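(* The following convergence holds in $\mathbb{L}^2$: $$n^{1-\sqrt{2}}\, N_{\tau_n}(0) \underset{n \to \infty}{\longrightarrow} \frac{\Gamma(2 \sqrt{2})}{\sqrt{2}\,\Gamma(\sqrt{2})^3}\, \mathfrak{M}_\infty,$$ where $\mathfrak{M}_\infty$ is the almost sure limit as $t\to\infty$ of the uniformly integrable martingale $\mathfrak{M}_t = \sum_{u\in\mathcal{A}} \mathrm{Leb}(R_u(0))^{\sqrt{2}-1}\,\mathbf{1}_{R_u(0)\in \mathrm{Q}(t)}$, $t\ge 0$.
   Context: Let $\Pi$ be a Poisson point process on $\mathbb{R}_+\times[0,1]^2$ with intensity $\mathrm{d}t\otimes \mathrm{d}x\,\mathrm{d}y$, with atoms $((\tau_i,x_i,y_i),\, i\ge 1)$ ranked in increasing order of $\tau_i$; put $\tau_0=0$. The process $(\mathrm{Q}(t))_{t\ge 0}$, with values in the finite coverings of $[0,1]^2$ by closed rectangles with disjoint interiors, is defined by: $\mathrm{Q}(t)=\{[0,1]^2\}$ for $t\in[0,\tau_1)$; and for $t\in[\tau_i,\tau_{i+1})$, $\mathrm{Q}(t)$ is obtained from $\mathrm{Q}(\tau_{i-1})$ by replacing the (almost surely unique) rectangle $R$ of $\mathrm{Q}(\tau_{i-1})$ containing $(x_i,y_i)$ in its interior by the four closed rectangles $R\cap([0,x_i]\times[0,y_i])$, $R\cap([0,x_i]\times[y_i,1])$, $R\cap([x_i,1]\times[0,y_i])$, $R\cap([x_i,1]\times[y_i,1])$. For $x\in[0,1]$ let $S_x$ be the vertical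 segment $[(x,0),(x,1)]$ and $$N_t(x)=\#\{R\in \mathrm{Q}(t): R\cap S_x\neq\emptyset\}-1.$$ Let $\mathcal{A}=\bigcup_{n\ge0}\{0,1\}^n$ be the set of finite words over $\{0,1\}$, with $\{0,1\}^0=\{\varnothing\}$. The rectangles appearing in $(\mathrm{Q}(t))_{t\ge0}$ that intersect $S_x$ are labelled by $\mathcal{A}$: $R_\varnothing(x)=[0,1]^2$, and inductively, when a point of $\Pi$ falls in $R_u(x)$ and divides it into four rectangles, almost surely exactly two of them intersect $S_x$; the bottom one is $R_{u0}(x)$ and the top one is $R_{u1}(x)$. $\mathrm{Leb}$ denotes two-dimensional Lebesgue measure and $\Gamma$ the Euler gamma function. *)

theory Defs
  imports "HOL-Probability.Probability"
begin

section \<open>Poisson point processes\<close>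

definition point_count :: "('a \<Rightarrow> 'b set) \<Rightarrow> 'b set \<Rightarrow> 'a \<Rightarrow> ennreal" where
  "point_count \<Phi> B \<omega> = emeasure (count_space UNIV) (\<Phi> \<omega> \<inter> B)"

text \<open>
  A point process is a random set of points, without multiplicities. This loses nothing
  for the diffuse intensity used below, for which the points are almost surely distinct.
  Independence is asked for sequences of pairwise disjoint sets; finite families are
  covered, since empty sets may be appended.
\<close>

definition poisson_point_process ::
    "'a measure \<Rightarrow> 'b measure \<Rightarrow> ('a \<Rightarrow> 'b set) \<Rightarrow> bool" where
  "poisson_point_process M I \<Phi> \<longleftrightarrow>
     (\<forall>\<omega>\<in>space M. \<Phi> \<omega> \<subseteq> space I) \<and>
     (\<forall>B\<in>sets I. point_count \<Phi> B \<in> borel_measurable M) \<and>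
     (\<forall>B\<in>sets I. emeasure I B < \<infinity> \<longrightarrow>
        (\<forall>k::nat. measure M {\<omega>\<in>space M. point_count \<Phi> B \<omega> = of_nat k} =
           measure I B ^ k / fact k * exp (- measure I B))) \<and>
     (\<forall>B\<in>sets I. emeasure I B = \<infinity> \<longrightarrow> (AE \<omega> in M. point_count \<Phi> B \<omega> = \<infinity>)) \<and>
     (\<forall>B::nat \<Rightarrow> 'b set. range B \<subseteq> sets I \<and> disjoint_family B \<longrightarrow>
        prob_space.indep_vars M (\<lambda>_. borel) (\<lambda>j. point_count \<Phi> (B j)) UNIV)"

definition unit_square :: "(real \<times> real) set" where
  "unit_square = {0..1} \<times> {0..1}"

definition intensity :: "(real \<times> real \<times> real) measure" where
  "intensity = restrict_space lborel ({0..} \<times> unit_square)"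

text \<open>
  The atoms are \<open>(\<tau> i, p i)\<close> for \<open>i \<ge> 1\<close>; index \<open>0\<close> only carries the convention
  \<open>\<tau> 0 = 0\<close>, and the value of \<open>p 0\<close> is irrelevant.
\<close>

definition ranked_atoms ::
    "'a measure \<Rightarrow> ('a \<Rightarrow> (real \<times> real \<times> real) set) \<Rightarrow>
     (nat \<Rightarrow> 'a \<Rightarrow> real) \<Rightarrow> (nat \<Rightarrow> 'a \<Rightarrow> real \<times> real) \<Rightarrow> bool" where
  "ranked_atoms M \<Phi> \<tau> p \<longleftrightarrow>
     (\<forall>i. \<tau> i \<in> borel_measurable M) \<and> (\<forall>i. p i \<in> borel_measurable M) \<and>
     (AE \<omega> in M. \<tau> 0 \<omega> = 0 \<and> strict_mono (\<lambda>i. \<tau> i \<omega>) \<and>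
        \<Phi> \<omega> = (\<lambda>i. (\<tau> i \<omega>, p i \<omega>)) ` {1..})"

text \<open>
  The information carried by the points up to time \<open>t\<close>, completed by the null sets because
  the atoms are only almost surely determined by the point process.
\<close>

definition point_filtration ::
    "'a measure \<Rightarrow> ('a \<Rightarrow> (real \<times> real \<times> real) set) \<Rightarrow> real \<Rightarrow> 'a measure" where
  "point_filtration M \<Phi> t = sigma (space M)
     ({{\<omega>\<in>space M. point_count \<Phi> B \<omega> = of_nat k} | B (k::nat).
         B \<in> sets intensity \<and> B \<subseteq> {0..t} \<times> unit_square} \<union> null_sets M)"

section \<open>Quadtrees\<close>

text \<open>
  In this section the atoms are deterministic sequences \<open>\<tau>\<close> and \<open>p\<close>, to be applied
  to a realisation of the random atoms.
\<close>

definition quarters ::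
    "(real \<times> real) set \<Rightarrow> real \<times> real \<Rightarrow> (real \<times> real) set set" where
  "quarters R = (\<lambda>(a, b).
     {R \<inter> ({0..a} \<times> {0..b}), R \<inter> ({0..a} \<times> {b..1}),
      R \<inter> ({a..1} \<times> {0..b}), R \<inter> ({a..1} \<times> {b..1})})"

text \<open>\<open>quadtree p n\<close> is the covering obtained from the first \<open>n\<close> points \<open>p 1, \<dots>, p n\<close>.\<close>

primrec quadtree :: "(nat \<Rightarrow> real \<times> real) \<Rightarrow> nat \<Rightarrow> (real \<times> real) set set" where
  "quadtree p 0 = {unit_square}"
| "quadtree p (Suc n) =
     {R \<in> quadtree p n. p (Suc n) \<notin> interior R} \<union>
     (\<Union>R \<in> {R \<in> quadtree p n. p (Suc n) \<in> interior R}. quarters R (p (Suc n)))"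

text \<open>
  If \<open>\<tau>\<close> increases to infinity, the number of \<open>i \<ge> 1\<close> with \<open>\<tau> i \<le> t\<close>
  is the index \<open>i\<close> such that \<open>\<tau> i \<le> t < \<tau> (i + 1)\<close>.
\<close>

definition Q :: "(nat \<Rightarrow> real) \<Rightarrow> (nat \<Rightarrow> real \<times> real) \<Rightarrow> real \<Rightarrow> (real \<times> real) set set" where
  "Q \<tau> p t = quadtree p (card {i. 1 \<le> i \<and> \<tau> i \<le> t})"

definition vseg :: "real \<Rightarrow> (real \<times> real) set" where
  "vseg x = {x} \<times> {0..1}"

definition N :: "(nat \<Rightarrow> real) \<Rightarrow> (nat \<Rightarrow> real \<times> real) \<Rightarrow> real \<Rightarrow> real \<Rightarrow> real" where
  "N \<tau> p t x = real (card {R \<in> Q \<tau> p t. R \<inter> vseg x \<noteq> {}}) - 1"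

text \<open>
  \<open>splits p R i\<close>: the \<open>i\<close>-th point divides the rectangle \<open>R\<close>. Given a rectangle \<open>R\<close> that
  meets \<open>vseg x\<close>, \<open>child p x R c\<close> is the bottom (\<open>c = False\<close>) or top (\<open>c = True\<close>) one of the
  two pieces of \<open>R\<close> that meet \<open>vseg x\<close>; it is the empty set, which never belongs to a
  covering, if \<open>R\<close> is never divided. Almost surely exactly one of the left and the right
  piece meets \<open>vseg x\<close>, so that preferring the left piece is immaterial.
\<close>

definition splits :: "(nat \<Rightarrow> real \<times> real) \<Rightarrow> (real \<times> real) set \<Rightarrow> nat \<Rightarrow> bool" where
  "splits p R i \<longleftrightarrow> 1 \<le> i \<and> R \<in> quadtree p (i - 1) \<and> p i \<in> interior R"

definition child ::
    "(nat \<Rightarrow> real \<times> real) \<Rightarrow> real \<Rightarrow> (real \<times> real) set \<Rightarrow> bool \<Rightarrow> (real \<times> real) set" where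
  "child p x R c =
     (if \<exists>i. splits p R i then
        let (a, b) = p (LEAST i. splits p R i);
            J = (if c then {b..1} else {0..b});
            L = R \<inter> ({0..a} \<times> J)
        in if L \<inter> vseg x \<noteq> {} then L else R \<inter> ({a..1} \<times> J)
      else {})"

text \<open>
  Words over \<open>{0, 1}\<close> are Boolean lists, read from left to right: \<open>rect p x (u @ [c])\<close> is
  \<open>child p x (rect p x u) c\<close>.
\<close>

definition rect ::
    "(nat \<Rightarrow> real \<times> real) \<Rightarrow> real \<Rightarrow> bool list \<Rightarrow> (real \<times> real) set" where
  "rect p x u = foldl (child p x) unit_square u"

text \<open>
  The sum has finitely many nonzero terms, since the covering is finite and distinct words
  label distinct nonempty rectangles.
\<close>

definition \<MM> :: "(nat \<Rightarrow> real) \<Rightarrow> (nat \<Rightarrow> real \<times> real) \<Rightarrow> real \<Rightarrow> real" where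
  "\<MM> \<tau> p t = (\<Sum>\<^sub>\<infinity>u. measure lborel (rect p 0 u) powr (sqrt 2 - 1) *
                        of_bool (rect p 0 u \<in> Q \<tau> p t))"

section \<open>Martingales, uniform integrability and convergence in mean square\<close>

definition martingale ::
    "'a measure \<Rightarrow> (real \<Rightarrow> 'a measure) \<Rightarrow> (real \<Rightarrow> 'a \<Rightarrow> real) \<Rightarrow> bool" where
  "martingale M F X \<longleftrightarrow>
     filtration (space M) F \<and> (\<forall>t\<ge>0. subalgebra M (F t)) \<and>
     (\<forall>t\<ge>0. X t \<in> borel_measurable (F t) \<and> integrable M (X t)) \<and>
     (\<forall>s t. 0 \<le> s \<and> s \<le> t \<longrightarrow> (AE \<omega> in M. real_cond_exp M (F s) (X t) \<omega> = X s \<omega>))"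

definition uniformly_integrable :: "'a measure \<Rightarrow> ('i \<Rightarrow> 'a \<Rightarrow> real) \<Rightarrow> 'i set \<Rightarrow> bool" where
  "uniformly_integrable M X T \<longleftrightarrow>
     (\<forall>t\<in>T. integrable M (X t)) \<and>
     (\<forall>\<epsilon>>0. \<exists>K. \<forall>t\<in>T.
        (LINT \<omega>|M. \<bar>X t \<omega>\<bar> * indicator {\<omega>. \<bar>X t \<omega>\<bar> \<ge> K} \<omega>) \<le> \<epsilon>)"

definition converges_L2 ::
    "'a measure \<Rightarrow> (nat \<Rightarrow> 'a \<Rightarrow> real) \<Rightarrow> ('a \<Rightarrow> real) \<Rightarrow> bool" where
  "converges_L2 M X Y \<longleftrightarrow>
     (\<forall>n. X n \<in> borel_measurable M \<and> integrable M (\<lambda>\<omega>. (X n \<omega>)\<^sup>2)) \<and>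
     Y \<in> borel_measurable M \<and> integrable M (\<lambda>\<omega>. (Y \<omega>)\<^sup>2) \<and>
     (\<lambda>n. LINT \<omega>|M. (X n \<omega> - Y \<omega>)\<^sup>2) \<longlonglongrightarrow> 0"

end

(* The strips of the quadtree along the left edge form a Markov chain: a uniform point hits a strip
   of area m with probability m and then replaces m by m U V and m U (1 - V), with U, V uniform. So a
   sum of F(area) over the strips turns, in conditional mean, into the sum of T F, where
   T m^a = m^a + (2 / (a + 1)^2 - 1) m^(a + 1). Hence m^\<beta>, with \<beta> = sqrt 2 - 1, gives a
   martingale Z, and the mean number of strips after j points inside a strip of area m is the
   polynomial H_j(m), where H_0 = 1 and H_(j+1) = T H_j. It is the Bernstein transform of the sequence
   h_k = H_k(1), and a Vandermonde computation with Gauss's summation theorem gives h_k ~ c k^\<beta>.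
   Comparing, for fixed n, the martingale k |-> sum of H_(n-k)(area) with c n^\<beta> Z_k, step by
   step in mean square, yields N_n / n^\<beta> - c Z_n -> 0 in L2. The passage to the Poisson clock
   only needs that the positions are uniform and independent of the past positions and of all times. *)

theory Submission
  imports Defs
begin

section \<open>Gauss summation\<close>

text \<open>The numbers \<open>h_k\<close> are alternating binomial sums with heavy cancellation, so
  no termwise estimate shows their growth. But \<open>2 - (l + 1)^2\<close> factors over its roots
  \<beta> and - 2 - \<beta>, which makes the coefficients products of two generalised binomials;
  that is what opens the way to Vandermonde. In the mean square comparison the obstacle is that the
  asymptotics of \<open>H_j\<close> is relative to \<open>j^\<beta>\<close> and says nothing about
  the last points, where j = n - k is small. Each step therefore gets two bounds: a fine one for
  fixed k as n grows, and a coarse one for all k < n. The coarse one has a part weighted by the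
  total area, which adds up to only \<open>O(n^\<beta>)\<close>, and a part
  \<open>n^(2 \<beta>)\<close> times an energy that is summable because powers above \<beta> decay
  in mean. Tannery's theorem joins the two bounds. Positions are separated from times using nothing
  but counts in disjoint sets, on a time grid that is refined. The discrete filtration contains all
  arrival times from the start, so the number of points at a fixed time behaves there like a known
  constant.\<close>

lemma gbinomial_Suc_ratio:
  fixes a :: real
  shows "a gchoose Suc k = (a gchoose k) * (a - real k) / real (Suc k)"
  using gbinomial_absorption[of k a] gbinomial_absorb_comp[of a k]
  by (simp add: field_simps)

text \<open>From i to i + 1 the binomial is multiplied by \<open>(x - i) / (i + 1)\<close>, of
  modulus at most \<open>i / (i + 1)\<close> once i is at least 1; these factors telescope.\<close>

lemma abs_gbinomial_le_inverse:
  fixes x :: real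
  assumes "0 \<le> x" "x \<le> 1" "i \<ge> 1"
  shows "\<bar>x gchoose i\<bar> \<le> 1 / real i"
  using assms(3)
proof (induction i rule: dec_induct)
  case base
  then show ?case using assms by simp
next
  case (step i)
  have "\<bar>x gchoose Suc i\<bar> = \<bar>x gchoose i\<bar> * \<bar>x - real i\<bar> / real (Suc i)"
    unfolding gbinomial_Suc_ratio by (simp add: abs_mult)
  also have "\<dots> \<le> (1 / real i) * real i / real (Suc i)"
    using step assms by (intro divide_right_mono mult_mono) auto
  also have "\<dots> = 1 / real (Suc i)" using step by simp
  finally show ?case .
qed

lemma abs_gbinomial_le_1:
  fixes x :: real
  assumes "0 \<le> x" "x \<le> 1"
  shows "\<bar>x gchoose i\<bar> \<le> 1"
proof (cases "i = 0")
  case False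
  then have "\<bar>x gchoose i\<bar> \<le> 1 / real i" using abs_gbinomial_le_inverse[OF assms] by simp
  also have "\<dots> \<le> 1" using False by simp
  finally show ?thesis .
qed simp

text \<open>Absorption, \<open>i * ((1 + x) gchoose i) = (1 + x) * (x gchoose (i - 1))\<close>,
  reduces this to the bound by 1.\<close>

lemma abs_gbinomial_plus1_le:
  fixes x :: real
  assumes "0 \<le> x" "x \<le> 1" "i \<ge> 1"
  shows "\<bar>(1 + x) gchoose i\<bar> \<le> 2 / real i"
proof -
  obtain k where k: "i = Suc k" using assms(3) by (cases i) auto
  have "real (Suc k) * ((1 + x) gchoose Suc k) = (1 + x) * (x gchoose k)"
    using gbinomial_absorption[of k "1 + x"] by simp
  then have "(1 + x) gchoose i = (1 + x) * (x gchoose k) / real i" by (simp add: k field_simps)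
  also have "\<bar>\<dots>\<bar> \<le> 2 * 1 / real i"
    using assms abs_gbinomial_le_1[of x k]
      mult_mono[of "1 + x" 2 "\<bar>x gchoose k\<bar>" 1]
    by (auto simp: abs_mult k intro!: divide_right_mono)
  finally show ?thesis by simp
qed

text \<open>The i-th term of the hypergeometric series F(-x, -1 - x; k + 1; 1): the signs of the two
  rising factorials cancel, and the lower parameter becomes the binomial in the denominator.\<close>

definition gauss_term :: "real \<Rightarrow> nat \<Rightarrow> nat \<Rightarrow> real" where
  "gauss_term x k i = (x gchoose i) * ((1 + x) gchoose i) / real ((k + i) choose i)"

lemma abs_gauss_term_0_le:
  assumes "0 \<le> x" "x \<le> 1" "i \<ge> 1"
  shows "\<bar>gauss_term x 0 i\<bar> \<le> 2 / (real i)\<^sup>2"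
proof -
  have "\<bar>gauss_term x 0 i\<bar> \<le> (1 / real i) * (2 / real i)"
    unfolding gauss_term_def
    using mult_mono[OF abs_gbinomial_le_inverse[OF assms] abs_gbinomial_plus1_le[OF assms]]
    by (simp add: abs_mult)
  then show ?thesis by (simp add: power2_eq_square)
qed

lemma summable_abs_gauss_term_0:
  assumes "0 \<le> x" "x \<le> 1"
  shows "summable (\<lambda>i. \<bar>gauss_term x 0 i\<bar>)"
proof (rule summable_comparison_test)
  show "\<exists>N. \<forall>n\<ge>N. norm \<bar>gauss_term x 0 n\<bar> \<le> 2 / (real n)\<^sup>2"
    using abs_gauss_term_0_le[OF assms] by auto
  show "summable (\<lambda>n. 2 / (real n)\<^sup>2)"
    using summable_mult[OF inverse_power_summable[of 2, where 'a = real], of 2]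
    by (simp add: divide_inverse)
qed

lemma choose_ge_Suc:
  assumes "i \<ge> 1"
  shows "(k + i) choose i \<ge> k + 1"
  using assms
proof (induction i rule: dec_induct)
  case base
  then show ?case by simp
next
  case (step i)
  then show ?case by simp
qed

text \<open>For i \<ge> 1 the denominator is at least k + 1. Hence all terms but the zeroth vanish
  as k grows, with the series for k = 0 as a common majorant.\<close>

lemma abs_gauss_term_le:
  assumes "0 \<le> x" "x \<le> 1" "i \<ge> 1"
  shows "\<bar>gauss_term x k i\<bar> \<le> \<bar>gauss_term x 0 i\<bar> / real (Suc k)"
proof -
  have "real (Suc k) \<le> real ((k + i) choose i)"
    using choose_ge_Suc[OF assms(3), of k] by (simp del: of_nat_Suc)
  then have "\<bar>(x gchoose i) * ((1 + x) gchoose i)\<bar> / real ((k + i) choose i)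
      \<le> \<bar>(x gchoose i) * ((1 + x) gchoose i)\<bar> / real (Suc k)"
    by (intro divide_left_mono) (auto simp: zero_less_binomial_iff simp del: of_nat_Suc)
  then show ?thesis by (simp add: gauss_term_def)
qed

lemma summable_gauss_term:
  assumes "0 \<le> x" "x \<le> 1"
  shows "summable (\<lambda>i. \<bar>gauss_term x k i\<bar>)"
proof (rule summable_comparison_test)
  have "\<bar>gauss_term x k n\<bar> \<le> \<bar>gauss_term x 0 n\<bar>" if "n \<ge> 1" for n
  proof -
    have "\<bar>gauss_term x k n\<bar> \<le> \<bar>gauss_term x 0 n\<bar> / real (Suc k)"
      by (rule abs_gauss_term_le[OF assms that])
    also have "\<dots> \<le> \<bar>gauss_term x 0 n\<bar> / 1" by (intro divide_left_mono) auto
    finally show ?thesis by simp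
  qed
  then show "\<exists>N. \<forall>n\<ge>N. norm \<bar>gauss_term x k n\<bar> \<le> \<bar>gauss_term x 0 n\<bar>" by auto
  show "summable (\<lambda>n. \<bar>gauss_term x 0 n\<bar>)" by (rule summable_abs_gauss_term_0[OF assms])
qed

lemma gauss_term_Suc_left:
  "gauss_term x (Suc k) i = gauss_term x k i * real (Suc k) / real (Suc k + i)"
proof -
  have "Suc k * ((Suc k + i) choose i) = (Suc k + i) * ((k + i) choose i)"
    using binomial_absorb_comp[of "Suc (k+i)" i] by simp
  then have "real (Suc k) * real ((Suc k + i) choose i) = real (Suc k + i) * real ((k + i) choose i)"
    by (metis of_nat_mult)
  moreover have "real ((Suc k + i) choose i) > 0" "real ((k + i) choose i) > 0"
    by (simp_all add: zero_less_binomial_iff)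
  ultimately show ?thesis unfolding gauss_term_def
    by (simp del: of_nat_Suc of_nat_add add: divide_simps)
qed

lemma gauss_term_Suc_right:
  "gauss_term x k (Suc i) = gauss_term x k i * (x - i) * (1 + x - i) / (real (Suc i) * real (Suc k + i))"
proof -
  have "Suc i * ((k + Suc i) choose Suc i) = (k + Suc i) * ((k + i) choose i)"
    using binomial_absorption[of i "k + Suc i"] by simp
  then have *: "real (Suc i) * real ((k + Suc i) choose Suc i) = real (Suc k + i) * real ((k + i) choose i)"
    by (simp only: of_nat_mult[symmetric] add_Suc add_Suc_right)
  have "real ((k + Suc i) choose Suc i) > 0" "real ((k + i) choose i) > 0"
    by (simp_all del: binomial_Suc_Suc add: zero_less_binomial_iff)
  moreover from * have "real ((k + Suc i) choose Suc i) = real (Suc k + i) * real ((k + i) choose i) / real (Suc i)"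
    by (simp add: field_simps)
  moreover have "(g * u / I) * (h * v / I) / (K * A / I) = g * h / A * u * v / (I * K)"
    if "A > 0" "I > 0" "K > 0" for g h u v A I K :: real
    using that by (simp add: divide_simps)
  ultimately show ?thesis unfolding gauss_term_def gbinomial_Suc_ratio
    by (simp del: of_nat_Suc of_nat_add binomial_Suc_Suc)
qed

text \<open>Contiguous relation behind Gauss's summation theorem; the difference of the two
  series telescopes.\<close>

lemma gauss_sum_contiguous:
  assumes "0 \<le> x" "x \<le> 1"
  shows "real (Suc k) * (k + 2 + 2 * x) * (\<Sum>i. gauss_term x k i) =
         (k + 1 + x) * (k + 2 + x) * (\<Sum>i. gauss_term x (Suc k) i)"
proof -
  \<comment> \<open>A telescoping certificate of Zeilberger type. The factor i gives
    \<open>u 0 = 0\<close>, and the quadratic decay of the terms makes \<open>u i\<close> tend to 0,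
    so the telescoped series has sum 0.\<close>
  define u where "u i = - real (Suc k) * real i * gauss_term x k i" for i
  have step: "real (Suc k) * (k + 2 + 2 * x) * gauss_term x k i -
      (k + 1 + x) * (k + 2 + x) * gauss_term x (Suc k) i = u (Suc i) - u i" for i
  proof -
    define g where "g = gauss_term x k i"
    have "real (Suc k + i) > 0" "real (Suc i) > 0" by auto
    then show ?thesis
      unfolding u_def gauss_term_Suc_left gauss_term_Suc_right g_def[symmetric]
      by (simp add: divide_simps) algebra
  qed
  have "(\<lambda>i. \<bar>u i\<bar>) \<longlonglongrightarrow> 0"
  proof (rule tendsto_sandwich)
    show "\<forall>\<^sub>F n in sequentially. 0 \<le> \<bar>u n\<bar>" by simp
    have "\<bar>u n\<bar> \<le> 2 / real n" if "n \<ge> 1" for n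
    proof -
      have "\<bar>u n\<bar> = real (Suc k) * real n * \<bar>gauss_term x k n\<bar>" by (simp add: u_def abs_mult)
      also have "\<dots> \<le> real (Suc k) * real n * ((2 / (real n)\<^sup>2) / real (Suc k))"
        using abs_gauss_term_le[OF assms that, of k] abs_gauss_term_0_le[OF assms that]
        by (intro mult_left_mono order_trans[OF abs_gauss_term_le[OF assms that]] divide_right_mono) auto
      also have "\<dots> = 2 / real n" using that by (simp add: power2_eq_square del: of_nat_Suc)
      finally show ?thesis .
    qed
    then show "\<forall>\<^sub>F n in sequentially. \<bar>u n\<bar> \<le> 2 / real n"
      by (auto simp: eventually_sequentially)
    show "(\<lambda>n. 2 / real n) \<longlonglongrightarrow> 0" by real_asymp
  qed auto
  then have "u \<longlonglongrightarrow> 0" by (simp add: tendsto_rabs_zero_iff)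
  from telescope_sums[OF this] have tel: "(\<lambda>i. u (Suc i) - u i) sums 0" by (simp add: u_def)
  have s: "summable (gauss_term x j)" for j
    using summable_rabs_cancel[OF summable_gauss_term[OF assms]] .
  have "(\<lambda>i. real (Suc k) * (k + 2 + 2 * x) * gauss_term x k i -
      (k + 1 + x) * (k + 2 + x) * gauss_term x (Suc k) i) sums
    (real (Suc k) * (k + 2 + 2 * x) * (\<Sum>i. gauss_term x k i) -
         (k + 1 + x) * (k + 2 + x) * (\<Sum>i. gauss_term x (Suc k) i))"
    by (intro sums_diff sums_mult summable_sums s)
  then have "(\<lambda>i. u (Suc i) - u i) sums
    (real (Suc k) * (k + 2 + 2 * x) * (\<Sum>i. gauss_term x k i) -
         (k + 1 + x) * (k + 2 + x) * (\<Sum>i. gauss_term x (Suc k) i))"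
    by (simp only: step)
  from sums_unique2[OF this tel] show ?thesis by (simp add: ac_simps)
qed

text \<open>Only the term i = 0, which equals 1, survives: the tail is at most
  \<open>B / (k + 1)\<close>.\<close>

lemma gauss_sum_limit:
  assumes "0 \<le> x" "x \<le> 1"
  shows "(\<lambda>k. \<Sum>i. gauss_term x k i) \<longlonglongrightarrow> 1"
proof -
  define B where "B = (\<Sum>i. \<bar>gauss_term x 0 (Suc i)\<bar>)"
  have s: "summable (\<lambda>i. \<bar>gauss_term x j i\<bar>)" for j
    by (rule summable_gauss_term[OF assms])
  then have s': "summable (\<lambda>i. \<bar>gauss_term x j (Suc i)\<bar>)" for j
    using summable_Suc_iff[of "\<lambda>i. \<bar>gauss_term x j i\<bar>"] s[of j] by simp
  have "\<bar>(\<Sum>i. gauss_term x k i) - 1\<bar> \<le> B / real (Suc k)" for k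
  proof -
    have "(\<Sum>i. gauss_term x k i) = gauss_term x k 0 + (\<Sum>i. gauss_term x k (Suc i))"
      using suminf_split_head[OF summable_rabs_cancel[OF s[of k]]] by simp
    then have "\<bar>(\<Sum>i. gauss_term x k i) - 1\<bar> = \<bar>\<Sum>i. gauss_term x k (Suc i)\<bar>"
      by (simp add: gauss_term_def)
    also have "\<dots> \<le> (\<Sum>i. \<bar>gauss_term x k (Suc i)\<bar>)"
      by (rule summable_rabs[OF s'])
    also have "\<dots> \<le> (\<Sum>i. \<bar>gauss_term x 0 (Suc i)\<bar> / real (Suc k))"
      using abs_gauss_term_le[OF assms] by (intro suminf_le s' summable_divide) auto
    also have "\<dots> = B / real (Suc k)" unfolding B_def by (rule suminf_divide[OF s'])
    finally show ?thesis .
  qed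
  then have "\<forall>\<^sub>F k in sequentially. norm ((\<Sum>i. gauss_term x k i) - 1) \<le> B / real (Suc k)"
    by simp
  then have "(\<lambda>k. (\<Sum>i. gauss_term x k i) - 1) \<longlonglongrightarrow> 0"
    by (rule Lim_null_comparison) (rule LIMSEQ_Suc[OF lim_const_over_n])
  then show ?thesis by (simp add: LIM_zero_iff)
qed

text \<open>Upper negation turns the binomial into \<open>(-1)^n * ((- x - 1) gchoose n)\<close>,
  whose growth is known. The power \<open>n^x\<close> stays an exponential, the form in which that
  asymptotics is stated.\<close>

lemma gbinomial_shift_limit:
  fixes x :: real
  shows "(\<lambda>n. ((real n + x) gchoose n) / exp (x * ln (real n))) \<longlonglongrightarrow> inverse (Gamma (1 + x))"
proof -
  have "((real n + x) gchoose n) = (-1)^n * ((- x - 1) gchoose n)" for n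
  proof -
    have "(- x - 1) gchoose n = (- 1) ^ n * ((real n + x) gchoose n)"
    proof -
      have "- x - 1 = - (x + 1)" "x + 1 + real n - 1 = real n + x" by simp_all
      then show ?thesis by (simp only: gbinomial_minus)
    qed
    then show ?thesis by (simp add: mult.assoc[symmetric] power_mult_distrib[symmetric])
  qed
  moreover have "(\<lambda>n. ((- x - 1) gchoose n) / ((- 1) ^ n / exp ((- x - 1 + 1) * ln (real n)))) \<longlonglongrightarrow> inverse (Gamma (- (- x - 1)))"
    using gbinomial_asymptotic[of "- x - 1"] by simp
  ultimately show ?thesis
    by (simp add: exp_minus divide_inverse mult_ac power_inverse[symmetric])
qed

text \<open>The contiguous relation iterated from 0 to k; its linear factors, each divided by the
  running index, accumulate to shifted binomials.\<close>

lemma gauss_sum_shift: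
  assumes "0 \<le> x" "x \<le> 1"
  shows "(\<Sum>i. gauss_term x 0 i) * ((real k + (1 + 2 * x)) gchoose k) =
     ((real k + x) gchoose k) * ((real k + (1 + x)) gchoose k) * (\<Sum>i. gauss_term x k i)"
proof (induction k)
  case (Suc k)
  have sh: "((real (Suc k) + y) gchoose Suc k) = ((real k + y) gchoose k) * (real k + 1 + y) / real (Suc k)" for y
    using gbinomial_absorption[of k "real (Suc k) + y"] by (simp add: field_simps)
  have *: "(\<Sum>i. gauss_term x k i) * (k + 2 + 2 * x) / real (Suc k) =
      (k + 1 + x) / real (Suc k) * ((k + 2 + x) / real (Suc k)) * (\<Sum>i. gauss_term x (Suc k) i)"
  proof -
    have "S * A / K = B / K * (C / K) * S'" if "K * A * S = B * C * S'" "K > 0" for S A K B C S' :: real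
      using that by (simp add: divide_simps mult_ac)
    from this[OF gauss_sum_contiguous[OF assms, of k]] show ?thesis by (simp add: add_ac)
  qed
  have "(\<Sum>i. gauss_term x 0 i) * ((real (Suc k) + (1 + 2 * x)) gchoose (Suc k)) =
    ((\<Sum>i. gauss_term x 0 i) * ((real k + (1 + 2 * x)) gchoose k)) * (k + 2 + 2 * x) / real (Suc k)"
    by (subst sh) (simp add: add_ac)
  also have "\<dots> = ((real k + x) gchoose k) * ((real k + (1 + x)) gchoose k) *
      ((\<Sum>i. gauss_term x k i) * (k + 2 + 2 * x) / real (Suc k))"
    unfolding Suc.IH by simp
  also have "\<dots> = ((real (Suc k) + x) gchoose Suc k) * ((real (Suc k) + (1 + x)) gchoose Suc k) * (\<Sum>i. gauss_term x (Suc k) i)"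
    unfolding * sh by (simp add: add_ac)
  finally show ?case .
qed simp

text \<open>Gauss's value of F(-x, -1 - x; 1; 1). As k tends to infinity in
  \<open>gauss_sum_shift\<close>, the series on the right tends to 1, and the powers of k cancel
  because \<open>1 + 2 * x = x + (1 + x)\<close>.\<close>

lemma gauss_sum:
  assumes "0 < x" "x \<le> 1"
  shows "(\<Sum>i. gauss_term x 0 i) = Gamma (2 + 2 * x) / (Gamma (1 + x) * Gamma (2 + x))"
proof -
  let ?S = "\<Sum>i. gauss_term x 0 i"
  let ?e = "\<lambda>y n. ((real n + y) gchoose n) / exp (y * ln (real n))"
  have "(\<lambda>k. ?S * ?e (1 + 2 * x) k) \<longlonglongrightarrow> ?S * inverse (Gamma (1 + (1 + 2 * x)))"
    by (intro tendsto_mult gbinomial_shift_limit tendsto_const)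
  moreover have "(\<lambda>k. ?S * ?e (1 + 2 * x) k) = (\<lambda>k. ?e x k * ?e (1 + x) k * (\<Sum>i. gauss_term x k i))"
  proof
    fix k
    have "exp ((1 + 2 * x) * ln (real k)) = exp (x * ln (real k)) * exp ((1 + x) * ln (real k))"
      by (simp add: exp_add[symmetric] algebra_simps)
    then show "?S * ?e (1 + 2 * x) k = ?e x k * ?e (1 + x) k * (\<Sum>i. gauss_term x k i)"
      using gauss_sum_shift[of x k] assms by (simp add: field_simps)
  qed
  moreover have "(\<lambda>k. ?e x k * ?e (1 + x) k * (\<Sum>i. gauss_term x k i)) \<longlonglongrightarrow>
      inverse (Gamma (1 + x)) * inverse (Gamma (1 + (1 + x))) * 1"
    using assms by (intro tendsto_mult gbinomial_shift_limit gauss_sum_limit) auto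
  ultimately have "?S * inverse (Gamma (1 + (1 + 2 * x))) = inverse (Gamma (1 + x)) * inverse (Gamma (1 + (1 + x))) * 1"
    by (simp only: LIMSEQ_unique)
  moreover have "Gamma (2 + 2 * x) > 0"
    using assms by (auto intro!: Gamma_real_pos)
  moreover have "1 + (1 + 2 * x) = 2 + 2 * x" "1 + (1 + x) = 2 + x" by simp_all
  moreover have "S = g / (h * j)" if "S * inverse g = inverse h * inverse j * 1" "g > 0" for S g h j :: real
  proof -
    have "S = (S * inverse g) * g" using that(2) by simp
    also have "\<dots> = g / (h * j)" unfolding that(1) by (simp add: divide_inverse)
    finally show ?thesis .
  qed
  ultimately show ?thesis by metis
qed

section \<open>Mean number of strips\<close>

definition \<beta> :: real where "\<beta> = sqrt 2 - 1"

lemma \<beta>_quadratic: "\<beta> * \<beta> + 2 * \<beta> = 1"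
  by (simp add: \<beta>_def algebra_simps)

text \<open>The rational lower bound 2 / 5 serves \<open>decay_pos\<close>, where
  \<open>2 * \<beta>\<close> has to lie beyond the zero of \<open>rate\<close>.\<close>

lemma \<beta>_bounds: "0 < \<beta>" "\<beta> \<le> 1" "2 / 5 < \<beta>" "\<beta> < 1 / 2"
proof -
  have "7 / 5 < sqrt 2" by (rule real_less_rsqrt) (simp add: power2_eq_square)
  moreover have "sqrt 2 < 3 / 2" by (rule real_less_lsqrt) (auto simp: power2_eq_square)
  ultimately show "0 < \<beta>" "\<beta> \<le> 1" "2 / 5 < \<beta>" "\<beta> < 1 / 2" by (auto simp: \<beta>_def)
qed

text \<open>A uniform point in a strip cuts it into relative areas U V and U (1 - V), each with a-th
  moment \<open>1 / (a + 1)^2\<close>. So \<open>rate a\<close> is the mean change of the sum of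
  a-th powers, relative to \<open>m^a\<close>, given that the strip is hit.\<close>

definition rate :: "real \<Rightarrow> real" where
  "rate a = 2 / (a + 1)\<^sup>2 - 1"

lemma rate_\<beta>: "rate \<beta> = 0"
  by (simp add: rate_def \<beta>_def)

definition rate_prod :: "nat \<Rightarrow> real" where
  "rate_prod i = (\<Prod>l<i. rate (real l))"

lemma gbinomial_Suc_shift:
  fixes y :: real
  shows "((real (Suc k) + y) gchoose Suc k) = ((real k + y) gchoose k) * (real k + 1 + y) / real (Suc k)"
  using gbinomial_absorption[of k "real (Suc k) + y"] by (simp add: field_simps)

text \<open>The numerator of \<open>rate\<close> is \<open>2 - (i + 1)^2\<close>, with roots \<beta>
  and - 2 - \<beta> in i. Each of the two linear factors takes one factor \<open>i + 1\<close> of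
  the denominator, as the recursion of a generalised binomial requires.\<close>

lemma rate_factor: "rate (real i) = (\<beta> - real i) * (real i + 1 + (1 + \<beta>)) / (real (Suc i) * real (Suc i))"
proof -
  have "(\<beta> - real i) * (real i + 1 + (1 + \<beta>)) = 2 - real (Suc i) * real (Suc i)"
    using \<beta>_quadratic by (simp add: algebra_simps)
  moreover have "real (Suc i) * real (Suc i) > 0" by simp
  ultimately show ?thesis
    by (simp add: rate_def power2_eq_square diff_divide_distrib add_ac)
qed

lemma rate_prod_gbinomial: "rate_prod i = (\<beta> gchoose i) * ((real i + (1 + \<beta>)) gchoose i)"
proof (induction i)
  case (Suc i)
  have "rate_prod (Suc i) = rate_prod i * rate (real i)" by (simp add: rate_prod_def)
  also have "\<dots> = (\<beta> gchoose Suc i) * ((real (Suc i) + (1 + \<beta>)) gchoose Suc i)"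
    unfolding Suc.IH gbinomial_Suc_shift[of i "1 + \<beta>"] gbinomial_Suc_ratio[of \<beta> i] rate_factor by (simp del: of_nat_Suc)
  finally show ?case .
qed (simp add: rate_prod_def)

definition mean_leaves :: "nat \<Rightarrow> real" where
  "mean_leaves n = (\<Sum>i\<le>n. real (n choose i) * rate_prod i)"

text \<open>The coefficients \<open>rate_prod i\<close> alternate in sign from i = 1 on, so the
  defining sum hides its size in cancellations. Two Vandermonde convolutions, one in each binomial
  factor, exchange it for a sum over j that converges after division by a single binomial.\<close>

lemma mean_leaves_Vandermonde:
  "mean_leaves n = (\<Sum>j\<le>n. ((1 + \<beta>) gchoose j) * (real (n choose j) * ((real (n - j) + \<beta>) gchoose n)))"
proof -
  \<comment> \<open>First convolution, splitting the upper index into \<open>1 + \<beta>\<close> and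
    i. The range is extended to n, where \<open>i choose j\<close> vanishes, so that the double sum
    below has a rectangular domain.\<close>
  have 1: "(real i + (1 + \<beta>)) gchoose i = (\<Sum>j\<le>n. ((1 + \<beta>) gchoose j) * real (i choose j))" if "i \<le> n" for i
  proof -
    have "(real i + (1 + \<beta>)) gchoose i = (\<Sum>j\<le>i. ((1 + \<beta>) gchoose j) * (real i gchoose (i - j)))"
      using gbinomial_Vandermonde[of "1 + \<beta>" "real i" i] by (simp add: add_ac atLeast0AtMost)
    also have "\<dots> = (\<Sum>j\<le>i. ((1 + \<beta>) gchoose j) * real (i choose j))"
      by (intro sum.cong refl) (auto simp: binomial_gbinomial[symmetric] binomial_symmetric[symmetric])
    also have "\<dots> = (\<Sum>j\<le>n. ((1 + \<beta>) gchoose j) * real (i choose j))"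
      using that by (intro sum.mono_neutral_left) auto
    finally show ?thesis .
  qed
  \<comment> \<open>Second convolution: with \<open>C(n,i) C(i,j) = C(n,j) C(n-j,n-i)\<close> the
    sum over i becomes one with upper indices \<beta> and n - j.\<close>
  have 2: "(\<Sum>i\<le>n. real (n choose i) * real (i choose j) * (\<beta> gchoose i))
      = real (n choose j) * ((real (n - j) + \<beta>) gchoose n)" if "j \<le> n" for j
  proof -
    have "real (n choose i) * real (i choose j) = real (n choose j) * real ((n - j) choose (n - i))"
      if "i \<le> n" for i
    proof (cases "j \<le> i")
      case True
      then have "(n choose i) * (i choose j) = (n choose j) * ((n - j) choose (i - j))"
        using choose_mult that by simp
      moreover have "(n - j) choose (i - j) = (n - j) choose (n - i)"
        using binomial_symmetric[of "i - j" "n - j"] True that by simp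
      ultimately show ?thesis by (metis of_nat_mult)
    next
      case False
      then have "i choose j = 0" "(n - j) choose (n - i) = 0"
        using that \<open>j \<le> n\<close> by (auto intro!: binomial_eq_0)
      then show ?thesis by (simp only: mult_zero_right of_nat_0)
    qed
    then have "(\<Sum>i\<le>n. real (n choose i) * real (i choose j) * (\<beta> gchoose i)) =
       (\<Sum>i\<le>n. real (n choose j) * ((\<beta> gchoose i) * (real (n - j) gchoose (n - i))))"
      by (intro sum.cong refl) (auto simp: binomial_gbinomial mult_ac)
    also have "\<dots> = real (n choose j) * ((real (n - j) + \<beta>) gchoose n)"
      using gbinomial_Vandermonde[of \<beta> "real (n - j)" n]
      by (simp add: sum_distrib_left[symmetric] add_ac atLeast0AtMost)
    finally show ?thesis .
  qed
  have "mean_leaves n = (\<Sum>i\<le>n. \<Sum>j\<le>n. ((1 + \<beta>) gchoose j) * (real (n choose i) * real (i choose j) * (\<beta> gchoose i)))"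
    unfolding mean_leaves_def rate_prod_gbinomial
    by (intro sum.cong refl) (auto simp: 1 sum_distrib_left mult_ac)
  also have "\<dots> = (\<Sum>j\<le>n. \<Sum>i\<le>n. ((1 + \<beta>) gchoose j) * (real (n choose i) * real (i choose j) * (\<beta> gchoose i)))"
    by (rule sum.swap)
  also have "\<dots> = (\<Sum>j\<le>n. ((1 + \<beta>) gchoose j) * (real (n choose j) * ((real (n - j) + \<beta>) gchoose n)))"
    by (intro sum.cong refl) (simp only: sum_distrib_left[symmetric] 2 atMost_iff)
  finally show ?thesis .
qed

section \<open>Growth of the mean number of strips\<close>

definition falling_ratio :: "nat \<Rightarrow> nat \<Rightarrow> real" where
  "falling_ratio n j = (\<Prod>l<j. (real n - real l) / (real n + \<beta> - real l))"

text \<open>Isolates the dependence on n: one binomial of order \<open>n^\<beta>\<close> common to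
  all j, and for each j a ratio in [0, 1] that tends to 1. Without that ratio the sum over j is the
  Gauss series for k = 0.\<close>

lemma choose_mult_gbinomial_shift:
  assumes "j \<le> n"
  shows "real (n choose j) * ((real (n - j) + \<beta>) gchoose n) =
     ((real n + \<beta>) gchoose n) * ((\<beta> gchoose j) * falling_ratio n j)"
  using assms
proof (induction j)
  case 0
  then show ?case by (simp add: falling_ratio_def)
next
  case (Suc j)
  define x where "x = real (n - j) + \<beta>"
  have x: "x > 0" "real (n - Suc j) + \<beta> = x - 1" "x - real n = \<beta> - real j" "real n + \<beta> - real j = x"
    using Suc.prems \<beta>_bounds by (auto simp: x_def of_nat_diff)
  have a: "(x - 1) gchoose n = (x gchoose n) * (\<beta> - real j) / x"
    using gbinomial_absorb_comp[of x n] x by (simp add: field_simps)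
  have b: "real (n choose Suc j) = real (n choose j) * (real n - real j) / real (Suc j)"
    using gbinomial_Suc_ratio[of "real n" j] by (simp add: binomial_gbinomial)
  have "real (n choose Suc j) * ((real (n - Suc j) + \<beta>) gchoose n) =
      (real (n choose j) * (x gchoose n)) * ((real n - real j) / x) * ((\<beta> - real j) / real (Suc j))"
    unfolding x(2) a b by (simp add: mult_ac)
  also have "\<dots> = ((real n + \<beta>) gchoose n) * ((\<beta> gchoose Suc j) * falling_ratio n (Suc j))"
    using Suc unfolding x_def[symmetric]
    by (simp add: falling_ratio_def x(4) gbinomial_Suc_ratio[of \<beta>] mult_ac del: of_nat_Suc)
  finally show ?case .
qed

lemma mean_leaves_eq:
  "mean_leaves n = ((real n + \<beta>) gchoose n) * (\<Sum>j\<le>n. gauss_term \<beta> 0 j * falling_ratio n j)"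
proof -
  have "mean_leaves n = (\<Sum>j\<le>n. ((real n + \<beta>) gchoose n) * (gauss_term \<beta> 0 j * falling_ratio n j))"
    unfolding mean_leaves_Vandermonde
    by (intro sum.cong refl)
       (simp only: choose_mult_gbinomial_shift atMost_iff, simp add: gauss_term_def mult_ac)
  then show ?thesis by (simp add: sum_distrib_left)
qed

lemma falling_ratio_bounds:
  assumes "j \<le> n" shows "0 \<le> falling_ratio n j" "falling_ratio n j \<le> 1"
  unfolding falling_ratio_def using assms \<beta>_bounds
  by (auto intro!: prod_nonneg prod_le_1 divide_nonneg_nonneg divide_le_eq_1_pos[THEN iffD2])

lemma falling_ratio_limit: "(\<lambda>n. falling_ratio n j) \<longlonglongrightarrow> 1"
proof -
  have "(\<lambda>n. (real n - real l) / (real n + \<beta> - real l)) \<longlonglongrightarrow> 1" for l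
    by real_asymp
  from tendsto_prod[of "{..<j}", OF this] show ?thesis
    by (simp add: falling_ratio_def)
qed

definition leaf_const :: real where
  "leaf_const = Gamma (2 * sqrt 2) / (sqrt 2 * Gamma (sqrt 2) ^ 3)"

text \<open>Tannery's theorem, with the absolutely convergent Gauss series as majorant, sums the
  limits over j; the common binomial contributes \<open>1 / Gamma (1 + \<beta>)\<close>.\<close>

lemma mean_leaves_asymp: "(\<lambda>n. mean_leaves n / real n powr \<beta>) \<longlonglongrightarrow> leaf_const"
proof -
  have "eventually (\<lambda>n. summable (\<lambda>j. norm (if j \<le> n then gauss_term \<beta> 0 j * falling_ratio n j else 0))) sequentially
    \<and> summable (\<lambda>j. norm (gauss_term \<beta> 0 j)) \<and>
    ((\<lambda>n. \<Sum>j. if j \<le> n then gauss_term \<beta> 0 j * falling_ratio n j else 0) \<longlongrightarrow> (\<Sum>j. gauss_term \<beta> 0 j)) sequentially"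
  proof (rule tannerys_theorem)
    fix j
    have "(\<lambda>n. gauss_term \<beta> 0 j * falling_ratio n j) \<longlonglongrightarrow> gauss_term \<beta> 0 j * 1"
      by (intro tendsto_mult falling_ratio_limit tendsto_const)
    moreover have "\<forall>\<^sub>F n in sequentially. gauss_term \<beta> 0 j * falling_ratio n j =
        (if j \<le> n then gauss_term \<beta> 0 j * falling_ratio n j else 0)"
      using eventually_ge_at_top[of j] by eventually_elim simp
    ultimately show "(\<lambda>n. if j \<le> n then gauss_term \<beta> 0 j * falling_ratio n j else 0) \<longlonglongrightarrow> gauss_term \<beta> 0 j"
      using filterlim_cong by fastforce
  next
    have "norm (if j \<le> n then gauss_term \<beta> 0 j * falling_ratio n j else 0) \<le> \<bar>gauss_term \<beta> 0 j\<bar>" for j n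
      using falling_ratio_bounds[of j n] by (auto simp: abs_mult mult_left_le)
    then show "\<forall>\<^sub>F (j, n) in at_top \<times>\<^sub>F sequentially.
       norm (if j \<le> n then gauss_term \<beta> 0 j * falling_ratio n j else 0) \<le> \<bar>gauss_term \<beta> 0 j\<bar>"
      by (intro always_eventually) auto
  next
    show "summable (\<lambda>j. \<bar>gauss_term \<beta> 0 j\<bar>)"
      using summable_abs_gauss_term_0 \<beta>_bounds by simp
  qed simp
  moreover have "(\<Sum>j. if j \<le> n then gauss_term \<beta> 0 j * falling_ratio n j else 0) =
      (\<Sum>j\<le>n. gauss_term \<beta> 0 j * falling_ratio n j)" for n
    by (subst suminf_finite[of "{..n}"]) auto
  ultimately have S: "(\<lambda>n. \<Sum>j\<le>n. gauss_term \<beta> 0 j * falling_ratio n j) \<longlonglongrightarrow> (\<Sum>j. gauss_term \<beta> 0 j)"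
    by simp
  have L: "(\<lambda>n. ((real n + \<beta>) gchoose n) / exp (\<beta> * ln (real n)) *
     (\<Sum>j\<le>n. gauss_term \<beta> 0 j * falling_ratio n j)) \<longlonglongrightarrow> inverse (Gamma (1 + \<beta>)) * (\<Sum>j. gauss_term \<beta> 0 j)"
    by (intro tendsto_mult gbinomial_shift_limit S)
  \<comment> \<open>The three factors \<open>Gamma (sqrt 2)\<close> come from the common binomial
    and from \<open>Gamma (1 + \<beta>)\<close> and \<open>Gamma (2 + \<beta>)\<close> in Gauss's
    value; the last one also yields \<open>sqrt 2\<close>.\<close>
  have eqs: "1 + \<beta> = sqrt 2" "2 + \<beta> = sqrt 2 + 1" "2 + 2 * \<beta> = 2 * sqrt 2" by (auto simp: \<beta>_def)
  have G1: "Gamma (sqrt 2 + 1) = sqrt 2 * Gamma (sqrt 2)"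
    by (rule Gamma_plus1) (auto dest!: nonpos_Ints_nonpos)
  have "(\<Sum>j. gauss_term \<beta> 0 j) = Gamma (2 * sqrt 2) / (Gamma (sqrt 2) * (sqrt 2 * Gamma (sqrt 2)))"
    using gauss_sum[OF \<beta>_bounds(1,2)] by (simp only: eqs G1)
  moreover have "inverse g * (G / (g * (s * g))) = G / (s * g ^ 3)" for g G s :: real
    by (simp add: divide_inverse power3_eq_cube mult_ac)
  ultimately have "inverse (Gamma (1 + \<beta>)) * (\<Sum>j. gauss_term \<beta> 0 j) = leaf_const"
    unfolding leaf_const_def by (simp only: eqs)
  then show ?thesis
  proof -
    have "\<forall>\<^sub>F n in sequentially. ((real n + \<beta>) gchoose n) / exp (\<beta> * ln (real n)) *
     (\<Sum>j\<le>n. gauss_term \<beta> 0 j * falling_ratio n j) = mean_leaves n / real n powr \<beta>"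
      using eventually_gt_at_top[of 0] by eventually_elim (simp add: mean_leaves_eq powr_def)
    then show ?thesis using L \<open>inverse (Gamma (1 + \<beta>)) * (\<Sum>j. gauss_term \<beta> 0 j) = leaf_const\<close>
      using filterlim_cong by fastforce
  qed
qed

text \<open>This is \<open>H_j\<close>: T is the identity plus the weighted shift taking
  \<open>m^i\<close> to \<open>rate i * m^(i + 1)\<close>, whose i-th power maps 1 to
  \<open>rate_prod i * m^i\<close>; the binomial theorem expands the j-th power of T.\<close>

definition leaf_poly :: "nat \<Rightarrow> real \<Rightarrow> real" where
  "leaf_poly j m = (\<Sum>i\<le>j. real (j choose i) * rate_prod i * m ^ i)"

lemma leaf_poly_at_1: "leaf_poly j 1 = mean_leaves j"
  by (simp add: leaf_poly_def mean_leaves_def)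

text \<open>The i-th binomial moment of a binomial(j, m) variable. Terms with k < i vanish, and the
  others reduce to the expansion of \<open>(m + (1 - m))^(j - i)\<close>.\<close>

lemma sum_choose_Bernstein:
  assumes "i \<le> j"
  shows "(\<Sum>k\<le>j. real (k choose i) * Bernstein j k m) = real (j choose i) * m ^ i"
proof -
  have "(\<Sum>k\<le>j. real (k choose i) * Bernstein j k m) = (\<Sum>k\<in>{i..j}. real (k choose i) * Bernstein j k m)"
    by (intro sum.mono_neutral_right) (auto simp: not_le)
  also have "\<dots> = (\<Sum>k\<in>{i..j}. real (j choose i) * m ^ i * (real ((j - i) choose (k - i)) * m ^ (k - i) * (1 - m) ^ (j - i - (k - i))))"
  proof (intro sum.cong refl)
    fix k assume k: "k \<in> {i..j}"
    have "real (j choose k) * real (k choose i) = real (j choose i) * real ((j - i) choose (k - i))"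
      using choose_mult[of i k j] k by (metis atLeastAtMost_iff of_nat_mult)
    moreover have "m ^ k = m ^ i * m ^ (k - i)" using k by (simp add: power_add[symmetric])
    moreover have "j - i - (k - i) = j - k" using k by simp
    ultimately show "real (k choose i) * Bernstein j k m = real (j choose i) * m ^ i * (real ((j - i) choose (k - i)) * m ^ (k - i) * (1 - m) ^ (j - i - (k - i)))"
      unfolding Bernstein_def by (simp add: mult_ac)
  qed
  also have "\<dots> = real (j choose i) * m ^ i * (\<Sum>k\<in>{i..j}. real ((j - i) choose (k - i)) * m ^ (k - i) * (1 - m) ^ (j - i - (k - i)))"
    by (simp only: sum_distrib_left)
  also have "(\<Sum>k\<in>{i..j}. real ((j - i) choose (k - i)) * m ^ (k - i) * (1 - m) ^ (j - i - (k - i))) =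
     (\<Sum>k\<le>j - i. real ((j - i) choose k) * m ^ k * (1 - m) ^ (j - i - k))"
    by (rule sum.reindex_bij_witness[of _ "\<lambda>k. k + i" "\<lambda>k. k - i"]) (use assms in auto)
  also have "\<dots> = 1"
    using binomial_ring[of m "1 - m" "j - i"] by simp
  finally show ?thesis by simp
qed

text \<open>Of j uniform points a binomial(j, m) number falls into a strip of area m, and k points
  there produce \<open>mean_leaves k\<close> strips in the mean. The proof is algebraic: both sides
  have the same expansion in binomial moments.\<close>

lemma leaf_poly_Bernstein:
  "leaf_poly j m = (\<Sum>k\<le>j. mean_leaves k * Bernstein j k m)"
proof -
  have "mean_leaves k = (\<Sum>i\<le>j. real (k choose i) * rate_prod i)" if "k \<le> j" for k
    unfolding mean_leaves_def using that by (intro sum.mono_neutral_left) auto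
  then have "(\<Sum>k\<le>j. mean_leaves k * Bernstein j k m) =
     (\<Sum>k\<le>j. \<Sum>i\<le>j. rate_prod i * (real (k choose i) * Bernstein j k m))"
    by (intro sum.cong refl) (auto simp: sum_distrib_left sum_distrib_right mult_ac)
  also have "\<dots> = (\<Sum>i\<le>j. \<Sum>k\<le>j. rate_prod i * (real (k choose i) * Bernstein j k m))"
    by (rule sum.swap)
  also have "\<dots> = (\<Sum>i\<le>j. rate_prod i * (real (j choose i) * m ^ i))"
    by (intro sum.cong refl) (simp only: sum_distrib_left[symmetric] sum_choose_Bernstein atMost_iff)
  finally show ?thesis by (simp add: leaf_poly_def mult_ac)
qed

lemma mean_leaves_bounded:
  obtains C where "C > 0" "\<And>k. \<bar>mean_leaves k\<bar> \<le> 1 + C * real k powr \<beta>"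
proof -
  have "Bseq (\<lambda>n. mean_leaves n / real n powr \<beta>)"
    using mean_leaves_asymp convergentI convergent_imp_Bseq by blast
  then obtain C where C: "C > 0" "\<And>n. norm (mean_leaves n / real n powr \<beta>) \<le> C"
    using BseqE by blast
  have "\<bar>mean_leaves k\<bar> \<le> 1 + C * real k powr \<beta>" for k
  \<comment> \<open>At k = 0 the power \<open>0 powr \<beta>\<close> is 0 while the mean is 1; the
    summand 1 in the bound covers this case.\<close>
  proof (cases "k = 0")
    case True
    then show ?thesis by (simp add: mean_leaves_def rate_prod_def)
  next
    case False
    then have "real k powr \<beta> > 0" by simp
    then have "\<bar>mean_leaves k\<bar> \<le> C * real k powr \<beta>"
      using C(2)[of k] by (simp add: abs_divide pos_divide_le_eq)
    then show ?thesis by simp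
  qed
  with C(1) that show ?thesis by blast
qed

text \<open>In place of Jensen's inequality, \<open>y^\<beta> \<le> 1 + y\<close> is applied to y =
  k / (j m), which has mean 1 under the binomial weights; hence the factor 2.\<close>

lemma sum_powr_Bernstein_le:
  assumes "0 < m" "m \<le> 1"
  shows "(\<Sum>k\<le>j. real k powr \<beta> * Bernstein j k m) \<le> 2 * (real j * m) powr \<beta>"
proof (cases "j = 0")
  case False
  define x where "x = real j * m"
  have x: "x > 0" using False assms by (simp add: x_def)
  have le: "real k powr \<beta> \<le> x powr \<beta> * (1 + real k / x)" for k
  proof -
    define y where "y = real k / x"
    have y: "y \<ge> 0" using x by (simp add: y_def)
    have "y powr \<beta> \<le> 1 + y"
    proof (cases "y \<le> 1")
      case True
      then have "y powr \<beta> \<le> 1 powr \<beta>" using y \<beta>_bounds by (intro powr_mono2) auto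
      then show ?thesis using y by simp
    next
      case False
      then have "y powr \<beta> \<le> y powr 1" using \<beta>_bounds by (intro powr_mono) auto
      then show ?thesis using y by simp
    qed
    moreover have "real k powr \<beta> = x powr \<beta> * y powr \<beta>"
      using x y by (subst powr_mult[symmetric]) (auto simp: y_def)
    ultimately show ?thesis by (simp add: y_def mult_left_mono)
  qed
  have "(\<Sum>k\<le>j. real k powr \<beta> * Bernstein j k m) \<le> (\<Sum>k\<le>j. x powr \<beta> * (1 + real k / x) * Bernstein j k m)"
    using assms by (intro sum_mono mult_right_mono le Bernstein_nonneg) auto
  also have "\<dots> = x powr \<beta> * ((\<Sum>k\<le>j. Bernstein j k m) + (\<Sum>k\<le>j. real k * Bernstein j k m) / x)"
    by (simp add: algebra_simps sum.distrib sum_distrib_left sum_divide_distrib del: sum_Bernstein sum_k_Bernstein)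
  also have "\<dots> = 2 * x powr \<beta>" using x by (simp add: x_def[symmetric])
  finally show ?thesis by (simp add: x_def)
qed simp

text \<open>Valid for all j and m at once. The summand 1 covers strips that expect few points, where
  \<open>(j m)^\<beta>\<close> is small.\<close>

lemma leaf_poly_bounded:
  obtains C where "C > 0" "\<And>j m. 0 < m \<Longrightarrow> m \<le> 1 \<Longrightarrow> \<bar>leaf_poly j m\<bar> \<le> 1 + C * (real j * m) powr \<beta>"
proof -
  obtain C where C: "C > 0" "\<And>k. \<bar>mean_leaves k\<bar> \<le> 1 + C * real k powr \<beta>"
    using mean_leaves_bounded by blast
  have "\<bar>leaf_poly j m\<bar> \<le> 1 + (2 * C) * (real j * m) powr \<beta>" if m: "0 < m" "m \<le> 1" for j m
  proof -
    have "\<bar>leaf_poly j m\<bar> \<le> (\<Sum>k\<le>j. \<bar>mean_leaves k\<bar> * Bernstein j k m)"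
      unfolding leaf_poly_Bernstein using m
      by (intro order_trans[OF sum_abs] sum_mono) (simp add: abs_mult Bernstein_nonneg)
    also have "\<dots> \<le> (\<Sum>k\<le>j. (1 + C * real k powr \<beta>) * Bernstein j k m)"
      using m by (intro sum_mono mult_right_mono C Bernstein_nonneg) auto
    also have "\<dots> = (\<Sum>k\<le>j. Bernstein j k m) + C * (\<Sum>k\<le>j. real k powr \<beta> * Bernstein j k m)"
      by (simp add: algebra_simps sum.distrib sum_distrib_left del: sum_Bernstein)
    also have "\<dots> \<le> 1 + C * (2 * (real j * m) powr \<beta>)"
      using sum_powr_Bernstein_le[OF m, of j] C(1) by simp
    finally show ?thesis by simp
  qed
  with C(1) show ?thesis by (intro that[of "2 * C"]) auto
qed

text \<open>By \<open>leaf_poly_Bernstein\<close>, replacing \<open>mean_leaves k\<close> by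
  \<open>leaf_const * k^\<beta>\<close> leaves \<open>j^\<beta>\<close> times the Bernstein
  polynomial of \<open>t^\<beta>\<close>, up to the constant, and these polynomials converge
  uniformly on [0, 1]. The error is relative to \<open>j^\<beta>\<close>, not to
  \<open>(j m)^\<beta>\<close>, so that tiny areas are included.\<close>

lemma leaf_poly_asymp_uniform:
  assumes "\<epsilon> > 0"
  shows "\<exists>J. \<forall>j\<ge>J. \<forall>m. 0 \<le> m \<longrightarrow> m \<le> 1 \<longrightarrow>
     \<bar>leaf_poly j m - leaf_const * (real j * m) powr \<beta>\<bar> \<le> \<epsilon> * real j powr \<beta>"
proof -
  \<comment> \<open>The means contribute \<open>2 * e\<close>, once for large k and once for D, and
    the Bernstein approximation \<open>e\<close> times the modulus of \<open>leaf_const\<close>; the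
    divisor exceeds the sum of these multiples.\<close>
  define e where "e = \<epsilon> / (3 + \<bar>leaf_const\<bar>)"
  have e: "e > 0" using assms by (simp add: e_def)
  have e_sum: "3 * e + \<bar>leaf_const\<bar> * e = \<epsilon>"
  proof -
    have "3 + \<bar>leaf_const\<bar> > 0" by simp
    then have "(3 + \<bar>leaf_const\<bar>) * e = \<epsilon>" by (simp add: e_def)
    then show ?thesis by (simp add: algebra_simps)
  qed
  have "\<forall>\<^sub>F k in sequentially. \<bar>mean_leaves k / real k powr \<beta> - leaf_const\<bar> < e"
    using mean_leaves_asymp e by (auto dest!: tendstoD simp: dist_real_def)
  then obtain K where K: "\<And>k. k \<ge> K \<Longrightarrow> \<bar>mean_leaves k / real k powr \<beta> - leaf_const\<bar> < e"
    by (auto simp: eventually_sequentially)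
  \<comment> \<open>Absorbs the finitely many small k, about which the asymptotics says nothing; j
    is later so large that \<open>D \<le> e * j^\<beta>\<close>.\<close>
  define D where "D = (\<Sum>k\<le>K. \<bar>mean_leaves k - leaf_const * real k powr \<beta>\<bar>)"
  have mean: "\<bar>mean_leaves k - leaf_const * real k powr \<beta>\<bar> \<le> e * real k powr \<beta> + D" for k
  proof (cases "k \<le> K")
    case True
    then have "\<bar>mean_leaves k - leaf_const * real k powr \<beta>\<bar> \<le> D"
      unfolding D_def by (intro member_le_sum) auto
    then show ?thesis using e by (simp add: add_increasing)
  next
    case False
    then have p: "real k powr \<beta> > 0" by simp
    have "mean_leaves k - leaf_const * real k powr \<beta> =
      (mean_leaves k / real k powr \<beta> - leaf_const) * real k powr \<beta>"
      using p by (simp add: field_simps)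
    also have "\<bar>\<dots>\<bar> \<le> e * real k powr \<beta>"
      using K[of k] False unfolding abs_mult by (intro mult_mono) auto
    finally show ?thesis unfolding D_def by (simp add: add_increasing2 sum_nonneg)
  qed
  have cont: "continuous_on {0..1} (\<lambda>t::real. t powr \<beta>)"
    using \<beta>_bounds by (intro continuous_on_powr' continuous_intros) auto
  obtain J1 where J1: "\<And>n x. J1 \<le> n \<Longrightarrow> x \<in> {0..1} \<Longrightarrow>
      \<bar>x powr \<beta> - (\<Sum>k\<le>n. (real k / real n) powr \<beta> * Bernstein n k x)\<bar> < e"
    using Bernstein_Weierstrass[OF cont e] by blast
  have "filterlim (\<lambda>j. real j powr \<beta>) at_top sequentially"
    using \<beta>_bounds by real_asymp
  then obtain J2 where J2: "\<And>j. J2 \<le> j \<Longrightarrow> D / e \<le> real j powr \<beta>"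
    by (auto simp: filterlim_at_top eventually_sequentially)
  have "\<bar>leaf_poly j m - leaf_const * (real j * m) powr \<beta>\<bar> \<le> \<epsilon> * real j powr \<beta>"
    if j: "j \<ge> max 1 (max J1 J2)" and m: "0 \<le> m" "m \<le> 1" for j m
  proof -
    define J where "J = real j powr \<beta>"
    have Jp: "J > 0" using j by (simp add: J_def)
    have De: "D \<le> e * J" using J2[of j] j e by (simp add: J_def field_simps)
    define s where "s = (\<Sum>k\<le>j. (real k / real j) powr \<beta> * Bernstein j k m)"
    have s: "\<bar>m powr \<beta> - s\<bar> \<le> e" using J1[of j m] j m by (simp add: s_def less_imp_le)
    have kp: "real k powr \<beta> = J * (real k / real j) powr \<beta>" for k
      using j unfolding J_def by (subst powr_mult[symmetric]) auto
    have "\<bar>leaf_poly j m - leaf_const * (J * s)\<bar> =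
       \<bar>\<Sum>k\<le>j. (mean_leaves k - leaf_const * real k powr \<beta>) * Bernstein j k m\<bar>"
      unfolding leaf_poly_Bernstein s_def kp
      by (simp add: algebra_simps sum_subtractf sum_distrib_left)
    also have "\<dots> \<le> (\<Sum>k\<le>j. \<bar>mean_leaves k - leaf_const * real k powr \<beta>\<bar> * Bernstein j k m)"
      using m by (intro order_trans[OF sum_abs] sum_mono) (simp add: abs_mult Bernstein_nonneg)
    also have "\<dots> \<le> (\<Sum>k\<le>j. (2 * e * J) * Bernstein j k m)"
    proof (intro sum_mono mult_right_mono Bernstein_nonneg m)
      fix k assume "k \<in> {..j}"
      then have "real k powr \<beta> \<le> J" unfolding J_def using \<beta>_bounds by (intro powr_mono2) auto
      then have "e * real k powr \<beta> \<le> e * J" using e by simp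
      then show "\<bar>mean_leaves k - leaf_const * real k powr \<beta>\<bar> \<le> 2 * e * J"
        using mean[of k] De by simp
    qed
    also have "\<dots> = 2 * e * J" by (simp add: sum_distrib_left[symmetric])
    finally have 1: "\<bar>leaf_poly j m - leaf_const * (J * s)\<bar> \<le> 2 * e * J" .
    have "(real j * m) powr \<beta> = J * m powr \<beta>" using m by (simp add: J_def powr_mult)
    then have "leaf_const * (J * s) - leaf_const * (real j * m) powr \<beta> = leaf_const * J * (s - m powr \<beta>)"
      by (simp add: algebra_simps)
    also have "\<bar>\<dots>\<bar> \<le> \<bar>leaf_const\<bar> * J * e"
      using s Jp by (auto simp: abs_mult abs_minus_commute intro!: mult_left_mono)
    finally have "\<bar>leaf_poly j m - leaf_const * (real j * m) powr \<beta>\<bar> \<le> 2 * e * J + \<bar>leaf_const\<bar> * J * e"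
      using 1 by linarith
    also have "\<dots> \<le> (3 * e + \<bar>leaf_const\<bar> * e) * J"
      using e Jp by (simp add: algebra_simps)
    finally show ?thesis by (simp only: e_sum J_def)
  qed
  then show ?thesis by blast
qed

section \<open>Strips along the left edge\<close>

type_synonym strip = "real \<times> real \<times> real"

fun strip_box :: "strip \<Rightarrow> (real \<times> real) set" where
  "strip_box (w, c, d) = {0..w} \<times> {c..d}"

fun in_strip :: "strip \<Rightarrow> real \<times> real \<Rightarrow> bool" where
  "in_strip (w, c, d) (x, y) \<longleftrightarrow> 0 < x \<and> x < w \<and> c < y \<and> y < d"

fun valid_strip :: "strip \<Rightarrow> bool" where
  "valid_strip (w, c, d) \<longleftrightarrow> 0 < w \<and> w \<le> 1 \<and> 0 \<le> c \<and> c < d \<and> d \<le> 1"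

fun strip_area :: "strip \<Rightarrow> real" where
  "strip_area (w, c, d) = w * (d - c)"

fun strip_piece :: "bool \<Rightarrow> real \<times> real \<Rightarrow> strip \<Rightarrow> strip" where
  "strip_piece b (x, y) (w, c, d) = (if b then (x, y, d) else (x, c, y))"

fun split_word :: "real \<times> real \<Rightarrow> bool list \<times> strip \<Rightarrow> (bool list \<times> strip) list" where
  "split_word q (u, r) = (if in_strip r q then [(u @ [False], strip_piece False q r), (u @ [True], strip_piece True q r)]
                    else [(u, r)])"

definition split_strip :: "real \<times> real \<Rightarrow> strip \<Rightarrow> strip list" where
  "split_strip q r = (if in_strip r q then [strip_piece False q r, strip_piece True q r] else [r])"

definition split_strips :: "real \<times> real \<Rightarrow> strip list \<Rightarrow> strip list" where
  "split_strips q L = concat (map (split_strip q) L)"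

text \<open>Runs in parallel with \<open>left_strips\<close>, keeping with each strip the word that
  labels it.\<close>

primrec left_words :: "(nat \<Rightarrow> real \<times> real) \<Rightarrow> nat \<Rightarrow> (bool list \<times> strip) list" where
  "left_words p 0 = [([], (1, 0, 1))]"
| "left_words p (Suc n) = concat (map (split_word (p (Suc n))) (left_words p n))"

text \<open>A list rather than a set, so that a sum over strips changes additively when an entry is
  split, without a distinctness argument at each step.\<close>

primrec left_strips :: "(nat \<Rightarrow> real \<times> real) \<Rightarrow> nat \<Rightarrow> strip list" where
  "left_strips p 0 = [(1, 0, 1)]"
| "left_strips p (Suc n) = split_strips (p (Suc n)) (left_strips p n)"

lemma split_strips_Nil [simp]: "split_strips q [] = []" and split_strips_Cons [simp]: "split_strips q (r # L) = split_strip q r @ split_strips q L"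
  by (simp_all add: split_strips_def)

lemma map_snd_left_words: "map snd (left_words p n) = left_strips p n"
proof (induction n)
  case (Suc n)
  have "map snd (split_word q ur) = split_strip q (snd ur)" for q ur
    by (cases ur) (auto simp: split_strip_def)
  then show ?case
    by (simp add: Suc.IH[symmetric] split_strips_def map_concat comp_def)
qed simp

lemma left_strips_cong: "(\<And>i. 1 \<le> i \<Longrightarrow> i \<le> n \<Longrightarrow> p i = p' i) \<Longrightarrow> left_strips p n = left_strips p' n"
  by (induction n) auto

lemma valid_strip_piece: "valid_strip r \<Longrightarrow> in_strip r q \<Longrightarrow> valid_strip (strip_piece b q r)"
  by (cases r; cases q) auto

lemma in_strip_piece: "in_strip r q \<Longrightarrow> in_strip (strip_piece b q r) z \<Longrightarrow> in_strip r z"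
  by (cases r; cases q; cases z) (auto split: if_splits)

lemma valid_split_strip: "valid_strip r \<Longrightarrow> r' \<in> set (split_strip q r) \<Longrightarrow> valid_strip r'"
  by (auto simp: split_strip_def valid_strip_piece split: if_splits)

lemma valid_split_strips: "\<forall>r\<in>set L. valid_strip r \<Longrightarrow> r' \<in> set (split_strips q L) \<Longrightarrow> valid_strip r'"
  by (auto simp: split_strips_def intro: valid_split_strip)

lemma valid_left_strips: "r \<in> set (left_strips p n) \<Longrightarrow> valid_strip r"
proof (induction n arbitrary: r)
  case (Suc n)
  show ?case by (rule valid_split_strips[of "left_strips p n" _ "p (Suc n)"]) (use Suc in simp_all)
qed simp

lemma interior_strip_box: "interior (strip_box r) = {q. in_strip r q}"
  by (cases r) (auto simp: interior_Times)

lemma valid_strip_nonempty: "valid_strip r \<Longrightarrow> \<exists>q. in_strip r q"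
proof (cases r)
  case (fields w c d)
  assume "valid_strip r"
  then have "in_strip r (w / 2, (c + d) / 2)" by (simp add: fields)
  then show ?thesis by blast
qed

lemma in_strip_unit_square: "valid_strip r \<Longrightarrow> in_strip r q \<Longrightarrow> q \<in> unit_square"
  by (cases r; cases q) (auto simp: unit_square_def)

lemma strip_box_inject:
  assumes "valid_strip r" "strip_box r = strip_box r'" shows "r = r'"
proof -
  obtain w c d w' c' d' where r: "r = (w, c, d)" "r' = (w', c', d')" by (metis prod_cases3)
  show ?thesis using assms unfolding r
    by (auto simp: times_eq_iff Icc_eq_Icc)
qed

lemma strip_box_vseg: "valid_strip r \<Longrightarrow> strip_box r \<inter> vseg 0 \<noteq> {}"
proof (cases r)
  case (fields w c d)
  assume "valid_strip r"
  then have "(0, c) \<in> strip_box r \<inter> vseg 0" by (auto simp: fields vseg_def)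
  then show ?thesis by blast
qed

text \<open>Concerns the open interiors, since neighbouring closed boxes share an edge. Imposed on
  all pairs of list positions, it also excludes repeated entries, because a valid strip has nonempty
  interior.\<close>

definition disjoint_strips :: "strip \<Rightarrow> strip \<Rightarrow> bool" where
  "disjoint_strips r r' \<longleftrightarrow> (\<forall>z. \<not> (in_strip r z \<and> in_strip r' z))"

lemma in_split_strip: "r' \<in> set (split_strip q r) \<Longrightarrow> in_strip r' z \<Longrightarrow> in_strip r z"
  by (auto simp: split_strip_def intro: in_strip_piece split: if_splits)

lemma sorted_split_strip: "sorted_wrt disjoint_strips (split_strip q r)"
  by (cases r; cases q) (auto simp: split_strip_def disjoint_strips_def)

lemma sorted_split_strips: "sorted_wrt disjoint_strips L \<Longrightarrow> sorted_wrt disjoint_strips (split_strips q L)"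
proof (induction L)
  case (Cons r L)
  have "disjoint_strips r1 r2" if r1: "r1 \<in> set (split_strip q r)" and r2: "r2 \<in> set (split_strips q L)" for r1 r2
  proof -
    obtain r' where r': "r' \<in> set L" "r2 \<in> set (split_strip q r')" using r2 by (auto simp: split_strips_def)
    then have "disjoint_strips r r'" using Cons.prems by simp
    then show ?thesis using in_split_strip r1 r'(2) unfolding disjoint_strips_def by blast
  qed
  then show ?case using Cons by (simp add: sorted_wrt_append sorted_split_strip)
qed simp

lemma sorted_left_strips: "sorted_wrt disjoint_strips (left_strips p n)"
  by (induction n) (auto intro: sorted_split_strips)

lemma sorted_disjoint_distinct:
  assumes "sorted_wrt disjoint_strips L" "\<forall>r\<in>set L. valid_strip r"
  shows "distinct (map strip_box L)"
  using assms
proof (induction L)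
  case (Cons r L)
  have "strip_box r \<noteq> strip_box r'" if "r' \<in> set L" for r'
  proof
    assume "strip_box r = strip_box r'"
    then have "r = r'" using strip_box_inject Cons.prems by simp
    moreover have "disjoint_strips r r'" using Cons.prems that by simp
    ultimately show False using valid_strip_nonempty[of r] Cons.prems by (auto simp: disjoint_strips_def)
  qed
  then show ?case using Cons by auto
qed simp

lemma distinct_left_strips: "distinct (map strip_box (left_strips p n))"
  by (rule sorted_disjoint_distinct) (auto intro: sorted_left_strips valid_left_strips)

lemma left_strips_unique:
  assumes "r \<in> set (left_strips p n)" "r' \<in> set (left_strips p n)" "in_strip r z" "in_strip r' z"
  shows "r = r'"
proof -
  obtain i j where ij: "i < length (left_strips p n)" "j < length (left_strips p n)" "r = left_strips p n ! i" "r' = left_strips p n ! j"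
    using assms by (metis in_set_conv_nth)
  have "disjoint_strips (left_strips p n ! i) (left_strips p n ! j)" if "i < j" "j < length (left_strips p n)" for i j
    using sorted_left_strips that by (simp add: sorted_wrt_iff_nth_less)
  then show ?thesis using assms ij unfolding disjoint_strips_def by (metis nat_neq_iff)
qed

section \<open>The rectangles of the covering that meet the left edge\<close>

lemma strip_box_bottom: "valid_strip r \<Longrightarrow> in_strip r (a, b) \<Longrightarrow> strip_box r \<inter> ({0..a} \<times> {0..b}) = strip_box (strip_piece False (a, b) r)"
  by (cases r) auto

lemma strip_box_top: "valid_strip r \<Longrightarrow> in_strip r (a, b) \<Longrightarrow> strip_box r \<inter> ({0..a} \<times> {b..1}) = strip_box (strip_piece True (a, b) r)"
  by (cases r) auto

text \<open>The abscissa a of an interior point is positive, so the pieces on its right stay away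
  from the line x = 0.\<close>

lemma strip_box_right: "in_strip r (a, b) \<Longrightarrow> strip_box r \<inter> ({a..1} \<times> J) \<inter> vseg 0 = {}"
  by (cases r) (auto simp: vseg_def)

lemma quarters_subset: "R \<in> quarters R' q \<Longrightarrow> R \<subseteq> R'"
  by (cases q) (auto simp: quarters_def)

lemma left_quarters:
  assumes "valid_strip r" "in_strip r q"
  shows "{R \<in> quarters (strip_box r) q. R \<inter> vseg 0 \<noteq> {}} = {strip_box (strip_piece False q r), strip_box (strip_piece True q r)}"
proof -
  obtain a b where q: "q = (a, b)" by fastforce
  note v = assms[unfolded q]
  have "quarters (strip_box r) q = {strip_box (strip_piece False q r), strip_box (strip_piece True q r),
     strip_box r \<inter> ({a..1} \<times> {0..b}), strip_box r \<inter> ({a..1} \<times> {b..1})}"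
    unfolding quarters_def q by (simp only: split strip_box_bottom[OF v] strip_box_top[OF v])
  then show ?thesis
    using strip_box_vseg[OF valid_strip_piece[OF assms, of False]] strip_box_vseg[OF valid_strip_piece[OF assms, of True]]
      strip_box_right[OF v(2)] by auto
qed

lemma UN_image_partition:
  assumes "\<And>r. P (f r) \<longleftrightarrow> P' r"
  shows "{R \<in> f ` A. \<not> P R} \<union> (\<Union>R\<in>{R \<in> f ` A. P R}. G R) =
    f ` {r \<in> A. \<not> P' r} \<union> (\<Union>r\<in>{r \<in> A. P' r}. G (f r))"
  using assms by auto

text \<open>A rectangle that meets the left edge descends only from rectangles that meet it, so this
  part of the covering evolves autonomously; the right quarters drop out at every division.\<close>

lemma left_quadtree: "{R \<in> quadtree p n. R \<inter> vseg 0 \<noteq> {}} = strip_box ` set (left_strips p n)"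
proof (induction n)
  case 0
  have "(0, 0) \<in> {0..1} \<times> {0..1} \<inter> vseg 0" by (simp add: vseg_def)
  then have "{0..1} \<times> {0..1} \<inter> vseg 0 \<noteq> {}" by blast
  then show ?case by (auto simp: unit_square_def)
next
  case (Suc n)
  let ?q = "p (Suc n)"
  have *: "R \<inter> vseg 0 \<noteq> {} \<Longrightarrow> R \<in> quarters R' ?q \<Longrightarrow> R' \<inter> vseg 0 \<noteq> {}" for R R'
    using quarters_subset by blast
  let ?D = "{R \<in> quadtree p n. R \<inter> vseg 0 \<noteq> {}}"
  have "{R \<in> quadtree p (Suc n). R \<inter> vseg 0 \<noteq> {}} =
     {R \<in> ?D. ?q \<notin> interior R} \<union> (\<Union>R'\<in>{R' \<in> ?D. ?q \<in> interior R'}. {R \<in> quarters R' ?q. R \<inter> vseg 0 \<noteq> {}})"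
    using * by auto
  also have "\<dots> = strip_box ` {r \<in> set (left_strips p n). \<not> in_strip r ?q} \<union>
     (\<Union>r\<in>{r \<in> set (left_strips p n). in_strip r ?q}. {R \<in> quarters (strip_box r) ?q. R \<inter> vseg 0 \<noteq> {}})"
    unfolding Suc.IH by (rule UN_image_partition) (simp add: interior_strip_box)
  also have "\<dots> = strip_box ` {r \<in> set (left_strips p n). \<not> in_strip r ?q} \<union>
     (\<Union>r\<in>{r \<in> set (left_strips p n). in_strip r ?q}. {strip_box (strip_piece False ?q r), strip_box (strip_piece True ?q r)})"
    by (intro arg_cong2[where f = "(\<union>)"] refl SUP_cong left_quarters)
       (blast intro: valid_left_strips)+
  also have "\<dots> = strip_box ` set (left_strips p (Suc n))"
    by (auto simp: split_strips_def split_strip_def split: if_splits)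
  finally show ?case .
qed

lemma left_strips_in_quadtree: "r \<in> set (left_strips p n) \<Longrightarrow> strip_box r \<in> quadtree p n"
  using left_quadtree[of p n] by auto

lemma N_eq:
  "N \<tau> p t 0 = real (length (left_strips p (card {i. 1 \<le> i \<and> \<tau> i \<le> t}))) - 1"
proof -
  have "card (strip_box ` set (left_strips p n)) = length (left_strips p n)" for n
    using distinct_card[OF distinct_left_strips[of p n]] by simp
  then show ?thesis by (simp add: N_def Q_def left_quadtree)
qed

section \<open>Birth, ancestry and word labels of rectangles\<close>

lemma quadtree_no_point:
  assumes "R \<in> quadtree p n" "1 \<le> i" "i \<le> n"
  shows "p i \<notin> interior R"
  using assms
proof (induction n arbitrary: R)
  case (Suc n)
  from Suc.prems(1) consider "R \<in> quadtree p n" "p (Suc n) \<notin> interior R"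
    | R' where "R' \<in> quadtree p n" "R \<in> quarters R' (p (Suc n))" by auto
  then show ?case
  proof cases
    case 1
    then show ?thesis using Suc by (cases "i = Suc n") auto
  next
    case 2
    show ?thesis
    proof (cases "i = Suc n")
      case True
      obtain a b where q: "p (Suc n) = (a, b)" by fastforce
      \<comment> \<open>Each quarter lies on one side of the vertical line through the dividing
        point, which can thus be on its boundary but not in its interior.\<close>
      consider "R \<subseteq> {0..a} \<times> UNIV" | "R \<subseteq> {a..1} \<times> UNIV"
        using 2(2) unfolding quarters_def q by auto
      then have "(a, b) \<notin> interior R"
        using interior_mono[of R "{0..a} \<times> UNIV"] interior_mono[of R "{a..1} \<times> UNIV"]
        by cases (auto simp: interior_Times)
      then show ?thesis by (simp add: True q)
    next
      case False
      then have "p i \<notin> interior R'" using Suc 2 by simp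
      then show ?thesis using interior_mono[OF quarters_subset[OF 2(2)]] by blast
    qed
  qed
qed simp

lemma quadtree_coarsen:
  assumes "R \<in> quadtree p m" "n \<le> m"
  shows "\<exists>R'\<in>quadtree p n. R \<subseteq> R'"
  using assms(2,1)
proof (induction m arbitrary: R rule: dec_induct)
  case base
  then show ?case by blast
next
  case (step m)
  from step.prems have "R \<in> quadtree p m \<or> (\<exists>R'\<in>quadtree p m. R \<in> quarters R' (p (Suc m)))"
    by auto
  then obtain R' where "R' \<in> quadtree p m" "R \<subseteq> R'"
    using quarters_subset by blast
  moreover from step.IH[OF this(1)] obtain R'' where "R'' \<in> quadtree p n" "R' \<subseteq> R''" by blast
  ultimately show ?case by (meson subset_trans)
qed

text \<open>The least dividing index is the current one: a member of the covering after n points has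
  none of these points in its interior, which rules out an earlier division.\<close>

lemma child_left:
  assumes r: "r \<in> set (left_strips p n)" and i: "in_strip r (p (Suc n))"
  shows "child p 0 (strip_box r) c = strip_box (strip_piece c (p (Suc n)) r)"
proof -
  have s: "splits p (strip_box r) (Suc n)"
    using left_strips_in_quadtree[OF r] i by (simp add: splits_def interior_strip_box)
  have L: "(LEAST i. splits p (strip_box r) i) = Suc n"
  proof (rule Least_equality)
    show "splits p (strip_box r) (Suc n)" by (rule s)
    fix k assume k: "splits p (strip_box r) k"
    show "Suc n \<le> k"
    proof (rule ccontr)
      assume "\<not> Suc n \<le> k"
      then have "p k \<notin> interior (strip_box r)"
        using quadtree_no_point[OF left_strips_in_quadtree[OF r], of k] k by (simp add: splits_def)
      then show False using k by (simp add: splits_def)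
    qed
  qed
  obtain a b where q: "p (Suc n) = (a, b)" by fastforce
  have v: "valid_strip r" "in_strip r (a, b)" using valid_left_strips[OF r] i by (simp_all add: q)
  have J: "strip_box r \<inter> ({0..a} \<times> (if c then {b..1} else {0..b})) = strip_box (strip_piece c (a, b) r)"
    using strip_box_bottom[OF v] strip_box_top[OF v] by simp
  have "\<exists>i. splits p (strip_box r) i" using s by blast
  note ex = if_P[OF this]
  show ?thesis unfolding child_def ex L q Let_def prod.case J
    by (rule if_P[OF strip_box_vseg[OF valid_strip_piece[OF v, of c]]])
qed

lemma child_subset: "child p x R c \<subseteq> R"
  by (auto simp: child_def Let_def split: prod.splits if_splits)

lemma rect_snoc: "rect p x (u @ [c]) = child p x (rect p x u) c"
  by (simp add: rect_def)

lemma left_words_rect: "(u, r) \<in> set (left_words p n) \<Longrightarrow> rect p 0 u = strip_box r"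
proof (induction n arbitrary: u r)
  case 0
  then show ?case by (simp add: rect_def unit_square_def)
next
  case (Suc n)
  then obtain v s where v: "(v, s) \<in> set (left_words p n)" "(u, r) \<in> set (split_word (p (Suc n)) (v, s))" by auto
  have s: "s \<in> set (left_strips p n)" using v(1) by (force simp: map_snd_left_words[symmetric])
  have "rect p 0 v = strip_box s" using Suc.IH v(1) .
  then show ?case using v(2) child_left[OF s] by (auto simp: rect_snoc split: if_splits)
qed

lemma left_words_persist:
  assumes "(u, r) \<in> set (left_words p i)" "i \<le> n" "\<And>k. i < k \<Longrightarrow> k \<le> n \<Longrightarrow> \<not> in_strip r (p k)"
  shows "(u, r) \<in> set (left_words p n)"
  using assms(2,3)
proof (induction n rule: dec_induct)
  case base
  then show ?case using assms(1) by simp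
next
  case (step n)
  then have "(u, r) \<in> set (left_words p n)" "\<not> in_strip r (p (Suc n))" by auto
  then show ?case by (auto intro!: bexI[of _ "(u, r)"])
qed

text \<open>Guarantees that words outside the list contribute 0 to the sum over all words. The
  induction removes the last letter and looks at the step at which the parent was divided.\<close>

lemma rect_in_quadtree:
  assumes "rect p 0 u \<in> quadtree p n" "rect p 0 u \<noteq> {}"
  shows "\<exists>r. (u, r) \<in> set (left_words p n)"
  using assms
proof (induction u arbitrary: n rule: rev_induct)
  case Nil
  have "(([]::bool list), (1, 0, 1)) \<in> set (left_words p n)"
  proof (rule left_words_persist[of _ _ _ 0])
    fix k assume "0 < k" "k \<le> n"
    then have "p k \<notin> interior (strip_box (1, 0, 1))"
      using Nil quadtree_no_point[of "strip_box (1, 0, 1)" p n k] by (simp add: rect_def unit_square_def)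
    then show "\<not> in_strip (1, 0, 1) (p k)" by (simp only: interior_strip_box mem_Collect_eq simp_thms)
  qed auto
  then show ?case by blast
next
  case (snoc c u)
  define R where "R = rect p 0 (u @ [c])"
  define R' where "R' = rect p 0 u"
  have R: "R = child p 0 R' c" by (simp add: R_def R'_def rect_snoc)
  have "R \<noteq> {}" using snoc.prems by (simp add: R_def)
  \<comment> \<open>\<open>child\<close> returns the empty set for a rectangle that is never
    divided, so nonemptiness forces a division of the parent.\<close>
  then have ex: "\<exists>i. splits p R' i" unfolding R child_def by (auto split: if_splits)
  then obtain i0 where i0: "splits p R' i0" by blast
  then obtain i where i: "i0 = Suc i" by (cases i0) (auto simp: splits_def)
  have R': "R' \<in> quadtree p i" "p (Suc i) \<in> interior R'" using i0 by (auto simp: splits_def i)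
  then have "R' \<noteq> {}" by auto
  with snoc.IH[of i] R' obtain r where r: "(u, r) \<in> set (left_words p i)" by (auto simp: R'_def)
  have R'r: "R' = strip_box r" unfolding R'_def using left_words_rect[OF r] .
  have inn: "in_strip r (p (Suc i))" using R'(2) by (simp add: R'r interior_strip_box)
  have rl: "r \<in> set (left_strips p i)" using r by (force simp: map_snd_left_words[symmetric])
  let ?s = "strip_piece c (p (Suc i)) r"
  have s: "(u @ [c], ?s) \<in> set (left_words p (Suc i))"
    using r inn by (cases c) (auto intro!: bexI[of _ "(u, r)"])
  have Rs: "R = strip_box ?s" unfolding R R'r by (rule child_left[OF rl inn])
  have vs: "valid_strip ?s" using valid_strip_piece[OF valid_left_strips[OF rl] inn] .
  have Rn: "R \<in> quadtree p n" using snoc.prems by (simp add: R_def)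
  show ?case
  proof (cases "Suc i \<le> n")
    case True
    have "(u @ [c], ?s) \<in> set (left_words p n)"
    proof (rule left_words_persist[OF s True])
      fix k assume "Suc i < k" "k \<le> n"
      then have "p k \<notin> interior (strip_box ?s)"
        using quadtree_no_point[OF Rn, of k] by (simp add: Rs)
      then show "\<not> in_strip ?s (p k)" by (simp add: interior_strip_box)
    qed
    then show ?thesis by blast
  next
    \<comment> \<open>The piece would be present before the division that creates it. At that
      earlier step some member of the covering contains the parent; it overlaps the piece, and both
      meet the left edge, so piece and parent coincide, although the dividing point lies strictly
      inside the parent.\<close>
    case False
    then obtain R2 where R2: "R2 \<in> quadtree p n" "R' \<subseteq> R2"
      using quadtree_coarsen[OF R'(1), of n] by auto
    have "R \<inter> vseg 0 \<noteq> {}" unfolding Rs by (rule strip_box_vseg[OF vs])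
    moreover have "R \<subseteq> R'" unfolding R by (rule child_subset)
    ultimately have "R2 \<inter> vseg 0 \<noteq> {}" "R \<inter> vseg 0 \<noteq> {}" using R2 by auto
    then have "R2 \<in> strip_box ` set (left_strips p n)" "R \<in> strip_box ` set (left_strips p n)"
      using left_quadtree[of p n] R2 Rn by auto
    then obtain r1 r2 where r12: "R = strip_box r1" "R2 = strip_box r2" "r1 \<in> set (left_strips p n)" "r2 \<in> set (left_strips p n)"
      by auto
    obtain z where z: "in_strip r1 z" using valid_strip_nonempty valid_left_strips r12 by blast
    have "interior R \<subseteq> interior R2" using \<open>R \<subseteq> R'\<close> R2 by (intro interior_mono) auto
    then have "in_strip r2 z" using z by (auto simp: r12 interior_strip_box)
    then have "r1 = r2" using left_strips_unique r12 z by blast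
    then have "R = R'" using \<open>R \<subseteq> R'\<close> R2 r12 by blast
    then have "?s = r" using strip_box_inject[OF vs] by (simp add: Rs R'r)
    then show ?thesis using inn by (cases r; cases "p (Suc i)") (auto split: if_splits)
  qed
qed

lemma measure_strip_box: "valid_strip r \<Longrightarrow> measure lborel (strip_box r) = strip_area r"
proof (cases r)
  case (fields w c d)
  assume v: "valid_strip r"
  have "emeasure lborel (strip_box r) = emeasure (lborel \<Otimes>\<^sub>M lborel) ({0..w} \<times> {c..d})"
    by (simp add: fields lborel_prod)
  also have "\<dots> = emeasure lborel {0..w} * emeasure lborel {c..d}"
    by (intro lborel.emeasure_pair_measure_Times) auto
  also have "\<dots> = ennreal (strip_area r)" using v by (simp add: fields ennreal_mult')
  finally show ?thesis using v by (simp add: measure_def fields)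
qed

text \<open>Distinct boxes force distinct words, so the infinite sum collapses to the list of
  labels; every other word names the empty set or a rectangle absent from the covering.\<close>

lemma \<MM>_eq:
  "\<MM> \<tau> p t = (\<Sum>r\<leftarrow>left_strips p (card {i. 1 \<le> i \<and> \<tau> i \<le> t}). strip_area r powr (sqrt 2 - 1))"
proof -
  define n where "n = card {i. 1 \<le> i \<and> \<tau> i \<le> t}"
  define W where "W = map fst (left_words p n)"
  let ?f = "\<lambda>u. measure lborel (rect p 0 u) powr (sqrt 2 - 1) * of_bool (rect p 0 u \<in> Q \<tau> p t)"
  have Q: "Q \<tau> p t = quadtree p n" by (simp add: Q_def n_def)
  have "map (rect p 0) W = map (strip_box \<circ> snd) (left_words p n)"
    unfolding W_def using left_words_rect by (auto simp: comp_def)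
  also have "\<dots> = map strip_box (left_strips p n)" by (simp add: map_snd_left_words[symmetric])
  finally have "distinct (map (rect p 0) W)" using distinct_left_strips by simp
  then have dW: "distinct W" by (simp add: distinct_map)
  have "\<MM> \<tau> p t = (\<Sum>\<^sub>\<infinity>u\<in>set W. ?f u)" unfolding \<MM>_def
  proof (rule infsum_cong_neutral)
    fix u assume u: "u \<in> UNIV - set W"
    show "?f u = 0"
    proof (cases "rect p 0 u = {}")
      case False
      then have "rect p 0 u \<notin> quadtree p n"
        using rect_in_quadtree[of p u n] u by (force simp: W_def)
      then show ?thesis by (simp add: Q)
    qed simp
  qed auto
  also have "\<dots> = (\<Sum>u\<leftarrow>W. ?f u)"
    using dW by (simp add: sum_list_distinct_conv_sum_set)
  also have "\<dots> = (\<Sum>ur\<leftarrow>left_words p n. strip_area (snd ur) powr (sqrt 2 - 1))"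
    unfolding W_def map_map
  proof (rule arg_cong[where f = sum_list], rule map_cong[OF refl])
    fix ur assume ur: "ur \<in> set (left_words p n)"
    then have r: "snd ur \<in> set (left_strips p n)" by (auto simp: map_snd_left_words[symmetric])
    have "rect p 0 (fst ur) = strip_box (snd ur)" using ur by (intro left_words_rect[of _ _ p n]) simp
    then show "(?f \<circ> fst) ur = strip_area (snd ur) powr (sqrt 2 - 1)"
      using left_strips_in_quadtree[OF r] measure_strip_box[OF valid_left_strips[OF r]] by (simp add: Q)
  qed
  also have "\<dots> = (\<Sum>r\<leftarrow>left_strips p n. strip_area r powr (sqrt 2 - 1))"
    by (simp add: map_snd_left_words[symmetric] comp_def)
  finally show ?thesis by (simp add: n_def)
qed

section \<open>Splitting by a uniform point\<close>

text \<open>A density on the whole plane, so that the law lives on the same Borel sets as the random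
  positions.\<close>

definition unif :: "(real \<times> real) measure" where
  "unif = density lborel (\<lambda>q. ennreal (indicator unit_square q))"

definition strip_sum :: "(real \<Rightarrow> real) \<Rightarrow> strip list \<Rightarrow> real" where
  "strip_sum F L = (\<Sum>r\<leftarrow>L. F (strip_area r))"

lemma in_strip_alt: "in_strip r q \<longleftrightarrow> 0 < fst q \<and> fst q < fst r \<and> fst (snd r) < snd q \<and> snd q < snd (snd r)"
  by (cases r; cases q) simp

lemma strip_piece_alt: "strip_piece b q r = (if b then (fst q, snd q, snd (snd r)) else (fst q, fst (snd r), snd q))"
  by (cases r; cases q) simp

lemma strip_area_alt: "strip_area r = fst r * (snd (snd r) - fst (snd r))"
  by (cases r) simp

lemma unit_square_borel [measurable]: "unit_square \<in> sets borel"
  unfolding unit_square_def by (intro borel_closed closed_Times) auto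

lemma emeasure_unit_square: "emeasure lborel unit_square = 1"
proof -
  have "emeasure lborel unit_square = emeasure (lborel \<Otimes>\<^sub>M lborel) ({0..1::real} \<times> {0..1::real})"
    by (simp add: lborel_prod unit_square_def)
  also have "\<dots> = emeasure lborel {0..1::real} * emeasure lborel {0..1::real}"
    by (intro lborel.emeasure_pair_measure_Times) auto
  finally show ?thesis by simp
qed

lemma sets_unif [measurable_cong, simp]: "sets unif = sets borel"
  and space_unif [simp]: "space unif = UNIV"
  by (simp_all add: unif_def)

lemma emeasure_unif: "C \<in> sets borel \<Longrightarrow> emeasure unif C = emeasure lborel (C \<inter> unit_square)"
  unfolding unif_def
  by (subst emeasure_density) (auto simp: indicator_inter_arith[symmetric] ennreal_indicator nn_integral_indicator Int_commute
      intro!: nn_integral_cong simp flip: nn_integral_indicator split: split_indicator)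

lemma prob_space_unif: "prob_space unif"
  by (rule prob_spaceI) (simp add: emeasure_unif emeasure_unit_square)

interpretation unif: prob_space unif by (rule prob_space_unif)

lemma nn_integral_powr_interval:
  assumes "a \<ge> 0" "w \<ge> 0"
  shows "(\<integral>\<^sup>+x. ennreal (x powr a * indicator {0<..<w} x) \<partial>lborel) = ennreal (w powr (a + 1) / (a + 1))"
proof -
  have "AE x in lborel. x \<noteq> 0" "AE x in lborel. x \<noteq> w" by (rule AE_lborel_singleton)+
  then have ae: "AE x in lborel. ennreal (x powr a * indicator {0<..<w} x) = ennreal (indicator {0..w} x * x powr a)"
    by eventually_elim (auto split: split_indicator)
  then have "(\<integral>\<^sup>+x. ennreal (x powr a * indicator {0<..<w} x) \<partial>lborel) =
      (\<integral>\<^sup>+x. ennreal (indicator {0..w} x * x powr a) \<partial>lborel)"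
    by (rule nn_integral_cong_AE)
  also have "\<dots> = ennreal (w powr (a + 1) / (a + 1))"
    using assms by (intro nn_integral_has_integral_lebesgue has_integral_powr_from_0) auto
  finally show ?thesis .
qed

text \<open>The area of a piece is x (y - c) or x (d - y), so the integral factors into integrals of
  a-th powers over intervals of lengths w and d - c.\<close>

lemma nn_integral_powr_strip:
  assumes "a \<ge> 0" "valid_strip r"
  shows "(\<integral>\<^sup>+q. ennreal (indicator {q. in_strip r q} q * strip_area (strip_piece b q r) powr a) \<partial>lborel) =
     ennreal (strip_area r powr (a + 1) / (a + 1)\<^sup>2)"
proof -
  obtain w c d where r: "r = (w, c, d)" by (cases r)
  have v: "0 < w" "c < d" using assms(2) by (auto simp: r)
  define g where "g y = (if b then (d - y) powr a else (y - c) powr a) * indicator {c<..<d} y" for y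
  have [measurable]: "g \<in> borel_measurable borel" unfolding g_def by measurable
  have g: "(\<integral>\<^sup>+y. ennreal (g y) \<partial>lborel) = ennreal ((d - c) powr (a + 1) / (a + 1))"
  proof (cases b)
    \<comment> \<open>Reflection of y at d for the top piece; the bottom piece needs only a
      translation by c.\<close>
    case True
    have "(\<integral>\<^sup>+y. ennreal (g y) \<partial>lborel) = ennreal \<bar>-1\<bar> * (\<integral>\<^sup>+y. ennreal (g (d + (-1) * y)) \<partial>lborel)"
      by (rule nn_integral_real_affine) auto
    also have "\<dots> = (\<integral>\<^sup>+y. ennreal (y powr a * indicator {0<..<d - c} y) \<partial>lborel)"
      using True by (auto intro!: nn_integral_cong simp: g_def split: split_indicator)
    finally show ?thesis using nn_integral_powr_interval assms(1) v by simp
  next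
    case False
    have "(\<integral>\<^sup>+y. ennreal (g y) \<partial>lborel) = ennreal \<bar>1\<bar> * (\<integral>\<^sup>+y. ennreal (g (c + 1 * y)) \<partial>lborel)"
      by (rule nn_integral_real_affine) auto
    also have "\<dots> = (\<integral>\<^sup>+y. ennreal (y powr a * indicator {0<..<d - c} y) \<partial>lborel)"
      using False by (auto intro!: nn_integral_cong simp: g_def split: split_indicator)
    finally show ?thesis using nn_integral_powr_interval assms(1) v by simp
  qed
  have "(\<integral>\<^sup>+q. ennreal (indicator {q. in_strip r q} q * strip_area (strip_piece b q r) powr a) \<partial>lborel) =
     (\<integral>\<^sup>+q. ennreal (fst q powr a * indicator {0<..<w} (fst q)) * ennreal (g (snd q)) \<partial>(lborel \<Otimes>\<^sub>M lborel))"
    unfolding lborel_prod g_def r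
    by (intro nn_integral_cong)
       (auto simp: powr_mult ennreal_mult'[symmetric] split: split_indicator)
  also have "\<dots> = (\<integral>\<^sup>+x. \<integral>\<^sup>+y. ennreal (x powr a * indicator {0<..<w} x) * ennreal (g y) \<partial>lborel \<partial>lborel)"
    by (subst lborel.nn_integral_fst[symmetric]) auto
  also have "\<dots> = ennreal (w powr (a + 1) / (a + 1)) * ennreal ((d - c) powr (a + 1) / (a + 1))"
    using assms(1) v by (simp add: nn_integral_cmult nn_integral_multc g nn_integral_powr_interval)
  also have "\<dots> = ennreal (strip_area r powr (a + 1) / (a + 1)\<^sup>2)"
    using assms(1) v by (simp add: ennreal_mult'[symmetric] r powr_mult power2_eq_square)
  finally show ?thesis .
qed

lemma measurable_fst_borel [measurable (raw)]:
  fixes f :: "'a \<Rightarrow> 'b::topological_space \<times> 'c::topological_space"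
  assumes "f \<in> M \<rightarrow>\<^sub>M borel" shows "(\<lambda>x. fst (f x)) \<in> M \<rightarrow>\<^sub>M borel"
  by (rule measurable_compose[OF assms]) (intro borel_measurable_continuous_onI continuous_intros)

lemma measurable_snd_borel [measurable (raw)]:
  fixes f :: "'a \<Rightarrow> 'b::topological_space \<times> 'c::topological_space"
  assumes "f \<in> M \<rightarrow>\<^sub>M borel" shows "(\<lambda>x. snd (f x)) \<in> M \<rightarrow>\<^sub>M borel"
  by (rule measurable_compose[OF assms]) (intro borel_measurable_continuous_onI continuous_intros)

lemma measurable_in_strip [measurable]: "{q. in_strip r q} \<in> sets borel"
  unfolding in_strip_alt by measurable

lemma measurable_piece_area [measurable]:
  "(\<lambda>q. strip_area (strip_piece b q r)) \<in> borel_measurable borel"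
  unfolding strip_area_alt strip_piece_alt by (cases b; simp; measurable)

lemma has_integral_powr_strip:
  assumes "a \<ge> 0" "valid_strip r"
  shows "has_bochner_integral unif (\<lambda>q. indicator {q. in_strip r q} q * strip_area (strip_piece b q r) powr a)
     (strip_area r powr (a + 1) / (a + 1)\<^sup>2)"
proof (rule has_bochner_integral_nn_integral)
  have "(\<integral>\<^sup>+q. ennreal (indicator {q. in_strip r q} q * strip_area (strip_piece b q r) powr a) \<partial>unif) =
    (\<integral>\<^sup>+q. ennreal (indicator {q. in_strip r q} q * strip_area (strip_piece b q r) powr a) \<partial>lborel)"
    unfolding unif_def using in_strip_unit_square[OF assms(2)]
    by (subst nn_integral_density) (auto intro!: nn_integral_cong split: split_indicator)
  then show "(\<integral>\<^sup>+q. ennreal (indicator {q. in_strip r q} q * strip_area (strip_piece b q r) powr a) \<partial>unif) =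
    ennreal (strip_area r powr (a + 1) / (a + 1)\<^sup>2)"
    using nn_integral_powr_strip[OF assms] by simp
qed auto

lemma valid_strip_area: "valid_strip r \<Longrightarrow> 0 < strip_area r \<and> strip_area r \<le> 1"
  by (cases r) (auto intro!: mult_le_one)

lemma strip_area_pieces:
  assumes "valid_strip r" "in_strip r q"
  shows "0 < strip_area (strip_piece b q r)"
    "strip_area (strip_piece False q r) + strip_area (strip_piece True q r) \<le> strip_area r"
proof -
  show "0 < strip_area (strip_piece b q r)" using valid_strip_area valid_strip_piece assms by blast
  obtain w c d x y where rq: "r = (w, c, d)" "q = (x, y)" by (metis prod_cases3 surj_pair)
  have "x * (d - c) \<le> w * (d - c)" using assms by (intro mult_right_mono) (auto simp: rq)
  then show "strip_area (strip_piece False q r) + strip_area (strip_piece True q r) \<le> strip_area r"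
    by (simp add: rq algebra_simps)
qed

text \<open>The case a = 0 of the power formula: the pieces have positive area, so their zeroth
  power is 1.\<close>

lemma has_integral_in_strip:
  assumes "valid_strip r"
  shows "has_bochner_integral unif (indicator {q. in_strip r q}) (strip_area r)"
proof -
  have "has_bochner_integral unif (\<lambda>q. indicator {q. in_strip r q} q * strip_area (strip_piece False q r) powr 0)
     (strip_area r powr (0 + 1) / (0 + 1)\<^sup>2)"
    using assms by (intro has_integral_powr_strip) auto
  moreover have "(\<lambda>q. indicator {q. in_strip r q} q * strip_area (strip_piece False q r) powr 0) =
     (indicator {q. in_strip r q} :: _ \<Rightarrow> real)"
  proof
    fix q show "indicator {q. in_strip r q} q * strip_area (strip_piece False q r) powr 0 =
     (indicator {q. in_strip r q} q :: real)"
      using strip_area_pieces(1)[OF assms, of q False] by (auto split: split_indicator)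
  qed
  ultimately show ?thesis using valid_strip_area[OF assms] by simp
qed

definition gain :: "(real \<Rightarrow> real) \<Rightarrow> strip \<Rightarrow> real \<times> real \<Rightarrow> real" where
  "gain F r q = indicator {q. in_strip r q} q *
     (F (strip_area (strip_piece False q r)) + F (strip_area (strip_piece True q r)) - F (strip_area r))"

text \<open>\<open>mean_split F G\<close>: after one more uniform point, the sum of \<open>F (strip_area r)\<close> over the strips
  has conditional mean the sum of \<open>G (strip_area r)\<close>.\<close>

definition mean_split :: "(real \<Rightarrow> real) \<Rightarrow> (real \<Rightarrow> real) \<Rightarrow> bool" where
  "mean_split F G \<longleftrightarrow> F \<in> borel_measurable borel \<and>
     (\<exists>B. \<forall>m. 0 < m \<longrightarrow> m \<le> 1 \<longrightarrow> \<bar>F m\<bar> \<le> B) \<and>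
     (\<forall>r. valid_strip r \<longrightarrow> has_bochner_integral unif (gain F r) (G (strip_area r) - F (strip_area r)))"

lemma mean_split_powr:
  assumes "a \<ge> 0"
  shows "mean_split (\<lambda>m. m powr a) (\<lambda>m. m powr a + rate a * m powr (a + 1))"
  unfolding mean_split_def
proof (intro conjI allI impI)
  show "\<exists>B. \<forall>m. 0 < m \<longrightarrow> m \<le> 1 \<longrightarrow> \<bar>m powr a\<bar> \<le> B"
    using assms by (auto intro!: exI[of _ 1] powr_le1)
  fix r assume r: "valid_strip r"
  define A where "A = strip_area r"
  have A: "A > 0" using valid_strip_area[OF r] by (simp add: A_def)
  have "has_bochner_integral unif (\<lambda>q. indicator {q. in_strip r q} q * strip_area (strip_piece False q r) powr a
     + indicator {q. in_strip r q} q * strip_area (strip_piece True q r) powr a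
     - indicator {q. in_strip r q} q * A powr a)
     (A powr (a + 1) / (a + 1)\<^sup>2 + A powr (a + 1) / (a + 1)\<^sup>2 - A * A powr a)"
    unfolding A_def using r assms
    by (intro has_bochner_integral_diff has_bochner_integral_add has_bochner_integral_mult_left
        has_integral_powr_strip has_integral_in_strip)
  moreover have "(A powr (a + 1) / (a + 1)\<^sup>2 + A powr (a + 1) / (a + 1)\<^sup>2 - A * A powr a) =
     A powr a + rate a * A powr (a + 1) - A powr a"
    using A by (simp add: rate_def powr_add algebra_simps)
  ultimately show "has_bochner_integral unif (gain (\<lambda>m. m powr a) r)
     (strip_area r powr a + rate a * strip_area r powr (a + 1) - strip_area r powr a)"
    unfolding gain_def A_def by (simp add: algebra_simps)
qed simp

lemma mean_split_lincomb:
  assumes "mean_split F G" "mean_split F' G'"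
  shows "mean_split (\<lambda>m. c * F m + c' * F' m) (\<lambda>m. c * G m + c' * G' m)"
  unfolding mean_split_def
proof (intro conjI allI impI)
  show "(\<lambda>m. c * F m + c' * F' m) \<in> borel_measurable borel"
    using assms by (auto simp: mean_split_def)
  obtain B B' where B: "\<And>m. 0 < m \<Longrightarrow> m \<le> 1 \<Longrightarrow> \<bar>F m\<bar> \<le> B" "\<And>m. 0 < m \<Longrightarrow> m \<le> 1 \<Longrightarrow> \<bar>F' m\<bar> \<le> B'"
    using assms unfolding mean_split_def by blast
  have "\<bar>c * F m + c' * F' m\<bar> \<le> \<bar>c\<bar> * B + \<bar>c'\<bar> * B'" if "0 < m" "m \<le> 1" for m
    using B[OF that] by (intro order_trans[OF abs_triangle_ineq]) (auto simp: abs_mult intro!: add_mono mult_left_mono)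
  then show "\<exists>B. \<forall>m. 0 < m \<longrightarrow> m \<le> 1 \<longrightarrow> \<bar>c * F m + c' * F' m\<bar> \<le> B" by blast
  fix r assume r: "valid_strip r"
  have "has_bochner_integral unif (gain F r) (G (strip_area r) - F (strip_area r))"
    "has_bochner_integral unif (gain F' r) (G' (strip_area r) - F' (strip_area r))"
    using assms r unfolding mean_split_def by blast+
  then have "has_bochner_integral unif (\<lambda>q. c * gain F r q + c' * gain F' r q)
      (c * (G (strip_area r) - F (strip_area r)) + c' * (G' (strip_area r) - F' (strip_area r)))"
    by (intro has_bochner_integral_add has_bochner_integral_mult_right)
  then show "has_bochner_integral unif (gain (\<lambda>m. c * F m + c' * F' m) r)
     (c * G (strip_area r) + c' * G' (strip_area r) - (c * F (strip_area r) + c' * F' (strip_area r)))"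
    unfolding gain_def by (simp add: algebra_simps)
qed

text \<open>Equality for positive m suffices because areas are positive. This allows passing from
  \<open>m powr i\<close> to \<open>m ^ i\<close>, which may differ elsewhere, for instance at m = 0
  and i = 0.\<close>

lemma mean_split_cong:
  assumes "mean_split F G" "\<And>m. 0 < m \<Longrightarrow> F m = F' m" "\<And>m. 0 < m \<Longrightarrow> G m = G' m" "F' \<in> borel_measurable borel"
  shows "mean_split F' G'"
  unfolding mean_split_def
proof (intro conjI allI impI)
  show "\<exists>B. \<forall>m. 0 < m \<longrightarrow> m \<le> 1 \<longrightarrow> \<bar>F' m\<bar> \<le> B" using assms unfolding mean_split_def by metis
  fix r assume r: "valid_strip r"
  have "gain F' r = gain F r"
    using strip_area_pieces(1)[OF r] valid_strip_area[OF r] assms(2)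
    by (auto simp: gain_def fun_eq_iff split: split_indicator)
  then show "has_bochner_integral unif (gain F' r) (G' (strip_area r) - F' (strip_area r))"
    using assms r valid_strip_area[OF r] unfolding mean_split_def by (metis)
qed (rule assms)

text \<open>Since \<open>rate i * rate_prod i\<close> is the next \<open>rate_prod\<close>, the
  coefficient of \<open>rate_prod i * m^i\<close> collects two neighbouring binomials, and Pascal's
  rule applies.\<close>

lemma mean_split_leaf_poly: "mean_split (leaf_poly j) (leaf_poly (Suc j))"
proof -
  let ?G = "\<lambda>i m. m powr real i + rate (real i) * m powr (real i + 1)"
  have *: "mean_split (\<lambda>m. \<Sum>i\<in>I. c i * m powr real i) (\<lambda>m. \<Sum>i\<in>I. c i * ?G i m)" if "finite I"
    for I :: "nat set" and c :: "nat \<Rightarrow> real"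
    using that
  proof induction
    case empty
    show ?case using mean_split_lincomb[OF mean_split_powr[of 0] mean_split_powr[of 0], of 0 0] by simp
  next
    case (insert i I)
    then show ?case
      using mean_split_lincomb[OF mean_split_powr[of "real i"] insert.IH, of "c i" 1] by simp
  qed
  show ?thesis
  proof (rule mean_split_cong[OF *[of "{..j}" "\<lambda>i. real (j choose i) * rate_prod i"]])
    fix m :: real assume m: "0 < m"
    show "(\<Sum>i\<le>j. real (j choose i) * rate_prod i * m powr real i) = leaf_poly j m"
      using m by (simp add: leaf_poly_def powr_realpow)
    have "m powr (real i + 1) = m ^ Suc i" for i
      using m powr_realpow[of m "Suc i"] by (simp add: add_ac)
    then have "(\<Sum>i\<le>j. real (j choose i) * rate_prod i * ?G i m) =
       (\<Sum>i\<le>j. real (j choose i) * rate_prod i * m ^ i) + (\<Sum>i\<le>j. real (j choose i) * rate_prod (Suc i) * m ^ Suc i)"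
      using m by (simp add: powr_realpow algebra_simps sum.distrib rate_prod_def)
    also have "(\<Sum>i\<le>j. real (j choose i) * rate_prod i * m ^ i) = (\<Sum>i\<le>Suc j. real (j choose i) * rate_prod i * m ^ i)"
      by simp
    also have "(\<Sum>i\<le>Suc j. real (j choose i) * rate_prod i * m ^ i) =
      rate_prod 0 + (\<Sum>i\<le>j. real (j choose Suc i) * rate_prod (Suc i) * m ^ Suc i)"
      by (subst sum.atMost_Suc_shift) simp
    also have "rate_prod 0 + (\<Sum>i\<le>j. real (j choose Suc i) * rate_prod (Suc i) * m ^ Suc i) +
        (\<Sum>i\<le>j. real (j choose i) * rate_prod (Suc i) * m ^ Suc i) =
      rate_prod 0 + (\<Sum>i\<le>j. real (Suc j choose Suc i) * rate_prod (Suc i) * m ^ Suc i)"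
      by (simp add: sum.distrib[symmetric] algebra_simps)
    also have "\<dots> = leaf_poly (Suc j) m"
      unfolding leaf_poly_def by (subst sum.atMost_Suc_shift) simp
    finally show "(\<Sum>i\<le>j. real (j choose i) * rate_prod i * ?G i m) = leaf_poly (Suc j) m" .
  qed (unfold leaf_poly_def[abs_def], measurable)
qed

lemma mean_split_\<beta>: "mean_split (\<lambda>m. m powr \<beta>) (\<lambda>m. m powr \<beta>)"
  using mean_split_powr[of \<beta>] \<beta>_bounds by (simp add: rate_\<beta>)

section \<open>Conditional mean and second moment after one point\<close>

definition admissible :: "strip list \<Rightarrow> bool" where
  "admissible L \<longleftrightarrow> sorted_wrt disjoint_strips L \<and> (\<forall>r\<in>set L. valid_strip r)"

lemma admissible_left_strips: "admissible (left_strips p n)"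
  by (auto simp: admissible_def sorted_left_strips valid_left_strips)

lemma strip_sum_split: "strip_sum F (split_strips q L) = strip_sum F L + (\<Sum>r\<leftarrow>L. gain F r q)"
  by (induction L) (auto simp: strip_sum_def split_strip_def gain_def)

lemma has_integral_sum_list:
  fixes f :: "'b \<Rightarrow> 'a \<Rightarrow> real"
  assumes "\<And>r. r \<in> set L \<Longrightarrow> has_bochner_integral M (f r) (g r)"
  shows "has_bochner_integral M (\<lambda>q. \<Sum>r\<leftarrow>L. f r q) (\<Sum>r\<leftarrow>L. g r)"
  using assms by (induction L) (auto intro!: has_bochner_integral_add)

lemma has_integral_gains:
  assumes "mean_split F G" "admissible L"
  shows "has_bochner_integral unif (\<lambda>q. \<Sum>r\<leftarrow>L. gain F r q) (strip_sum G L - strip_sum F L)"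
proof -
  have "has_bochner_integral unif (\<lambda>q. \<Sum>r\<leftarrow>L. gain F r q) (\<Sum>r\<leftarrow>L. G (strip_area r) - F (strip_area r))"
    using assms by (intro has_integral_sum_list) (auto simp: mean_split_def admissible_def)
  then show ?thesis by (simp add: strip_sum_def sum_list_subtractf)
qed

lemma integral_strip_sum_split:
  assumes "mean_split F G" "admissible L"
  shows "has_bochner_integral unif (\<lambda>q. strip_sum F (split_strips q L)) (strip_sum G L)"
proof -
  have "has_bochner_integral unif (\<lambda>q. strip_sum F L + (\<Sum>r\<leftarrow>L. gain F r q))
     (strip_sum F L + (strip_sum G L - strip_sum F L))"
    using has_integral_gains[OF assms] unif.prob_space
    by (intro has_bochner_integral_add) (auto simp: has_bochner_integral_iff)
  then show ?thesis by (simp add: strip_sum_split)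
qed

text \<open>The strips have disjoint interiors, so a point splits at most one of them and all
  mixed products vanish.\<close>

lemma gains_square:
  assumes "admissible L"
  shows "(\<Sum>r\<leftarrow>L. gain F r q)\<^sup>2 = (\<Sum>r\<leftarrow>L. (gain F r q)\<^sup>2)"
  using assms
proof (induction L)
  case (Cons r L)
  have "gain F r q * (\<Sum>r\<leftarrow>L. gain F r q) = 0"
  proof (cases "in_strip r q")
    case True
    have "gain F r' q = 0" if "r' \<in> set L" for r'
    proof -
      have "disjoint_strips r r'" using Cons.prems that by (simp add: admissible_def)
      then have "\<not> in_strip r' q" using True unfolding disjoint_strips_def by blast
      then show ?thesis by (simp add: gain_def)
    qed
    then have "(\<Sum>r\<leftarrow>L. gain F r q) = 0" by (simp add: sum_list_0 cong: map_cong)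
    then show ?thesis by simp
  qed (simp add: gain_def)
  moreover have "(\<Sum>r\<leftarrow>L. gain F r q)\<^sup>2 = (\<Sum>r\<leftarrow>L. (gain F r q)\<^sup>2)"
    using Cons by (simp add: admissible_def)
  ultimately show ?case by (simp add: power2_sum)
qed simp

text \<open>Write the new sum as B + W, with B the old one. Its mean square is
  \<open>B^2 + 2 B E W + E W^2\<close>, at most \<open>(B + E W)^2 + E W^2\<close>, and disjointness
  turns \<open>E W^2\<close> into a sum over strips: a strip of area m is hit with probability m and
  then changes the sum by at most \<open>b m\<close>.\<close>

lemma integral_strip_sum_split_square:
  assumes FG: "mean_split F G" and L: "admissible L"
    and b: "\<And>m x y. 0 < x \<Longrightarrow> 0 < y \<Longrightarrow> x + y \<le> m \<Longrightarrow> m \<le> 1 \<Longrightarrow> \<bar>F x + F y - F m\<bar> \<le> b m"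
  shows "integrable unif (\<lambda>q. (strip_sum F (split_strips q L))\<^sup>2)"
    "(LINT q|unif. (strip_sum F (split_strips q L))\<^sup>2) \<le> (strip_sum G L)\<^sup>2 + strip_sum (\<lambda>m. m * (b m)\<^sup>2) L"
proof -
  define W where "W q = (\<Sum>r\<leftarrow>L. gain F r q)" for q
  define B where "B = strip_sum F L"
  have W: "has_bochner_integral unif W (strip_sum G L - B)"
    unfolding W_def B_def by (rule has_integral_gains[OF FG L])
  have [measurable]: "F \<in> borel_measurable borel" using FG by (simp add: mean_split_def)
  have g2: "(gain F r q)\<^sup>2 \<le> indicator {q. in_strip r q} q * (b (strip_area r))\<^sup>2" if "r \<in> set L" for r q
  proof (cases "in_strip r q")
    case True
    have r: "valid_strip r" using L that by (auto simp: admissible_def)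
    have "\<bar>gain F r q\<bar> \<le> b (strip_area r)"
      using b strip_area_pieces[OF r True] valid_strip_area[OF r] True by (simp add: gain_def)
    then show ?thesis using True by (simp add: abs_le_square_iff[symmetric])
  qed (simp add: gain_def)
  have bd: "has_bochner_integral unif (\<lambda>q. \<Sum>r\<leftarrow>L. indicator {q. in_strip r q} q * (b (strip_area r))\<^sup>2)
      (\<Sum>r\<leftarrow>L. strip_area r * (b (strip_area r))\<^sup>2)"
    using L by (intro has_integral_sum_list has_bochner_integral_mult_left has_integral_in_strip)
       (auto simp: admissible_def)
  have le: "(W q)\<^sup>2 \<le> (\<Sum>r\<leftarrow>L. indicator {q. in_strip r q} q * (b (strip_area r))\<^sup>2)" for q
    unfolding W_def gains_square[OF L] by (intro sum_list_mono g2)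
  have int2: "integrable unif (\<lambda>q. (W q)\<^sup>2)"
  proof (rule Bochner_Integration.integrable_bound)
    show "integrable unif (\<lambda>q. \<Sum>r\<leftarrow>L. indicator {q. in_strip r q} q * (b (strip_area r))\<^sup>2)"
      using bd by (simp add: has_bochner_integral_iff)
    show "(\<lambda>q. (W q)\<^sup>2) \<in> borel_measurable unif"
      using W by (auto simp: has_bochner_integral_iff)
    show "AE q in unif. norm ((W q)\<^sup>2) \<le> norm (\<Sum>r\<leftarrow>L. indicator {q. in_strip r q} q * (b (strip_area r))\<^sup>2)"
      using le by (auto intro!: order_trans[OF _ abs_ge_self])
  qed
  have W2: "(LINT q|unif. (W q)\<^sup>2) \<le> strip_sum (\<lambda>m. m * (b m)\<^sup>2) L"
  proof -
    have "(LINT q|unif. (W q)\<^sup>2) \<le> (LINT q|unif. (\<Sum>r\<leftarrow>L. indicator {q. in_strip r q} q * (b (strip_area r))\<^sup>2))"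
      using bd by (intro integral_mono int2 le) (simp add: has_bochner_integral_iff)
    then show ?thesis using bd by (simp add: has_bochner_integral_iff strip_sum_def)
  qed
  have "has_bochner_integral unif (\<lambda>q. B\<^sup>2 + 2 * B * W q + (W q)\<^sup>2)
     (B\<^sup>2 + 2 * B * (strip_sum G L - B) + (LINT q|unif. (W q)\<^sup>2))"
    using int2 unif.prob_space
    by (intro has_bochner_integral_add has_bochner_integral_mult_right W) (auto simp: has_bochner_integral_iff)
  moreover have "(strip_sum F (split_strips q L))\<^sup>2 = B\<^sup>2 + 2 * B * W q + (W q)\<^sup>2" for q
    by (simp add: strip_sum_split B_def W_def power2_sum)
  ultimately have *: "has_bochner_integral unif (\<lambda>q. (strip_sum F (split_strips q L))\<^sup>2)
     (B\<^sup>2 + 2 * B * (strip_sum G L - B) + (LINT q|unif. (W q)\<^sup>2))" by simp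
  then show "integrable unif (\<lambda>q. (strip_sum F (split_strips q L))\<^sup>2)" by (simp add: has_bochner_integral_iff)
  have "B\<^sup>2 + 2 * B * (strip_sum G L - B) \<le> (strip_sum G L)\<^sup>2"
    using zero_le_power2[of "strip_sum G L - B"] by (simp add: power2_eq_square algebra_simps)
  then show "(LINT q|unif. (strip_sum F (split_strips q L))\<^sup>2) \<le> (strip_sum G L)\<^sup>2 + strip_sum (\<lambda>m. m * (b m)\<^sup>2) L"
    using * W2 by (simp add: has_bochner_integral_iff)
qed

section \<open>The Markov chain of strips\<close>

lemma in_strip_pred [measurable (raw)]:
  assumes [measurable]: "f \<in> M \<rightarrow>\<^sub>M borel" "g \<in> M \<rightarrow>\<^sub>M borel"
  shows "Measurable.pred M (\<lambda>x. in_strip (f x) (g x))"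
  unfolding in_strip_alt by measurable

lemma strip_piece_measurable [measurable (raw)]:
  assumes [measurable]: "f \<in> M \<rightarrow>\<^sub>M borel" "g \<in> M \<rightarrow>\<^sub>M borel"
  shows "(\<lambda>x. strip_piece b (g x) (f x)) \<in> M \<rightarrow>\<^sub>M borel"
  unfolding strip_piece_alt by (cases b; simp add: borel_prod[symmetric]; measurable)

lemma strip_area_measurable [measurable]: "strip_area \<in> borel_measurable borel"
  unfolding strip_area_alt[abs_def] by measurable

lemma sum_list_split_strips:
  fixes \<Psi> :: "strip \<Rightarrow> real"
  shows "(\<Sum>r\<leftarrow>split_strips q L. \<Psi> r) =
    (\<Sum>r\<leftarrow>L. if in_strip r q then \<Psi> (strip_piece False q r) + \<Psi> (strip_piece True q r) else \<Psi> r)"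
  by (induction L) (auto simp: split_strip_def)

text \<open>Lists of strips are never random elements themselves; only sums over them are. The
  weight \<Psi> may depend on \<omega>, so that the induction can absorb the last point into
  it.\<close>

lemma measurable_left_strips_sum:
  fixes \<Psi> :: "strip \<Rightarrow> 'a \<Rightarrow> real"
  assumes "\<And>i. 1 \<le> i \<Longrightarrow> i \<le> n \<Longrightarrow> p i \<in> M' \<rightarrow>\<^sub>M borel"
    and "(\<lambda>x. \<Psi> (fst x) (snd x)) \<in> borel_measurable (borel \<Otimes>\<^sub>M M')"
  shows "(\<lambda>\<omega>. \<Sum>r\<leftarrow>left_strips (\<lambda>i. p i \<omega>) n. \<Psi> r \<omega>) \<in> borel_measurable M'"
  using assms
proof (induction n arbitrary: \<Psi>)
  case 0
  have "(\<lambda>\<omega>. (\<lambda>x. \<Psi> (fst x) (snd x)) ((1, 0, 1), \<omega>)) \<in> borel_measurable M'"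
    by (rule measurable_compose[OF _ 0(2)]) measurable
  then show ?case by simp
next
  case (Suc n)
  have [measurable]: "p (Suc n) \<in> M' \<rightarrow>\<^sub>M borel" using Suc.prems by simp
  define \<Psi>' where "\<Psi>' r \<omega> = (if in_strip r (p (Suc n) \<omega>) then \<Psi> (strip_piece False (p (Suc n) \<omega>) r) \<omega> +
      \<Psi> (strip_piece True (p (Suc n) \<omega>) r) \<omega> else \<Psi> r \<omega>)" for r \<omega>
  have [measurable]: "(\<lambda>x. \<Psi> (strip_piece b (p (Suc n) (snd x)) (fst x)) (snd x)) \<in> borel_measurable (borel \<Otimes>\<^sub>M M')" for b
    using measurable_compose[OF _ Suc.prems(2), of "\<lambda>x. (strip_piece b (p (Suc n) (snd x)) (fst x), snd x)" "borel \<Otimes>\<^sub>M M'"]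
    by simp
  note [measurable] = Suc.prems(2)
  have "(\<lambda>x. \<Psi>' (fst x) (snd x)) \<in> borel_measurable (borel \<Otimes>\<^sub>M M')"
    unfolding \<Psi>'_def by measurable
  from Suc.IH[OF Suc.prems(1) this] show ?case
    by (simp add: sum_list_split_strips \<Psi>'_def)
qed

lemma length_split_strips: "length (split_strips q L) \<le> 2 * length L"
  by (induction L) (auto simp: split_strip_def)

lemma length_left_strips: "length (left_strips p n) \<le> 2 ^ n"
  by (induction n) (auto intro: order_trans[OF length_split_strips])

text \<open>Each point at most doubles the list. Crude as it is, this makes every such sum bounded
  at a fixed step, which settles integrability there.\<close>

lemma abs_strip_sum_le:
  assumes "\<And>m. 0 < m \<Longrightarrow> m \<le> 1 \<Longrightarrow> \<bar>F m\<bar> \<le> B" "B \<ge> 0"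
  shows "\<bar>strip_sum F (left_strips p n)\<bar> \<le> 2 ^ n * B"
proof -
  have "\<bar>strip_sum F L\<bar> \<le> real (length L) * B" if "\<forall>r\<in>set L. valid_strip r" for L
    using that
  proof (induction L)
    case (Cons r L)
    then have "\<bar>F (strip_area r)\<bar> \<le> B" using assms(1) valid_strip_area by simp
    then show ?case using Cons by (simp add: strip_sum_def algebra_simps)
  qed (simp add: strip_sum_def)
  then have "\<bar>strip_sum F (left_strips p n)\<bar> \<le> real (length (left_strips p n)) * B"
    using valid_left_strips by blast
  also have "\<dots> \<le> 2 ^ n * B"
    using length_left_strips[of p n] assms(2) by (intro mult_right_mono) (simp_all flip: of_nat_le_iff)
  finally show ?thesis .
qed

lemma total_area_le_1: "strip_sum (\<lambda>m. m) (left_strips p n) \<le> 1"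
proof (induction n)
  case 0
  show ?case by (simp add: strip_sum_def)
next
  case (Suc n)
  have "strip_sum (\<lambda>m. m) (split_strips q L) \<le> strip_sum (\<lambda>m. m) L" if "\<forall>r\<in>set L. valid_strip r" for q L
    using that
  proof (induction L)
    case (Cons r L)
    have "(\<Sum>s\<leftarrow>split_strip q r. strip_area s) \<le> strip_area r"
      using strip_area_pieces(2)[of r q] Cons.prems by (simp add: split_strip_def)
    then show ?case using Cons by (simp add: strip_sum_def)
  qed (simp add: strip_sum_def)
  from this[of "left_strips p n" "p (Suc n)"] show ?case using Suc valid_left_strips by simp
qed

lemma strip_sum_mono:
  assumes "\<And>m. 0 < m \<Longrightarrow> m \<le> 1 \<Longrightarrow> F m \<le> F' m"
  shows "strip_sum F (left_strips p n) \<le> strip_sum F' (left_strips p n)"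
  unfolding strip_sum_def using assms valid_strip_area valid_left_strips by (intro sum_list_mono) blast

lemma strip_sum_cong:
  assumes "\<And>m. 0 < m \<Longrightarrow> m \<le> 1 \<Longrightarrow> F m = F' m"
  shows "strip_sum F (left_strips p n) = strip_sum F' (left_strips p n)"
  using assms by (intro antisym strip_sum_mono) auto

lemma strip_sum_lincomb:
  "strip_sum (\<lambda>m. c * F m + c' * F' m) L = c * strip_sum F L + c' * strip_sum F' L"
  by (induction L) (auto simp: strip_sum_def algebra_simps)

definition bounded_weight :: "(real \<Rightarrow> real) \<Rightarrow> bool" where
  "bounded_weight F \<longleftrightarrow> F \<in> borel_measurable borel \<and> (\<exists>B. \<forall>m. 0 < m \<longrightarrow> m \<le> 1 \<longrightarrow> \<bar>F m\<bar> \<le> B)"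

lemma mean_split_bounded_weight: "mean_split F F' \<Longrightarrow> bounded_weight F"
  by (auto simp: mean_split_def bounded_weight_def)

lemma bounded_weight_powr: "a \<ge> 0 \<Longrightarrow> bounded_weight (\<lambda>m. m powr a)"
  using mean_split_powr mean_split_bounded_weight by blast

lemma bounded_weight_lincomb:
  assumes "bounded_weight F" "bounded_weight F'"
  shows "bounded_weight (\<lambda>m. c * F m + c' * F' m)"
proof -
  obtain B B' where B: "\<And>m. 0 < m \<Longrightarrow> m \<le> 1 \<Longrightarrow> \<bar>F m\<bar> \<le> B" "\<And>m. 0 < m \<Longrightarrow> m \<le> 1 \<Longrightarrow> \<bar>F' m\<bar> \<le> B'"
    using assms unfolding bounded_weight_def by blast
  have "\<bar>c * F m + c' * F' m\<bar> \<le> \<bar>c\<bar> * B + \<bar>c'\<bar> * B'" if "0 < m" "m \<le> 1" for m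
    using B[OF that] by (intro order_trans[OF abs_triangle_ineq]) (auto simp: abs_mult intro!: add_mono mult_left_mono)
  then show ?thesis using assms unfolding bounded_weight_def by auto
qed

text \<open>The sigma-algebra \<open>G n\<close> may contain more than the first n positions; the
  next position is independent of all of it. This freedom lets the Poisson case put the arrival
  times into every \<open>G n\<close>.\<close>

locale uniform_chain = prob_space P for P :: "'a measure" +
  fixes G :: "nat \<Rightarrow> 'a measure" and p :: "nat \<Rightarrow> 'a \<Rightarrow> real \<times> real"
  assumes subalg: "\<And>n. subalgebra P (G n)"
    and G_mono: "\<And>n. sets (G n) \<subseteq> sets (G (Suc n))"
    and p_measurable: "\<And>n. p (Suc n) \<in> G (Suc n) \<rightarrow>\<^sub>M borel"
    and p_indep: "\<And>n A C. A \<in> sets (G n) \<Longrightarrow> C \<in> sets borel \<Longrightarrow>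
      prob (A \<inter> p (Suc n) -` C) = prob A * measure unif C"
begin

definition S :: "(real \<Rightarrow> real) \<Rightarrow> nat \<Rightarrow> 'a \<Rightarrow> real" where
  "S F n \<omega> = strip_sum F (left_strips (\<lambda>i. p i \<omega>) n)"

lemma space_G [simp]: "space (G n) = space P"
  using subalg by (auto simp: subalgebra_def)

lemma G_le: "m \<le> n \<Longrightarrow> sets (G m) \<subseteq> sets (G n)"
  by (induction n rule: dec_induct) (use G_mono in auto)

lemma measurable_G_le: "f \<in> G m \<rightarrow>\<^sub>M M \<Longrightarrow> m \<le> n \<Longrightarrow> f \<in> G n \<rightarrow>\<^sub>M M"
  using G_le[of m n] by (auto simp: measurable_def)

lemma measurable_G_P: "f \<in> G m \<rightarrow>\<^sub>M M \<Longrightarrow> f \<in> P \<rightarrow>\<^sub>M M"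
  using subalg[of m] by (rule measurable_from_subalg)

lemma p_measurable_G: "1 \<le> i \<Longrightarrow> i \<le> n \<Longrightarrow> p i \<in> G n \<rightarrow>\<^sub>M borel"
  using measurable_G_le[OF p_measurable[of "i - 1"], of n] by simp

lemma S_measurable: "F \<in> borel_measurable borel \<Longrightarrow> S F n \<in> borel_measurable (G n)"
  unfolding S_def strip_sum_def
  by (intro measurable_left_strips_sum p_measurable_G) simp_all

lemma S_measurable_P: "F \<in> borel_measurable borel \<Longrightarrow> S F n \<in> borel_measurable P"
  by (rule measurable_G_P[OF S_measurable])

lemma S_bounded:
  assumes "bounded_weight F" shows "\<exists>B\<ge>0. \<forall>\<omega>. \<bar>S F n \<omega>\<bar> \<le> B"
proof -
  obtain B where B: "\<And>m. 0 < m \<Longrightarrow> m \<le> 1 \<Longrightarrow> \<bar>F m\<bar> \<le> B"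
    using assms unfolding bounded_weight_def by blast
  moreover have "B \<ge> 0" using B[of 1] by simp
  ultimately have "\<bar>S F n \<omega>\<bar> \<le> 2 ^ n * B" for \<omega>
    unfolding S_def by (intro abs_strip_sum_le) auto
  with \<open>B \<ge> 0\<close> show ?thesis by (intro exI[of _ "2 ^ n * B"]) auto
qed

lemma S_lincomb: "S (\<lambda>m. c * F m + c' * F' m) n \<omega> = c * S F n \<omega> + c' * S F' n \<omega>"
  by (simp add: S_def strip_sum_lincomb)

lemma S_0: "S F 0 \<omega> = F 1"
  by (simp add: S_def strip_sum_def)

definition bounded_rv :: "nat \<Rightarrow> ('a \<Rightarrow> real) \<Rightarrow> bool" where
  "bounded_rv n X \<longleftrightarrow> X \<in> borel_measurable (G n) \<and> (\<exists>B\<ge>0. \<forall>\<omega>\<in>space P. \<bar>X \<omega>\<bar> \<le> B)"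

lemma bounded_rv_S: "bounded_weight F \<Longrightarrow> bounded_rv n (S F n)"
  using S_bounded[of F n] S_measurable[of F n] by (auto simp: bounded_rv_def bounded_weight_def)

lemma bounded_rv_mult:
  assumes "bounded_rv n X" "bounded_rv n Y" shows "bounded_rv n (\<lambda>\<omega>. X \<omega> * Y \<omega>)"
proof -
  obtain B B' where B: "\<forall>\<omega>\<in>space P. \<bar>X \<omega>\<bar> \<le> B" "\<forall>\<omega>\<in>space P. \<bar>Y \<omega>\<bar> \<le> B'" "B \<ge> 0" "B' \<ge> 0"
    using assms by (auto simp: bounded_rv_def)
  then have "\<forall>\<omega>\<in>space P. \<bar>X \<omega> * Y \<omega>\<bar> \<le> B * B'" "B * B' \<ge> 0" by (auto simp: abs_mult intro!: mult_mono)
  then show ?thesis using assms by (auto simp: bounded_rv_def)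
qed

lemma bounded_rv_diff:
  assumes "bounded_rv n X" "bounded_rv n Y" shows "bounded_rv n (\<lambda>\<omega>. X \<omega> - Y \<omega>)"
proof -
  obtain B B' where B: "\<forall>\<omega>\<in>space P. \<bar>X \<omega>\<bar> \<le> B" "\<forall>\<omega>\<in>space P. \<bar>Y \<omega>\<bar> \<le> B'" "B \<ge> 0" "B' \<ge> 0"
    using assms by (auto simp: bounded_rv_def)
  then have "\<forall>\<omega>\<in>space P. \<bar>X \<omega> - Y \<omega>\<bar> \<le> B + B'" "B + B' \<ge> 0" by fastforce+
  then show ?thesis using assms by (auto simp: bounded_rv_def)
qed

lemma bounded_rv_square: "bounded_rv n X \<Longrightarrow> bounded_rv n (\<lambda>\<omega>. (X \<omega>)\<^sup>2)"
  using bounded_rv_mult[of n X X] by (simp add: power2_eq_square)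

lemma bounded_rv_le: "bounded_rv m X \<Longrightarrow> m \<le> n \<Longrightarrow> bounded_rv n X"
  using measurable_G_le by (auto simp: bounded_rv_def)

lemma bounded_rv_indicator: "H \<in> sets (G n) \<Longrightarrow> bounded_rv n (indicator H)"
  by (auto simp: bounded_rv_def indicator_def intro!: exI[of _ 1])

lemma bounded_rv_integrable: "bounded_rv n X \<Longrightarrow> integrable P X"
proof -
  assume X: "bounded_rv n X"
  then obtain B where "\<forall>\<omega>\<in>space P. \<bar>X \<omega>\<bar> \<le> B" by (auto simp: bounded_rv_def)
  with X show ?thesis
    by (intro integrable_const_bound[of _ B]) (auto simp: bounded_rv_def dest: measurable_G_P)
qed

text \<open>Freezing: the pair of the next position and \<omega>, with \<omega> seen through
  \<open>G n\<close>, has a product law, so Fubini's theorem integrates the next position out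
  first.\<close>

lemma expectation_step:
  assumes \<Psi>: "(\<lambda>x. \<Psi> (fst x) (snd x)) \<in> borel_measurable (borel \<Otimes>\<^sub>M G n)"
    and B: "\<And>q \<omega>. \<omega> \<in> space P \<Longrightarrow> \<bar>\<Psi> q \<omega>\<bar> \<le> (B :: real)"
  shows "(\<lambda>\<omega>. LINT q|unif. \<Psi> q \<omega>) \<in> borel_measurable (G n)"
    and "expectation (\<lambda>\<omega>. \<Psi> (p (Suc n) \<omega>) \<omega>) = expectation (\<lambda>\<omega>. LINT q|unif. \<Psi> q \<omega>)"
proof -
  note [measurable] = \<Psi>
  \<comment> \<open>The image under the identity is P restricted to \<open>G n\<close>.\<close>
  let ?D = "distr P (G n) (\<lambda>\<omega>. \<omega>)"
  have id: "(\<lambda>\<omega>. \<omega>) \<in> P \<rightarrow>\<^sub>M G n" by (rule measurable_G_P[of _ n]) simp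
  have [measurable]: "p (Suc n) \<in> P \<rightarrow>\<^sub>M borel" by (rule measurable_G_P[OF p_measurable])
  interpret D: prob_space ?D by (rule prob_space_distr[OF id])
  interpret pair_sigma_finite unif ?D ..
  have swap: "(\<lambda>x. \<Psi> (snd x) (fst x)) \<in> borel_measurable (G n \<Otimes>\<^sub>M unif)"
    using measurable_compose[OF measurable_pair_swap' \<Psi>]
    by (simp add: case_prod_beta cong: measurable_cong_sets)
  then show m: "(\<lambda>\<omega>. LINT q|unif. \<Psi> q \<omega>) \<in> borel_measurable (G n)"
    by (intro unif.borel_measurable_lebesgue_integral) (simp add: case_prod_beta)
  have eq: "distr P (borel \<Otimes>\<^sub>M G n) (\<lambda>\<omega>. (p (Suc n) \<omega>, \<omega>)) = unif \<Otimes>\<^sub>M ?D"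
  proof (rule pair_measure_eqI[symmetric])
    show "sigma_finite_measure unif" "sigma_finite_measure ?D" by unfold_locales
    show "sets (unif \<Otimes>\<^sub>M ?D) = sets (distr P (borel \<Otimes>\<^sub>M G n) (\<lambda>\<omega>. (p (Suc n) \<omega>, \<omega>)))"
      by (simp cong: sets_pair_measure_cong)
    fix C A assume "C \<in> sets unif" "A \<in> sets ?D"
    then have CA: "C \<in> sets borel" "A \<in> sets (G n)" by simp_all
    have A: "A \<in> sets P" using CA subalg[of n] by (auto simp: subalgebra_def)
    have pair: "(\<lambda>\<omega>. (p (Suc n) \<omega>, \<omega>)) \<in> P \<rightarrow>\<^sub>M borel \<Otimes>\<^sub>M G n" using id by measurable
    have "emeasure (distr P (borel \<Otimes>\<^sub>M G n) (\<lambda>\<omega>. (p (Suc n) \<omega>, \<omega>))) (C \<times> A) =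
        emeasure P ((\<lambda>\<omega>. (p (Suc n) \<omega>, \<omega>)) -` (C \<times> A) \<inter> space P)"
      using CA by (intro emeasure_distr[OF pair]) auto
    also have "(\<lambda>\<omega>. (p (Suc n) \<omega>, \<omega>)) -` (C \<times> A) \<inter> space P = A \<inter> p (Suc n) -` C"
      using sets.sets_into_space[OF A] by auto
    also have "emeasure P \<dots> = emeasure unif C * emeasure P A"
      using p_indep[OF CA(2,1)] by (simp add: emeasure_eq_measure unif.emeasure_eq_measure ennreal_mult' mult.commute)
    also have "emeasure P A = emeasure ?D A"
      using sets.sets_into_space[OF A] CA by (subst emeasure_distr[OF id]) (auto simp: Int_absorb2)
    finally show "emeasure unif C * emeasure ?D A = emeasure (distr P (borel \<Otimes>\<^sub>M G n) (\<lambda>\<omega>. (p (Suc n) \<omega>, \<omega>))) (C \<times> A)"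
      by simp
  qed
  have "integrable (unif \<Otimes>\<^sub>M ?D) (\<lambda>(q, \<omega>). \<Psi> q \<omega>)"
  proof -
    interpret UD: prob_space "unif \<Otimes>\<^sub>M ?D"
      unfolding eq[symmetric] by (rule prob_space_distr) (use id in measurable)
    show ?thesis
      by (rule UD.integrable_const_bound[of _ B])
         (use B \<Psi> in \<open>auto simp: space_pair_measure case_prod_beta cong: measurable_cong_sets\<close>)
  qed
  then have "(LINT \<omega>|?D. (LINT q|unif. \<Psi> q \<omega>)) = (LINT x|(unif \<Otimes>\<^sub>M ?D). \<Psi> (fst x) (snd x))"
    by (subst integral_snd) (simp_all add: case_prod_beta')
  also have "\<dots> = expectation (\<lambda>\<omega>. \<Psi> (p (Suc n) \<omega>) \<omega>)"
    unfolding eq[symmetric] using id by (subst integral_distr) auto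
  also have "(LINT \<omega>|?D. (LINT q|unif. \<Psi> q \<omega>)) = expectation (\<lambda>\<omega>. LINT q|unif. \<Psi> q \<omega>)"
    by (subst integral_distr[OF id m]) simp
  finally show "expectation (\<lambda>\<omega>. \<Psi> (p (Suc n) \<omega>) \<omega>) = expectation (\<lambda>\<omega>. LINT q|unif. \<Psi> q \<omega>)" by simp
qed

lemma S_split_measurable:
  assumes [measurable]: "F \<in> borel_measurable borel"
  shows "(\<lambda>x. strip_sum F (split_strips (fst x) (left_strips (\<lambda>i. p i (snd x)) n))) \<in> borel_measurable (borel \<Otimes>\<^sub>M G n)"
  unfolding strip_sum_def sum_list_split_strips
  by (rule measurable_left_strips_sum[of n "\<lambda>i x. p i (snd x)"])
     (auto intro!: measurable_compose[OF measurable_snd p_measurable_G])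

lemma strip_sum_split_bounded:
  assumes "bounded_weight F"
  shows "\<exists>B\<ge>0. \<forall>q \<omega>. \<bar>strip_sum F (split_strips q (left_strips (\<lambda>i. p i \<omega>) n))\<bar> \<le> B"
proof -
  obtain B where B: "\<And>m. 0 < m \<Longrightarrow> m \<le> 1 \<Longrightarrow> \<bar>F m\<bar> \<le> B"
    using assms unfolding bounded_weight_def by blast
  moreover have "B \<ge> 0" using B[of 1] by simp
  \<comment> \<open>Overwriting entry n + 1 by q leaves the first n entries alone, so this is again
    the strip list of a sequence and inherits its bound.\<close>
  moreover have "split_strips q (left_strips (\<lambda>i. p i \<omega>) n) = left_strips ((\<lambda>i. p i \<omega>)(Suc n := q)) (Suc n)" for q \<omega>
    using left_strips_cong[of n "\<lambda>i. p i \<omega>" "(\<lambda>i. p i \<omega>)(Suc n := q)"] by simp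
  ultimately have "\<bar>strip_sum F (split_strips q (left_strips (\<lambda>i. p i \<omega>) n))\<bar> \<le> 2 ^ Suc n * B" for q \<omega>
    using abs_strip_sum_le[of F B _ "Suc n"] by metis
  with \<open>B \<ge> 0\<close> show ?thesis by (intro exI[of _ "2 ^ Suc n * B"]) auto
qed

lemma S_Suc: "S F (Suc n) \<omega> = strip_sum F (split_strips (p (Suc n) \<omega>) (left_strips (\<lambda>i. p i \<omega>) n))"
  by (simp add: S_def)

text \<open>Conditional expectation in weak form: X ranges over the bounded variables known at step
  n.\<close>

lemma expectation_S_Suc:
  assumes F: "mean_split F F'" and X: "bounded_rv n X"
  shows "expectation (\<lambda>\<omega>. X \<omega> * S F (Suc n) \<omega>) = expectation (\<lambda>\<omega>. X \<omega> * S F' n \<omega>)"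
proof -
  have [measurable]: "F \<in> borel_measurable borel" "X \<in> borel_measurable (G n)"
    using F X by (auto simp: mean_split_def bounded_rv_def)
  note [measurable] = S_split_measurable[of F n]
  let ?\<Psi> = "\<lambda>q \<omega>. X \<omega> * strip_sum F (split_strips q (left_strips (\<lambda>i. p i \<omega>) n))"
  obtain B B' where B: "\<forall>q \<omega>. \<bar>strip_sum F (split_strips q (left_strips (\<lambda>i. p i \<omega>) n))\<bar> \<le> B"
      "\<forall>\<omega>\<in>space P. \<bar>X \<omega>\<bar> \<le> B'" "B \<ge> 0" "B' \<ge> 0"
    using strip_sum_split_bounded[OF mean_split_bounded_weight[OF F], of n] X by (auto simp: bounded_rv_def)
  have 1: "expectation (\<lambda>\<omega>. ?\<Psi> (p (Suc n) \<omega>) \<omega>) = expectation (\<lambda>\<omega>. LINT q|unif. ?\<Psi> q \<omega>)"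
  proof (rule expectation_step(2))
    show "\<bar>?\<Psi> q \<omega>\<bar> \<le> B' * B" if "\<omega> \<in> space P" for q \<omega>
      using mult_mono[OF B(2)[rule_format, OF that] B(1)[rule_format, of q \<omega>]] B(3,4)
      by (simp add: abs_mult)
  qed measurable
  have 2: "(LINT q|unif. ?\<Psi> q \<omega>) = X \<omega> * S F' n \<omega>" for \<omega>
    using has_bochner_integral_mult_right[OF integral_strip_sum_split[OF F admissible_left_strips], of "X \<omega>" "\<lambda>i. p i \<omega>" n]
    by (simp add: has_bochner_integral_iff S_def)
  show ?thesis by (simp only: S_Suc 1 2)
qed

text \<open>The last term bounds the contribution of the conditional variance, with
  \<open>b m\<close> controlling the jump at a strip of area m; X is a nonnegative test variable
  known at step n.\<close>

lemma expectation_S_Suc_square: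
  assumes F: "mean_split F F'" and X: "bounded_rv n X" "\<And>\<omega>. X \<omega> \<ge> 0"
    and b: "\<And>m x y. 0 < x \<Longrightarrow> 0 < y \<Longrightarrow> x + y \<le> m \<Longrightarrow> m \<le> 1 \<Longrightarrow> \<bar>F x + F y - F m\<bar> \<le> b m"
    and F': "bounded_weight F'" and b2: "bounded_weight (\<lambda>m. m * (b m)\<^sup>2)"
  shows "expectation (\<lambda>\<omega>. X \<omega> * (S F (Suc n) \<omega>)\<^sup>2) \<le>
    expectation (\<lambda>\<omega>. X \<omega> * (S F' n \<omega>)\<^sup>2) + expectation (\<lambda>\<omega>. X \<omega> * S (\<lambda>m. m * (b m)\<^sup>2) n \<omega>)"
proof -
  have [measurable]: "F \<in> borel_measurable borel" "X \<in> borel_measurable (G n)"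
    using F X by (auto simp: mean_split_def bounded_rv_def)
  note [measurable] = S_split_measurable[of F n]
  let ?\<Psi> = "\<lambda>q \<omega>. X \<omega> * (strip_sum F (split_strips q (left_strips (\<lambda>i. p i \<omega>) n)))\<^sup>2"
  obtain B B' where B: "\<forall>q \<omega>. \<bar>strip_sum F (split_strips q (left_strips (\<lambda>i. p i \<omega>) n))\<bar> \<le> B"
      "\<forall>\<omega>\<in>space P. \<bar>X \<omega>\<bar> \<le> B'" "B \<ge> 0" "B' \<ge> 0"
    using strip_sum_split_bounded[OF mean_split_bounded_weight[OF F], of n] X by (auto simp: bounded_rv_def)
  have bnd: "\<bar>?\<Psi> q \<omega>\<bar> \<le> B' * B\<^sup>2" if "\<omega> \<in> space P" for q \<omega>
  proof -
    have "(strip_sum F (split_strips q (left_strips (\<lambda>i. p i \<omega>) n)))\<^sup>2 \<le> B\<^sup>2"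
      using B(1)[rule_format, of q \<omega>] B(3) by (simp add: power2_le_iff_abs_le)
    from mult_mono[OF B(2)[rule_format, OF that] this] B(4) show ?thesis by (simp add: abs_mult)
  qed
  have m: "(\<lambda>x. ?\<Psi> (fst x) (snd x)) \<in> borel_measurable (borel \<Otimes>\<^sub>M G n)" by measurable
  have le: "(LINT q|unif. ?\<Psi> q \<omega>) \<le> X \<omega> * (S F' n \<omega>)\<^sup>2 + X \<omega> * S (\<lambda>m. m * (b m)\<^sup>2) n \<omega>" for \<omega>
  proof -
    have "(LINT q|unif. ?\<Psi> q \<omega>) = X \<omega> * (LINT q|unif. (strip_sum F (split_strips q (left_strips (\<lambda>i. p i \<omega>) n)))\<^sup>2)"
      by simp
    also have "\<dots> \<le> X \<omega> * ((S F' n \<omega>)\<^sup>2 + S (\<lambda>m. m * (b m)\<^sup>2) n \<omega>)"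
      unfolding S_def using integral_strip_sum_split_square(2)[OF F admissible_left_strips b] X(2)
      by (intro mult_left_mono) auto
    finally show ?thesis by (simp add: algebra_simps)
  qed
  have "expectation (\<lambda>\<omega>. X \<omega> * (S F (Suc n) \<omega>)\<^sup>2) = expectation (\<lambda>\<omega>. LINT q|unif. ?\<Psi> q \<omega>)"
    using expectation_step(2)[OF m bnd] by (simp add: S_Suc)
  also have "\<dots> \<le> expectation (\<lambda>\<omega>. X \<omega> * (S F' n \<omega>)\<^sup>2 + X \<omega> * S (\<lambda>m. m * (b m)\<^sup>2) n \<omega>)"
  proof (rule integral_mono)
    have "\<bar>LINT q|unif. ?\<Psi> q \<omega>\<bar> \<le> B' * B\<^sup>2" if "\<omega> \<in> space P" for \<omega>
    proof -
      have "norm (LINT q|unif. ?\<Psi> q \<omega>) \<le> (LINT q|unif. norm (?\<Psi> q \<omega>))" by (rule integral_norm_bound)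
      also have "\<dots> \<le> (LINT q|unif. B' * B\<^sup>2)"
        using bnd[OF that] B by (intro integral_mono') (simp_all only: real_norm_def, auto)
      finally show ?thesis using unif.prob_space by simp
    qed
    then show "integrable P (\<lambda>\<omega>. LINT q|unif. ?\<Psi> q \<omega>)"
      by (intro integrable_const_bound[of _ "B' * B\<^sup>2"] measurable_G_P[OF expectation_step(1)[OF m bnd]]) auto
    show "integrable P (\<lambda>\<omega>. X \<omega> * (S F' n \<omega>)\<^sup>2 + X \<omega> * S (\<lambda>m. m * (b m)\<^sup>2) n \<omega>)"
      by (intro Bochner_Integration.integrable_add bounded_rv_integrable[of n] bounded_rv_mult X bounded_rv_square bounded_rv_S F' b2)
  qed (rule le)
  also have "\<dots> = expectation (\<lambda>\<omega>. X \<omega> * (S F' n \<omega>)\<^sup>2) + expectation (\<lambda>\<omega>. X \<omega> * S (\<lambda>m. m * (b m)\<^sup>2) n \<omega>)"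
    by (intro Bochner_Integration.integral_add bounded_rv_integrable[of n] bounded_rv_mult X bounded_rv_square bounded_rv_S F' b2)
  finally show ?thesis .
qed

end

lemma bounded_weight_mult_powr: "a \<ge> 0 \<Longrightarrow> bounded_weight (\<lambda>m. m * (c * m powr a)\<^sup>2)"
proof -
  assume "a \<ge> 0"
  then have "\<bar>m * (c * m powr a)\<^sup>2\<bar> \<le> c\<^sup>2" if "0 < m" "m \<le> 1" for m
  proof -
    have "m powr a \<le> 1" using that \<open>a \<ge> 0\<close> by (intro powr_le1) auto
    then have "(m powr a)\<^sup>2 \<le> 1" by (intro power_le_one) auto
    then have "m * (m powr a)\<^sup>2 \<le> 1" using that by (intro mult_le_one) auto
    then have "c\<^sup>2 * (m * (m powr a)\<^sup>2) \<le> c\<^sup>2" by (intro mult_left_le) auto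
    then show ?thesis using that by (simp add: power_mult_distrib mult_ac abs_mult)
  qed
  then show ?thesis unfolding bounded_weight_def by auto
qed

text \<open>Both pieces have area at most m, so the jump lies between \<open>- m^a\<close> and
  \<open>m^a\<close>. The factor 1 matches the shape \<open>c * m powr a\<close> in
  \<open>bounded_weight_mult_powr\<close>.\<close>

lemma powr_split_le:
  fixes x y m a :: real
  assumes "0 < x" "0 < y" "x + y \<le> m" "a \<ge> 0"
  shows "\<bar>x powr a + y powr a - m powr a\<bar> \<le> 1 * m powr a"
proof -
  have "x powr a \<le> m powr a" "y powr a \<le> m powr a" using assms by (auto intro!: powr_mono2)
  moreover have "x powr a \<ge> 0" "y powr a \<ge> 0" by auto
  ultimately show ?thesis by linarith
qed

section \<open>The martingale Z and its second moment\<close>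

context uniform_chain begin

definition Z :: "nat \<Rightarrow> 'a \<Rightarrow> real" where
  "Z = S (\<lambda>m. m powr \<beta>)"

text \<open>Bounds the conditional variance of the next step of Z: a strip of area m is hit with
  probability m, and its term then changes by at most \<open>m^\<beta>\<close>.\<close>

definition energy :: "nat \<Rightarrow> 'a \<Rightarrow> real" where
  "energy = S (\<lambda>m. m powr (2 * \<beta> + 1))"

lemma S_cong: "(\<And>m. 0 < m \<Longrightarrow> m \<le> 1 \<Longrightarrow> F m = F' m) \<Longrightarrow> S F n = S F' n"
  unfolding fun_eq_iff S_def by (intro allI strip_sum_cong)

lemma bounded_rv_Z: "bounded_rv n (Z n)"
  unfolding Z_def using \<beta>_bounds by (intro bounded_rv_S bounded_weight_powr) simp

lemma bounded_rv_energy: "bounded_rv n (energy n)"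
  unfolding energy_def using \<beta>_bounds by (intro bounded_rv_S bounded_weight_powr) simp

lemma energy_nonneg: "energy n \<omega> \<ge> 0"
  unfolding energy_def S_def strip_sum_def by (intro sum_list_nonneg) auto

lemma expectation_mult_Z:
  assumes "bounded_rv n X" "n \<le> m"
  shows "expectation (\<lambda>\<omega>. X \<omega> * Z m \<omega>) = expectation (\<lambda>\<omega>. X \<omega> * Z n \<omega>)"
  using assms(2)
proof (induction m rule: dec_induct)
  case (step m)
  then show ?case
    using expectation_S_Suc[OF mean_split_\<beta> bounded_rv_le[OF assms(1)], of m] by (simp add: Z_def)
qed simp

definition decay :: real where
  "decay = - rate (2 * \<beta>)"

text \<open>\<open>rate\<close> decreases and vanishes at \<beta>, so it is negative at
  \<open>2 * \<beta>\<close>; numerically, \<open>2 * \<beta> + 1\<close> exceeds 9 / 5, whose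
  square is above 2.\<close>

lemma decay_pos: "decay > 0"
proof -
  have "(2 * \<beta> + 1)\<^sup>2 > 2"
  proof -
    have "(9 / 5)\<^sup>2 \<le> (2 * \<beta> + 1)\<^sup>2" using \<beta>_bounds by (intro power_mono) auto
    then show ?thesis by (simp add: power2_eq_square)
  qed
  then show ?thesis by (simp add: decay_def rate_def divide_less_eq)
qed

text \<open>Loses \<open>decay * energy\<close> in mean at every step, and thereby pays for the
  variance of Z.\<close>

definition quad :: "nat \<Rightarrow> 'a \<Rightarrow> real" where
  "quad = S (\<lambda>m. m powr (2 * \<beta>))"

lemma bounded_rv_quad: "bounded_rv n (quad n)"
  unfolding quad_def using \<beta>_bounds by (intro bounded_rv_S bounded_weight_powr) simp

lemma expectation_quad_Suc:
  assumes X: "bounded_rv n X"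
  shows "expectation (\<lambda>\<omega>. X \<omega> * quad (Suc n) \<omega>) = expectation (\<lambda>\<omega>. X \<omega> * quad n \<omega>) - decay * expectation (\<lambda>\<omega>. X \<omega> * energy n \<omega>)"
proof -
  have "mean_split (\<lambda>m. m powr (2 * \<beta>)) (\<lambda>m. 1 * m powr (2 * \<beta>) + rate (2 * \<beta>) * m powr (2 * \<beta> + 1))"
    using mean_split_powr[of "2 * \<beta>"] \<beta>_bounds by simp
  from expectation_S_Suc[OF this X]
  have "expectation (\<lambda>\<omega>. X \<omega> * quad (Suc n) \<omega>) = expectation (\<lambda>\<omega>. X \<omega> * quad n \<omega> + rate (2 * \<beta>) * (X \<omega> * energy n \<omega>))"
    unfolding S_lincomb by (simp add: quad_def energy_def algebra_simps)
  also have "\<dots> = expectation (\<lambda>\<omega>. X \<omega> * quad n \<omega>) + rate (2 * \<beta>) * expectation (\<lambda>\<omega>. X \<omega> * energy n \<omega>)"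
    by (subst Bochner_Integration.integral_add)
       (auto intro!: bounded_rv_integrable[of n] bounded_rv_mult X bounded_rv_quad bounded_rv_energy)
  finally show ?thesis by (simp add: decay_def)
qed

lemma expectation_Z_Suc_square:
  assumes X: "bounded_rv n X" "\<And>\<omega>. X \<omega> \<ge> 0"
  shows "expectation (\<lambda>\<omega>. X \<omega> * (Z (Suc n) \<omega>)\<^sup>2) \<le>
    expectation (\<lambda>\<omega>. X \<omega> * (Z n \<omega>)\<^sup>2) + expectation (\<lambda>\<omega>. X \<omega> * energy n \<omega>)"
proof -
  have "S (\<lambda>m. m * (1 * m powr \<beta>)\<^sup>2) n = energy n"
    unfolding energy_def
  proof (rule S_cong)
    fix m :: real assume "0 < m"
    have "m powr (2 * \<beta> + 1) = m powr (\<beta> + \<beta> + 1)" by simp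
    also have "\<dots> = m powr \<beta> * m powr \<beta> * m" using \<open>0 < m\<close> by (simp only: powr_add powr_one less_imp_le)
    finally show "m * (1 * m powr \<beta>)\<^sup>2 = m powr (2 * \<beta> + 1)" by (simp add: power2_eq_square)
  qed
  moreover have "expectation (\<lambda>\<omega>. X \<omega> * (S (\<lambda>m. m powr \<beta>) (Suc n) \<omega>)\<^sup>2) \<le>
    expectation (\<lambda>\<omega>. X \<omega> * (S (\<lambda>m. m powr \<beta>) n \<omega>)\<^sup>2) + expectation (\<lambda>\<omega>. X \<omega> * S (\<lambda>m. m * (1 * m powr \<beta>)\<^sup>2) n \<omega>)"
    using \<beta>_bounds
    by (intro expectation_S_Suc_square mean_split_\<beta> X powr_split_le bounded_weight_powr bounded_weight_mult_powr) auto
  ultimately show ?thesis by (simp add: Z_def)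
qed

text \<open>The value of \<open>Z^2 + quad / decay\<close> at step 0, where the only strip has area
  1.\<close>

definition var_bound :: real where
  "var_bound = 1 + 1 / decay"

text \<open>\<open>Z\<^sup>2 + quad / decay\<close> is a supermartingale.\<close>

lemma expectation_Z_square_le:
  assumes H: "H \<in> sets (G 0)"
  shows "expectation (\<lambda>\<omega>. indicator H \<omega> * (Z n \<omega>)\<^sup>2) \<le> var_bound * prob H"
proof -
  let ?X = "indicator H :: 'a \<Rightarrow> real"
  have X: "bounded_rv n ?X" for n by (intro bounded_rv_le[OF bounded_rv_indicator[OF H]]) simp
  have HP: "H \<in> sets P" using H subalg[of 0] by (auto simp: subalgebra_def)
  define V where "V n = expectation (\<lambda>\<omega>. ?X \<omega> * (Z n \<omega>)\<^sup>2) + expectation (\<lambda>\<omega>. ?X \<omega> * quad n \<omega>) / decay" for n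
  have "V (Suc n) \<le> V n" for n
    using expectation_Z_Suc_square[OF X, of n] expectation_quad_Suc[OF X, of n] decay_pos
    by (simp add: V_def diff_divide_distrib)
  then have "V n \<le> V 0" by (induction n) (auto intro: order_trans)
  also have "V 0 = var_bound * prob H"
    using HP sets.sets_into_space[OF HP]
    by (simp add: V_def Z_def quad_def S_0 var_bound_def algebra_simps Int_absorb2)
  finally have "V n \<le> var_bound * prob H" .
  moreover have "expectation (\<lambda>\<omega>. ?X \<omega> * quad n \<omega>) \<ge> 0"
    unfolding quad_def S_def strip_sum_def by (intro Bochner_Integration.integral_nonneg mult_nonneg_nonneg sum_list_nonneg) auto
  then have "expectation (\<lambda>\<omega>. ?X \<omega> * quad n \<omega>) / decay \<ge> 0" using decay_pos by simp
  ultimately show ?thesis by (simp add: V_def)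
qed

lemma space_in_G: "space P \<in> sets (G n)"
  using sets.top[of "G n"] by simp

lemma expectation_indicator_space: "expectation (\<lambda>\<omega>. indicator (space P) \<omega> * f \<omega>) = expectation f"
  for f :: "'a \<Rightarrow> real"
  by (intro Bochner_Integration.integral_cong) auto

lemma expectation_Z_square_bounded: "expectation (\<lambda>\<omega>. (Z n \<omega>)\<^sup>2) \<le> var_bound"
  using expectation_Z_square_le[OF space_in_G, of n] by (simp add: expectation_indicator_space prob_space)

lemma bounded_rv_1: "bounded_rv n (\<lambda>_. 1)"
  by (auto simp: bounded_rv_def intro!: exI[of _ 1])

text \<open>In mean, \<open>quad\<close> starts at 1, stays nonnegative and loses
  \<open>decay\<close> times the energy at each step.\<close>

lemma summable_energy: "summable (\<lambda>n. expectation (energy n))"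
proof (rule summableI_nonneg_bounded)
  show "expectation (energy n) \<ge> 0" for n by (intro Bochner_Integration.integral_nonneg energy_nonneg)
  show "(\<Sum>i<n. expectation (energy i)) \<le> 1 / decay" for n
  proof -
    have "expectation (quad n) + decay * (\<Sum>i<n. expectation (energy i)) = 1"
    proof (induction n)
      case 0
      show ?case by (simp add: quad_def S_0 prob_space)
    next
      case (Suc n)
      then show ?case using expectation_quad_Suc[OF bounded_rv_1, of n] by (simp add: algebra_simps)
    qed
    moreover have "expectation (quad n) \<ge> 0"
      unfolding quad_def S_def strip_sum_def by (intro Bochner_Integration.integral_nonneg sum_list_nonneg) auto
    ultimately show ?thesis using decay_pos by (simp add: field_simps)
  qed
qed

section \<open>Exact means of counts and areas\<close>

definition leaves :: "nat \<Rightarrow> 'a \<Rightarrow> real" where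
  "leaves n \<omega> = real (length (left_strips (\<lambda>i. p i \<omega>) n))"

lemma leaves_eq: "leaves n = S (leaf_poly 0) n"
proof -
  have "strip_sum (leaf_poly 0) L = real (length L)" for L
    by (induction L) (auto simp: strip_sum_def leaf_poly_def rate_prod_def)
  then show ?thesis by (auto simp: leaves_def S_def)
qed

text \<open>Each step back exchanges one point for one application of T; with no point left, the
  single strip has area 1.\<close>

lemma expectation_S_leaf_poly: "expectation (S (leaf_poly j) n) = mean_leaves (j + n)"
proof (induction n arbitrary: j)
  case 0
  show ?case by (simp add: S_0 prob_space leaf_poly_at_1)
next
  case (Suc n)
  have "expectation (S (leaf_poly j) (Suc n)) = expectation (S (leaf_poly (Suc j)) n)"
    using expectation_S_Suc[OF mean_split_leaf_poly bounded_rv_1, of j n] by simp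
  then show ?case using Suc by simp
qed

text \<open>T 1 = 1 + m: the mean total area at step k is the probability that point k + 1 divides a
  strip, hence the mean increment of the count. The 1 is the initial strip.\<close>

lemma sum_expectation_area:
  "(\<Sum>k<n. expectation (S (\<lambda>m. m) k)) = mean_leaves n - 1"
proof (induction n)
  case 0
  show ?case by (simp add: mean_leaves_def rate_prod_def)
next
  case (Suc n)
  have "leaf_poly 1 = (\<lambda>m. 1 * leaf_poly 0 m + 1 * m)"
    by (simp add: fun_eq_iff leaf_poly_def rate_prod_def rate_def)
  then have "S (leaf_poly 1) n \<omega> = S (\<lambda>m. 1 * leaf_poly 0 m + 1 * m) n \<omega>" for \<omega>
    by (rule arg_cong)
  then have "S (leaf_poly 1) n = (\<lambda>\<omega>. 1 * S (leaf_poly 0) n \<omega> + 1 * S (\<lambda>m. m) n \<omega>)"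
    unfolding S_lincomb by (rule ext)
  moreover have "integrable P (S (leaf_poly 0) n)"
    by (intro bounded_rv_integrable[of n] bounded_rv_S mean_split_bounded_weight[OF mean_split_leaf_poly])
  moreover have "integrable P (S (\<lambda>m. m) n)"
    by (intro bounded_rv_integrable[of n] bounded_rv_S) (auto simp: bounded_weight_def)
  ultimately have "expectation (S (leaf_poly 1) n) = expectation (S (leaf_poly 0) n) + expectation (S (\<lambda>m. m) n)"
    by simp
  then show ?case using Suc by (simp add: expectation_S_leaf_poly)
qed

end

section \<open>Mean square comparison of counts and martingale\<close>

context uniform_chain begin

text \<open>Summed over the strips at step k, this weight gives the conditional mean of the final
  count minus \<open>leaf_const * n^\<beta>\<close> times Z, a martingale in k up to n. The explicit
  factor 1 and the sign in the coefficient fit the lemmas on linear combinations.\<close>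

definition residual :: "nat \<Rightarrow> nat \<Rightarrow> real \<Rightarrow> real" where
  "residual n k = (\<lambda>m. 1 * leaf_poly (n - k) m + (- (leaf_const * real n powr \<beta>)) * m powr \<beta>)"

definition residual_energy :: "nat \<Rightarrow> nat \<Rightarrow> real" where
  "residual_energy n k = expectation (\<lambda>\<omega>. (S (residual n k) k \<omega>)\<^sup>2)"

lemma mean_split_residual: "k < n \<Longrightarrow> mean_split (residual n (Suc k)) (residual n k)"
  using mean_split_lincomb[OF mean_split_leaf_poly[of "n - Suc k"] mean_split_\<beta>, of 1 "- (leaf_const * real n powr \<beta>)"]
  by (simp add: residual_def Suc_diff_Suc)

lemma bounded_weight_residual: "bounded_weight (residual n k)"
  unfolding residual_def
  by (intro bounded_weight_lincomb mean_split_bounded_weight[OF mean_split_leaf_poly] mean_split_bounded_weight[OF mean_split_\<beta>])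

lemma residual_energy_0: "residual_energy n 0 = (mean_leaves n - leaf_const * real n powr \<beta>)\<^sup>2"
  by (simp add: residual_energy_def S_0 residual_def leaf_poly_at_1 prob_space)

lemma residual_energy_n: "residual_energy n n = expectation (\<lambda>\<omega>. (leaves n \<omega> - leaf_const * real n powr \<beta> * Z n \<omega>)\<^sup>2)"
  unfolding residual_energy_def residual_def S_lincomb by (simp add: leaves_eq Z_def)

text \<open>F replaces the squared jump bound \<open>m * (b m)^2\<close> by a larger weight whose
  expectation can be evaluated.\<close>

lemma residual_energy_Suc:
  assumes "k < n"
    and b: "\<And>m x y. 0 < x \<Longrightarrow> 0 < y \<Longrightarrow> x + y \<le> m \<Longrightarrow> m \<le> 1 \<Longrightarrow>
      \<bar>residual n (Suc k) x + residual n (Suc k) y - residual n (Suc k) m\<bar> \<le> b m"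
    and b2: "bounded_weight (\<lambda>m. m * (b m)\<^sup>2)"
    and F: "bounded_weight F" "\<And>m. 0 < m \<Longrightarrow> m \<le> 1 \<Longrightarrow> m * (b m)\<^sup>2 \<le> F m"
  shows "residual_energy n (Suc k) \<le> residual_energy n k + expectation (S F k)"
proof -
  have "residual_energy n (Suc k) \<le> residual_energy n k + expectation (S (\<lambda>m. m * (b m)\<^sup>2) k)"
    using expectation_S_Suc_square[OF mean_split_residual[OF assms(1)] bounded_rv_1 _ b bounded_weight_residual b2]
    by (simp add: residual_energy_def)
  also have "expectation (S (\<lambda>m. m * (b m)\<^sup>2) k) \<le> expectation (S F k)"
    using F(2) by (intro integral_mono bounded_rv_integrable[of k] bounded_rv_S F(1) b2)
       (auto simp: S_def intro: strip_sum_mono)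
  finally show ?thesis by simp
qed

lemma bounded_weight_scaled_id: "bounded_weight (\<lambda>m. m * c)"
proof -
  have "\<bar>m * c\<bar> \<le> \<bar>c\<bar>" if "0 < m" "m \<le> 1" for m
    using that by (simp add: abs_mult mult_left_le_one_le)
  then show ?thesis by (auto simp: bounded_weight_def)
qed

lemma expectation_area_bounds: "0 \<le> expectation (S (\<lambda>m. m) k)" "expectation (S (\<lambda>m. m) k) \<le> 1"
proof -
  have "0 \<le> S (\<lambda>m. m) k \<omega>" for \<omega>
  proof -
    have "0 \<le> strip_area r" if "r \<in> set (left_strips (\<lambda>i. p i \<omega>) k)" for r
      using valid_strip_area[OF valid_left_strips[OF that]] by simp
    then show ?thesis unfolding S_def strip_sum_def by (intro sum_list_nonneg) (auto simp only: set_map)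
  qed
  then show "0 \<le> expectation (S (\<lambda>m. m) k)" by (intro Bochner_Integration.integral_nonneg)
  have "integrable P (S (\<lambda>m. m) k)"
    using bounded_rv_integrable[OF bounded_rv_S[OF bounded_weight_scaled_id[of 1]], of k] by simp
  then have "expectation (S (\<lambda>m. m) k) \<le> expectation (\<lambda>_. 1)"
    by (intro integral_mono) (auto simp: S_def total_area_le_1)
  then show "expectation (S (\<lambda>m. m) k) \<le> 1" by (simp add: prob_space)
qed

text \<open>A jump involves three values of the weight, hence is at most
  \<open>3 * \<sigma>\<close>; it occurs with probability equal to the total area, which is at most
  1.\<close>

lemma residual_energy_Suc_uniform:
  assumes "k < n" and \<sigma>: "\<And>m. 0 < m \<Longrightarrow> m \<le> 1 \<Longrightarrow> \<bar>residual n (Suc k) m\<bar> \<le> \<sigma>"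
  shows "residual_energy n (Suc k) \<le> residual_energy n k + 9 * \<sigma>\<^sup>2"
proof -
  have "residual_energy n (Suc k) \<le> residual_energy n k + expectation (S (\<lambda>m. m * (3 * \<sigma>)\<^sup>2) k)"
  proof (rule residual_energy_Suc[OF assms(1), of "\<lambda>_. 3 * \<sigma>"])
    fix m x y :: real assume "0 < x" "0 < y" "x + y \<le> m" "m \<le> 1"
    then show "\<bar>residual n (Suc k) x + residual n (Suc k) y - residual n (Suc k) m\<bar> \<le> 3 * \<sigma>"
      using \<sigma>[of x] \<sigma>[of y] \<sigma>[of m] by linarith
  qed (auto intro: bounded_weight_scaled_id)
  also have "S (\<lambda>m. m * (3 * \<sigma>)\<^sup>2) k = (\<lambda>\<omega>. (9 * \<sigma>\<^sup>2) * S (\<lambda>m. m) k \<omega> + 0 * S (\<lambda>m. m) k \<omega>)"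
    unfolding S_lincomb[symmetric] by (simp add: power_mult_distrib mult_ac)
  also have "expectation \<dots> = 9 * \<sigma>\<^sup>2 * expectation (S (\<lambda>m. m) k)" by simp
  also have "\<dots> \<le> 9 * \<sigma>\<^sup>2 * 1" using expectation_area_bounds by (intro mult_left_mono) auto
  finally show ?thesis by simp
qed

text \<open>Uniform in k and n. The summand 1 of \<open>leaf_poly_bounded\<close> produces the area
  term, whose sum over k is of order \<open>n^\<beta>\<close> and so negligible against
  \<open>n^(2 \<beta>)\<close>; the power produces the energy term, which is summable in k and will
  be the majorant for Tannery's theorem.\<close>

lemma residual_energy_Suc_bound:
  obtains K where "\<And>n k. k < n \<Longrightarrow> residual_energy n (Suc k) \<le> residual_energy n k +
     18 * expectation (S (\<lambda>m. m) k) + K * real n powr (2 * \<beta>) * expectation (energy k)"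
proof -
  obtain C where C: "C > 0" "\<And>j m. 0 < m \<Longrightarrow> m \<le> 1 \<Longrightarrow> \<bar>leaf_poly j m\<bar> \<le> 1 + C * (real j * m) powr \<beta>"
    using leaf_poly_bounded by blast
  define K where "K = C + \<bar>leaf_const\<bar>"
  have K: "K > 0" using C by (simp add: K_def add_pos_nonneg)
  have "residual_energy n (Suc k) \<le> residual_energy n k +
     18 * expectation (S (\<lambda>m. m) k) + (18 * K\<^sup>2) * real n powr (2 * \<beta>) * expectation (energy k)" if "k < n" for n k
  proof -
    define D where "D = K * real n powr \<beta>"
    have D: "D \<ge> 0" using K by (simp add: D_def)
    have res: "\<bar>residual n (Suc k) x\<bar> \<le> 1 + D * m powr \<beta>" if "0 < x" "x \<le> m" "m \<le> 1" for x m
    proof -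
      have "real n powr \<beta> * x powr \<beta> \<le> real n powr \<beta> * m powr \<beta>"
        using that \<beta>_bounds by (intro mult_left_mono powr_mono2) auto
      moreover have "(real (n - Suc k) * x) powr \<beta> \<le> real n powr \<beta> * x powr \<beta>"
        unfolding powr_mult using \<beta>_bounds by (intro mult_right_mono powr_mono2) auto
      ultimately have le: "(real (n - Suc k) * x) powr \<beta> \<le> real n powr \<beta> * m powr \<beta>"
         "real n powr \<beta> * x powr \<beta> \<le> real n powr \<beta> * m powr \<beta>" by linarith+
      have "\<bar>residual n (Suc k) x\<bar> \<le> \<bar>leaf_poly (n - Suc k) x\<bar> + \<bar>leaf_const\<bar> * (real n powr \<beta> * x powr \<beta>)"
        unfolding residual_def by (intro order_trans[OF abs_triangle_ineq]) (simp add: abs_mult)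
      also have "\<dots> \<le> (1 + C * (real (n - Suc k) * x) powr \<beta>) + \<bar>leaf_const\<bar> * (real n powr \<beta> * x powr \<beta>)"
        using C(2)[of x "n - Suc k"] that by simp
      also have "\<dots> \<le> (1 + C * (real n powr \<beta> * m powr \<beta>)) + \<bar>leaf_const\<bar> * (real n powr \<beta> * m powr \<beta>)"
        using C(1) by (intro add_mono mult_left_mono order_refl le) auto
      also have "\<dots> = 1 + D * m powr \<beta>" by (simp add: D_def K_def algebra_simps)
      finally show ?thesis .
    qed
    \<comment> \<open>The square of a sum is at most twice the sum of the squares; twice
      \<open>3^2\<close> is the origin of 18.\<close>
    have sq: "(3 + 3 * D * t)\<^sup>2 \<le> 18 + 18 * D\<^sup>2 * t\<^sup>2" for t :: real
      using zero_le_power2[of "3 - 3 * D * t"] by (simp add: power2_eq_square algebra_simps)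
    have mp: "m * (m powr \<beta>)\<^sup>2 = m powr (2 * \<beta> + 1)" if "0 < m" for m :: real
    proof -
      have "m powr (2 * \<beta> + 1) = m powr (\<beta> + \<beta> + 1)" by simp
      also have "\<dots> = m powr \<beta> * m powr \<beta> * m" using that by (simp only: powr_add powr_one less_imp_le)
      finally show ?thesis by (simp add: power2_eq_square)
    qed
    have "residual_energy n (Suc k) \<le> residual_energy n k +
       expectation (S (\<lambda>m. 18 * m + 18 * D\<^sup>2 * m powr (2 * \<beta> + 1)) k)"
    proof (rule residual_energy_Suc[OF that, of "\<lambda>m. 3 + 3 * D * m powr \<beta>"])
      fix m x y :: real assume a: "0 < x" "0 < y" "x + y \<le> m" "m \<le> 1"
      then have "\<bar>residual n (Suc k) x\<bar> \<le> 1 + D * m powr \<beta>" "\<bar>residual n (Suc k) y\<bar> \<le> 1 + D * m powr \<beta>"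
         "\<bar>residual n (Suc k) m\<bar> \<le> 1 + D * m powr \<beta>"
        by (auto intro!: res)
      then show "\<bar>residual n (Suc k) x + residual n (Suc k) y - residual n (Suc k) m\<bar> \<le> 3 + 3 * D * m powr \<beta>"
        by linarith
    next
      show w: "bounded_weight (\<lambda>m. 18 * m + 18 * D\<^sup>2 * m powr (2 * \<beta> + 1))"
        using bounded_weight_scaled_id[of 1] \<beta>_bounds
        by (intro bounded_weight_lincomb bounded_weight_powr) auto
      show le: "m * (3 + 3 * D * m powr \<beta>)\<^sup>2 \<le> 18 * m + 18 * D\<^sup>2 * m powr (2 * \<beta> + 1)" if "0 < m" "m \<le> 1" for m
      proof -
        have "m * (3 + 3 * D * m powr \<beta>)\<^sup>2 \<le> m * (18 + 18 * D\<^sup>2 * (m powr \<beta>)\<^sup>2)"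
          using that by (intro mult_left_mono sq) auto
        also have "\<dots> = 18 * m + 18 * D\<^sup>2 * (m * (m powr \<beta>)\<^sup>2)" by (simp add: algebra_simps)
        finally show ?thesis by (simp only: mp[OF that(1)])
      qed
      obtain B where B: "\<And>m. 0 < m \<Longrightarrow> m \<le> 1 \<Longrightarrow> \<bar>18 * m + 18 * D\<^sup>2 * m powr (2 * \<beta> + 1)\<bar> \<le> B"
        using w unfolding bounded_weight_def by blast
      have "\<bar>m * (3 + 3 * D * m powr \<beta>)\<^sup>2\<bar> \<le> B" if "0 < m" "m \<le> 1" for m
      proof -
        have "0 \<le> m * (3 + 3 * D * m powr \<beta>)\<^sup>2" using that by simp
        then show ?thesis using le[OF that] B[OF that] by linarith
      qed
      then show "bounded_weight (\<lambda>m. m * (3 + 3 * D * m powr \<beta>)\<^sup>2)"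
        unfolding bounded_weight_def by auto
    qed
    also have "expectation (S (\<lambda>m. 18 * m + 18 * D\<^sup>2 * m powr (2 * \<beta> + 1)) k) =
       expectation (\<lambda>\<omega>. 18 * S (\<lambda>m. m) k \<omega> + 18 * D\<^sup>2 * energy k \<omega>)"
      unfolding S_lincomb energy_def ..
    also have "\<dots> = 18 * expectation (S (\<lambda>m. m) k) + 18 * D\<^sup>2 * expectation (energy k)"
      using bounded_rv_integrable[OF bounded_rv_S[OF bounded_weight_scaled_id[of 1]], of k]
        bounded_rv_integrable[OF bounded_rv_energy, of k] by simp
    also have "D\<^sup>2 = K\<^sup>2 * real n powr (2 * \<beta>)"
      using that by (simp add: D_def power_mult_distrib power2_eq_square powr_add[symmetric])
    finally show ?thesis by (simp add: mult_ac add_ac)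
  qed
  then show ?thesis by (rule that)
qed

text \<open>For fixed k the remaining number n - k - 1 of points tends to infinity with ratio 1 to
  n, so the uniform asymptotics of \<open>leaf_poly\<close> applies and \<open>n^\<beta>\<close> may
  replace \<open>(n - k - 1)^\<beta>\<close>.\<close>

lemma residual_uniformly_small:
  assumes "\<epsilon> > 0"
  shows "\<forall>\<^sub>F n in sequentially. k < n \<and> (\<forall>m. 0 < m \<longrightarrow> m \<le> 1 \<longrightarrow> \<bar>residual n (Suc k) m\<bar> \<le> \<epsilon> * real n powr \<beta>)"
proof -
  obtain J where J: "\<And>j m. j \<ge> J \<Longrightarrow> 0 \<le> m \<Longrightarrow> m \<le> 1 \<Longrightarrow>
     \<bar>leaf_poly j m - leaf_const * (real j * m) powr \<beta>\<bar> \<le> (\<epsilon> / 2) * real j powr \<beta>"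
    using leaf_poly_asymp_uniform[of "\<epsilon> / 2"] assms by auto
  have "(\<lambda>n. \<bar>leaf_const\<bar> * (1 - ((real n - real (Suc k)) / real n) powr \<beta>)) \<longlonglongrightarrow> \<bar>leaf_const\<bar> * (1 - 1 powr \<beta>)"
    by (intro tendsto_intros) (real_asymp, simp)
  then have "\<forall>\<^sub>F n in sequentially. \<bar>leaf_const\<bar> * (1 - ((real n - real (Suc k)) / real n) powr \<beta>) < \<epsilon> / 2"
    using assms by (auto dest: order_tendstoD(2)[of _ _ _ "\<epsilon> / 2"])
  then show ?thesis using eventually_ge_at_top[of "J + Suc k"]
  proof eventually_elim
    case (elim n)
    define j where "j = n - Suc k"
    have j: "j \<ge> J" "k < n" "real j = real n - real (Suc k)" using elim by (auto simp: j_def)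
    define W where "W = real n powr \<beta>"
    have W: "W > 0" using j by (simp add: W_def)
    have jW: "real j powr \<beta> = ((real n - real (Suc k)) / real n) powr \<beta> * W"
      using j by (simp add: W_def powr_mult[symmetric] del: of_nat_Suc)
    have jle: "real j powr \<beta> \<le> W" unfolding W_def using j \<beta>_bounds by (intro powr_mono2) auto
    have diff: "\<bar>leaf_const\<bar> * (W - real j powr \<beta>) \<le> \<epsilon> / 2 * W"
    proof -
      have "\<bar>leaf_const\<bar> * (W - real j powr \<beta>) = \<bar>leaf_const\<bar> * (1 - ((real n - real (Suc k)) / real n) powr \<beta>) * W"
        unfolding jW by (simp add: algebra_simps)
      also have "\<dots> \<le> \<epsilon> / 2 * W" using elim(1) W by (intro mult_right_mono) auto
      finally show ?thesis .
    qed
    have "\<bar>residual n (Suc k) m\<bar> \<le> \<epsilon> * W" if m: "0 < m" "m \<le> 1" for m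
    proof -
      have "residual n (Suc k) m = (leaf_poly j m - leaf_const * (real j * m) powr \<beta>) +
         leaf_const * ((real j powr \<beta> - W) * m powr \<beta>)"
        using m by (simp add: residual_def W_def j_def[symmetric] powr_mult algebra_simps)
      also have "\<bar>\<dots>\<bar> \<le> (\<epsilon> / 2) * real j powr \<beta> + \<bar>leaf_const\<bar> * ((W - real j powr \<beta>) * m powr \<beta>)"
        using J[of j m] j m jle by (intro order_trans[OF abs_triangle_ineq] add_mono) (auto simp: abs_mult)
      also have "\<dots> \<le> (\<epsilon> / 2) * W + \<bar>leaf_const\<bar> * ((W - real j powr \<beta>) * 1)"
        using jle m assms \<beta>_bounds by (intro add_mono mult_left_mono powr_le1) auto
      also have "\<dots> \<le> \<epsilon> * W" using diff by (simp add: field_simps)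
      finally show ?thesis .
    qed
    then show ?case using j by (simp add: W_def)
  qed
qed

text \<open>The mean square grows from the error of the means at k = 0 by one increment per step.
  After division by \<open>n^(2 \<beta>)\<close> each increment has limit superior at most 0 for
  fixed k, and a bound summable in k permits summing these limits.\<close>

theorem leaves_L2_asymp:
  "(\<lambda>n. expectation (\<lambda>\<omega>. (leaves n \<omega> - leaf_const * real n powr \<beta> * Z n \<omega>)\<^sup>2) / real n powr (2 * \<beta>)) \<longlonglongrightarrow> 0"
proof -
  obtain K where K: "\<And>n k. k < n \<Longrightarrow> residual_energy n (Suc k) \<le> residual_energy n k +
     18 * expectation (S (\<lambda>m. m) k) + K * real n powr (2 * \<beta>) * expectation (energy k)"
    using residual_energy_Suc_bound by blast
  define w where "w n = real n powr (2 * \<beta>)" for n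
  \<comment> \<open>The area part is taken out here and summed exactly at the end; what is left is
    dominated by the energy.\<close>
  define inc where "inc n k = (residual_energy n (Suc k) - residual_energy n k) / w n - 18 * expectation (S (\<lambda>m. m) k) / w n" for n k
  \<comment> \<open>Only an upper bound is wanted, so the positive part is taken: the one-sided
    estimate then bounds the modulus, as Tannery's theorem requires. The cut at n makes each series
    finite.\<close>
  define a where "a k n = (if k < n then max 0 (inc n k) else 0)" for k n
  have w: "w n \<ge> 0" "n > 0 \<Longrightarrow> w n > 0" for n by (auto simp: w_def)
  have a_le: "\<bar>a k n\<bar> \<le> \<bar>K\<bar> * expectation (energy k)" for k n
  proof (cases "k < n")
    case True
    then have "residual_energy n (Suc k) - residual_energy n k - 18 * expectation (S (\<lambda>m. m) k) \<le>
        (K * expectation (energy k)) * w n"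
      using K[OF True] by (simp add: w_def mult_ac)
    then have "inc n k \<le> K * expectation (energy k)"
      using w(2)[of n] True by (simp only: inc_def diff_divide_distrib[symmetric] pos_divide_le_eq)
    also have "\<dots> \<le> \<bar>K\<bar> * expectation (energy k)"
      by (intro mult_right_mono Bochner_Integration.integral_nonneg energy_nonneg) auto
    finally have "inc n k \<le> \<bar>K\<bar> * expectation (energy k)" .
    moreover have "0 \<le> \<bar>K\<bar> * expectation (energy k)"
      by (intro mult_nonneg_nonneg Bochner_Integration.integral_nonneg energy_nonneg) auto
    ultimately show ?thesis using True by (simp add: a_def)
  qed (auto simp: a_def intro!: mult_nonneg_nonneg Bochner_Integration.integral_nonneg energy_nonneg)
  have a_lim: "(\<lambda>n. a k n) \<longlonglongrightarrow> 0" for k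
  proof (rule tendstoI)
    fix e :: real assume e: "e > 0"
    \<comment> \<open>Then \<open>9 * \<epsilon>^2\<close> is 9 / 16 of the square of
      \<open>min 1 e\<close>, which is below e whether or not e exceeds 1.\<close>
    define \<epsilon> where "\<epsilon> = min 1 e / 4"
    have \<epsilon>: "\<epsilon> > 0" "9 * \<epsilon>\<^sup>2 < e"
    proof -
      show "\<epsilon> > 0" using e by (simp add: \<epsilon>_def)
      have "9 * \<epsilon>\<^sup>2 < min 1 e * min 1 e" using e by (simp add: \<epsilon>_def power2_eq_square)
      also have "\<dots> \<le> 1 * e" using e by (intro mult_mono) auto
      finally show "9 * \<epsilon>\<^sup>2 < e" by simp
    qed
    show "\<forall>\<^sub>F n in sequentially. dist (a k n) 0 < e"
      using residual_uniformly_small[OF \<epsilon>(1), of k]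
    proof eventually_elim
      case (elim n)
      then have "residual_energy n (Suc k) \<le> residual_energy n k + 9 * (\<epsilon> * real n powr \<beta>)\<^sup>2"
        by (intro residual_energy_Suc_uniform) auto
      also have "9 * (\<epsilon> * real n powr \<beta>)\<^sup>2 = 9 * \<epsilon>\<^sup>2 * w n"
        using elim by (simp add: w_def power_mult_distrib power2_eq_square powr_add[symmetric])
      finally have "(residual_energy n (Suc k) - residual_energy n k) / w n \<le> 9 * \<epsilon>\<^sup>2"
        using w(2)[of n] elim by (simp add: field_simps)
      moreover have "18 * expectation (S (\<lambda>m. m) k) / w n \<ge> 0" using expectation_area_bounds w by simp
      ultimately have "inc n k \<le> 9 * \<epsilon>\<^sup>2" by (simp add: inc_def)
      then show ?case using \<epsilon>(2) e by (auto simp: a_def dist_real_def)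
    qed
  qed
  have T: "(\<lambda>n. \<Sum>k. a k n) \<longlonglongrightarrow> (\<Sum>k. 0)"
  proof (rule tannerys_theorem[THEN conjunct2, THEN conjunct2])
    show "summable (\<lambda>k. \<bar>K\<bar> * expectation (energy k))" by (intro summable_mult summable_energy)
    show "\<forall>\<^sub>F (k, n) in at_top \<times>\<^sub>F sequentially. norm (a k n) \<le> \<bar>K\<bar> * expectation (energy k)"
      using a_le by (intro always_eventually) auto
  qed (auto intro: a_lim)
  have suma: "(\<Sum>k. a k n) = (\<Sum>k<n. max 0 (inc n k))" for n
    by (subst suminf_finite[of "{..<n}"]) (auto simp: a_def)
  \<comment> \<open>Initial error, dominated increments, and the area terms summed by
    \<open>sum_expectation_area\<close>.\<close>
  define y where "y n = (mean_leaves n / real n powr \<beta> - leaf_const)\<^sup>2 + (\<Sum>k. a k n) + 18 * (mean_leaves n / w n - 1 / w n)" for n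
  have "(\<lambda>n. mean_leaves n / real n powr \<beta> * (1 / real n powr \<beta>)) \<longlonglongrightarrow> leaf_const * 0"
    using \<beta>_bounds by (intro tendsto_mult mean_leaves_asymp) real_asymp
  moreover have "(\<lambda>n. mean_leaves n / real n powr \<beta> * (1 / real n powr \<beta>)) = (\<lambda>n. mean_leaves n / w n)"
  proof
    fix n
    have "w n = real n powr \<beta> * real n powr \<beta>" by (simp add: w_def powr_add[symmetric])
    then show "mean_leaves n / real n powr \<beta> * (1 / real n powr \<beta>) = mean_leaves n / w n" by simp
  qed
  ultimately have 1: "(\<lambda>n. mean_leaves n / w n) \<longlonglongrightarrow> 0" by simp
  have 2: "(\<lambda>n. 1 / w n) \<longlonglongrightarrow> 0" unfolding w_def using \<beta>_bounds by real_asymp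
  have "y \<longlonglongrightarrow> (leaf_const - leaf_const)\<^sup>2 + (\<Sum>k. 0) + 18 * (0 - 0)"
    unfolding y_def by (intro tendsto_intros T mean_leaves_asymp 1 2)
  then have y: "y \<longlonglongrightarrow> 0" by simp
  have le: "expectation (\<lambda>\<omega>. (leaves n \<omega> - leaf_const * real n powr \<beta> * Z n \<omega>)\<^sup>2) / w n \<le> y n" if n: "n > 0" for n
  proof -
    have "residual_energy n n / w n - residual_energy n 0 / w n = (\<Sum>k<n. residual_energy n (Suc k) / w n - residual_energy n k / w n)"
      by (rule sum_lessThan_telescope[symmetric])
    also have "\<dots> = (\<Sum>k<n. inc n k) + (\<Sum>k<n. 18 * expectation (S (\<lambda>m. m) k) / w n)"
      by (simp add: sum.distrib[symmetric] inc_def diff_divide_distrib)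
    also have "(\<Sum>k<n. inc n k) \<le> (\<Sum>k. a k n)" unfolding suma by (intro sum_mono) auto
    also have "(\<Sum>k<n. 18 * expectation (S (\<lambda>m. m) k) / w n) = 18 * (mean_leaves n / w n - 1 / w n)"
      unfolding diff_divide_distrib[symmetric] sum_expectation_area[symmetric]
      by (simp add: sum_divide_distrib sum_distrib_left)
    also have "residual_energy n 0 / w n = (mean_leaves n / real n powr \<beta> - leaf_const)\<^sup>2"
    proof -
      have "w n = (real n powr \<beta>)\<^sup>2" by (simp add: w_def power2_eq_square powr_add[symmetric])
      moreover have "real n powr \<beta> > 0" using n by simp
      ultimately show ?thesis unfolding residual_energy_0 by (simp add: power_divide[symmetric] diff_divide_distrib)
    qed
    finally show ?thesis unfolding y_def residual_energy_n by simp
  qed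
  show ?thesis
  proof (rule tendsto_sandwich[OF _ _ tendsto_const y])
    show "\<forall>\<^sub>F n in sequentially. 0 \<le> expectation (\<lambda>\<omega>. (leaves n \<omega> - leaf_const * real n powr \<beta> * Z n \<omega>)\<^sup>2) / real n powr (2 * \<beta>)"
      by (intro always_eventually allI divide_nonneg_nonneg Bochner_Integration.integral_nonneg) auto
    show "\<forall>\<^sub>F n in sequentially. expectation (\<lambda>\<omega>. (leaves n \<omega> - leaf_const * real n powr \<beta> * Z n \<omega>)\<^sup>2) / real n powr (2 * \<beta>) \<le> y n"
      using eventually_gt_at_top[of 0] by eventually_elim (use le in \<open>simp add: w_def\<close>)
  qed
qed

end

section \<open>Convergence of the discrete martingale\<close>

context uniform_chain begin

text \<open>By orthogonality of the increments this second moment is 1 plus the accumulated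
  variances of the steps. It is not the sum of the means of \<open>energy\<close>, which only bound
  these variances.\<close>

definition energy_sum :: "nat \<Rightarrow> real" where
  "energy_sum n = expectation (\<lambda>\<omega>. (Z n \<omega>)\<^sup>2)"

lemma integrable_products:
  assumes "bounded_rv n X" "bounded_rv n Y" shows "integrable P (\<lambda>\<omega>. X \<omega> * Y \<omega>)"
  by (rule bounded_rv_integrable[OF bounded_rv_mult[OF assms]])

text \<open>Orthogonality of martingale increments: the mixed term equals the second moment of
  \<open>Z n\<close>.\<close>

lemma expectation_Z_diff_square:
  assumes "n \<le> m"
  shows "expectation (\<lambda>\<omega>. (Z m \<omega> - Z n \<omega>)\<^sup>2) = energy_sum m - energy_sum n"
proof -
  have Zn: "bounded_rv m (Z n)" by (rule bounded_rv_le[OF bounded_rv_Z assms])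
  note int = integrable_products[OF bounded_rv_Z bounded_rv_Z, of m] integrable_products[OF Zn bounded_rv_Z]
    integrable_products[OF Zn Zn]
  have "expectation (\<lambda>\<omega>. (Z m \<omega> - Z n \<omega>)\<^sup>2) =
    expectation (\<lambda>\<omega>. Z m \<omega> * Z m \<omega> - 2 * (Z n \<omega> * Z m \<omega>) + Z n \<omega> * Z n \<omega>)"
    by (simp add: power2_eq_square algebra_simps)
  also have "\<dots> = expectation (\<lambda>\<omega>. Z m \<omega> * Z m \<omega>) - 2 * expectation (\<lambda>\<omega>. Z n \<omega> * Z m \<omega>) + expectation (\<lambda>\<omega>. Z n \<omega> * Z n \<omega>)"
    using int by simp
  also have "expectation (\<lambda>\<omega>. Z n \<omega> * Z m \<omega>) = expectation (\<lambda>\<omega>. Z n \<omega> * Z n \<omega>)"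
    by (rule expectation_mult_Z[OF bounded_rv_Z assms])
  finally show ?thesis by (simp add: energy_sum_def power2_eq_square)
qed

lemma energy_sum_mono: "n \<le> m \<Longrightarrow> energy_sum n \<le> energy_sum m"
proof -
  assume "n \<le> m"
  have "0 \<le> expectation (\<lambda>\<omega>. (Z m \<omega> - Z n \<omega>)\<^sup>2)" by (intro Bochner_Integration.integral_nonneg) auto
  then show ?thesis using expectation_Z_diff_square[OF \<open>n \<le> m\<close>] by simp
qed

definition energy_lim :: real where
  "energy_lim = lim energy_sum"

lemma energy_sum_limit: "energy_sum \<longlonglongrightarrow> energy_lim" "energy_sum n \<le> energy_lim"
proof -
  have inc: "incseq energy_sum" using energy_sum_mono by (simp add: incseq_def)
  obtain L where L: "energy_sum \<longlonglongrightarrow> L" "\<forall>i. energy_sum i \<le> L"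
    using incseq_convergent[OF inc, of var_bound] expectation_Z_square_bounded
    by (auto simp: energy_sum_def)
  then have "energy_lim = L" by (simp add: energy_lim_def limI)
  with L show "energy_sum \<longlonglongrightarrow> energy_lim" "energy_sum n \<le> energy_lim" by auto
qed

lemma Z_measurable_P [measurable]: "Z n \<in> borel_measurable P"
  using bounded_rv_Z[of n] measurable_G_P by (auto simp: bounded_rv_def)

text \<open>Kolmogorov's inequality for the martingale started at n, by decomposition according to
  the first exceedance.\<close>

lemma maximal_inequality:
  assumes "n \<le> m" and e: "\<epsilon> > 0"
  shows "\<epsilon>\<^sup>2 * prob (\<Union>k\<in>{n..m}. {\<omega>\<in>space P. \<epsilon> \<le> \<bar>Z k \<omega> - Z n \<omega>\<bar>}) \<le> energy_sum m - energy_sum n"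
proof -
  \<comment> \<open>First exceedance at k, an event known at step k.\<close>
  define A where "A k = {\<omega>\<in>space P. \<epsilon> \<le> \<bar>Z k \<omega> - Z n \<omega>\<bar> \<and> (\<forall>i\<in>{n..<k}. \<bar>Z i \<omega> - Z n \<omega>\<bar> < \<epsilon>)}" for k
  have AG: "A k \<in> sets (G k)" if "n \<le> k" for k
  proof -
    have [measurable]: "Z i \<in> borel_measurable (G k)" if "i \<le> k" for i
      using bounded_rv_le[OF bounded_rv_Z that] by (simp add: bounded_rv_def)
    have [measurable]: "Z k \<in> borel_measurable (G k)" "Z n \<in> borel_measurable (G k)"
      using \<open>n \<le> k\<close> by auto
    have "A k = {\<omega>\<in>space (G k). \<epsilon> \<le> \<bar>Z k \<omega> - Z n \<omega>\<bar>} \<inter>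
        {\<omega>\<in>space (G k). \<forall>i\<in>{n..<k}. \<bar>Z i \<omega> - Z n \<omega>\<bar> < \<epsilon>}"
      by (auto simp: A_def)
    moreover have "{\<omega>\<in>space (G k). \<forall>i\<in>{n..<k}. \<bar>Z i \<omega> - Z n \<omega>\<bar> < \<epsilon>} \<in> sets (G k)"
    proof (rule sets.sets_Collect_finite_All)
      fix i assume "i \<in> {n..<k}"
      then have [measurable]: "Z i \<in> borel_measurable (G k)" by simp
      show "{\<omega>\<in>space (G k). \<bar>Z i \<omega> - Z n \<omega>\<bar> < \<epsilon>} \<in> sets (G k)" by measurable
    qed auto
    moreover have "{\<omega>\<in>space (G k). \<epsilon> \<le> \<bar>Z k \<omega> - Z n \<omega>\<bar>} \<in> sets (G k)" by measurable
    ultimately show ?thesis by simp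
  qed
  have AP: "A k \<in> sets P" if "n \<le> k" for k
    using AG[OF that] subalg[of k] by (auto simp: subalgebra_def)
  have disj: "disjoint_family_on A {n..m}"
    unfolding disjoint_family_on_def
  proof safe
    fix i j x assume ij: "i \<in> {n..m}" "j \<in> {n..m}" "i \<noteq> j" "x \<in> A i" "x \<in> A j"
    then show "x \<in> {}" by (cases "i < j") (force simp: A_def)+
  qed
  have un: "(\<Union>k\<in>{n..m}. {\<omega>\<in>space P. \<epsilon> \<le> \<bar>Z k \<omega> - Z n \<omega>\<bar>}) = (\<Union>k\<in>{n..m}. A k)"
  proof (intro equalityI subsetI)
    fix \<omega> assume "\<omega> \<in> (\<Union>k\<in>{n..m}. {\<omega>\<in>space P. \<epsilon> \<le> \<bar>Z k \<omega> - Z n \<omega>\<bar>})"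
    then obtain k where k: "n \<le> k \<and> k \<le> m \<and> \<epsilon> \<le> \<bar>Z k \<omega> - Z n \<omega>\<bar>" "\<omega> \<in> space P" by auto
    define k0 where "k0 = (LEAST k. n \<le> k \<and> k \<le> m \<and> \<epsilon> \<le> \<bar>Z k \<omega> - Z n \<omega>\<bar>)"
    have k0: "n \<le> k0 \<and> k0 \<le> m \<and> \<epsilon> \<le> \<bar>Z k0 \<omega> - Z n \<omega>\<bar>" unfolding k0_def by (rule LeastI[of "\<lambda>k. n \<le> k \<and> k \<le> m \<and> \<epsilon> \<le> \<bar>Z k \<omega> - Z n \<omega>\<bar>", OF k(1)])
    have "\<bar>Z i \<omega> - Z n \<omega>\<bar> < \<epsilon>" if "i \<in> {n..<k0}" for i
      using not_less_Least[of i "\<lambda>k. n \<le> k \<and> k \<le> m \<and> \<epsilon> \<le> \<bar>Z k \<omega> - Z n \<omega>\<bar>"] that k0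
      by (auto simp: k0_def[symmetric])
    then have "\<omega> \<in> A k0" using k0 k by (auto simp: A_def)
    then show "\<omega> \<in> (\<Union>k\<in>{n..m}. A k)" using k0 by auto
  qed (auto simp: A_def)
  have bZ: "bounded_rv m (Z k)" if "k \<le> m" for k by (rule bounded_rv_le[OF bounded_rv_Z that])
  have bA: "bounded_rv m (indicator (A k))" if "n \<le> k" "k \<le> m" for k
    by (rule bounded_rv_le[OF bounded_rv_indicator[OF AG[OF that(1)]] that(2)])
  have bD: "bounded_rv m (\<lambda>\<omega>. (Z m \<omega> - Z n \<omega>)\<^sup>2)"
    using assms by (intro bounded_rv_square bounded_rv_diff bZ) auto
  have part: "\<epsilon>\<^sup>2 * prob (A k) \<le> expectation (\<lambda>\<omega>. indicator (A k) \<omega> * (Z m \<omega> - Z n \<omega>)\<^sup>2)" if k: "k \<in> {n..m}" for k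
  proof -
    let ?X = "\<lambda>\<omega>. indicator (A k) \<omega> * (Z k \<omega> - Z n \<omega>)"
    have kk: "n \<le> k" "k \<le> m" using k by auto
    have X: "bounded_rv k ?X"
      using kk by (intro bounded_rv_mult bounded_rv_indicator AG bounded_rv_diff bounded_rv_Z bounded_rv_le[OF bounded_rv_Z]) auto
    have Xm: "bounded_rv m ?X" by (rule bounded_rv_le[OF X kk(2)])
    have i1: "integrable P (\<lambda>\<omega>. ?X \<omega> * Z m \<omega>)" "integrable P (\<lambda>\<omega>. ?X \<omega> * Z k \<omega>)"
      using kk by (auto intro!: integrable_products[of m] Xm bZ)
    have i2: "integrable P (indicat_real (A k))" using bounded_rv_integrable[OF bA[OF kk]] .
    \<comment> \<open>The added terms have expectation 0 by the martingale property. With them the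
      integrand is dominated pointwise: expanding \<open>(Z m - Z n)^2\<close> around
      \<open>Z k\<close> yields exactly them, the square at k, and one more square.\<close>
    have "\<epsilon>\<^sup>2 * prob (A k) = expectation (\<lambda>\<omega>. \<epsilon>\<^sup>2 * indicat_real (A k) \<omega> + 2 * (?X \<omega> * Z m \<omega> - ?X \<omega> * Z k \<omega>))"
      using i1 i2 expectation_mult_Z[OF X kk(2)] AP[OF kk(1)] sets.sets_into_space[OF AP[OF kk(1)]]
      by (simp add: Int_absorb2)
    also have "\<dots> \<le> expectation (\<lambda>\<omega>. indicator (A k) \<omega> * (Z m \<omega> - Z n \<omega>)\<^sup>2)"
    proof (rule integral_mono)
      show "integrable P (\<lambda>\<omega>. \<epsilon>\<^sup>2 * indicat_real (A k) \<omega> + 2 * (?X \<omega> * Z m \<omega> - ?X \<omega> * Z k \<omega>))"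
        using i1 i2 by simp
      show "integrable P (\<lambda>\<omega>. indicat_real (A k) \<omega> * (Z m \<omega> - Z n \<omega>)\<^sup>2)"
        by (rule integrable_products[OF bA[OF kk] bD])
      fix \<omega> assume "\<omega> \<in> space P"
      show "\<epsilon>\<^sup>2 * indicat_real (A k) \<omega> + 2 * (?X \<omega> * Z m \<omega> - ?X \<omega> * Z k \<omega>) \<le> indicator (A k) \<omega> * (Z m \<omega> - Z n \<omega>)\<^sup>2"
      proof (cases "\<omega> \<in> A k")
        case True
        then have "\<epsilon> \<le> \<bar>Z k \<omega> - Z n \<omega>\<bar>" by (simp add: A_def)
        then have "\<epsilon>\<^sup>2 \<le> \<bar>Z k \<omega> - Z n \<omega>\<bar>\<^sup>2" using e by (intro power_mono) auto
        then have "\<epsilon>\<^sup>2 \<le> (Z k \<omega> - Z n \<omega>)\<^sup>2" by simp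
        moreover have "(Z m \<omega> - Z n \<omega>)\<^sup>2 = (Z k \<omega> - Z n \<omega>)\<^sup>2 + 2 * ((Z k \<omega> - Z n \<omega>) * Z m \<omega> - (Z k \<omega> - Z n \<omega>) * Z k \<omega>) + (Z m \<omega> - Z k \<omega>)\<^sup>2"
          by (simp add: power2_eq_square algebra_simps)
        moreover have "0 \<le> (Z m \<omega> - Z k \<omega>)\<^sup>2" by simp
        ultimately show ?thesis using True by (simp add: add_increasing2)
      qed simp
    qed
    finally show ?thesis .
  qed
  have "\<epsilon>\<^sup>2 * prob (\<Union>k\<in>{n..m}. {\<omega>\<in>space P. \<epsilon> \<le> \<bar>Z k \<omega> - Z n \<omega>\<bar>}) = (\<Sum>k\<in>{n..m}. \<epsilon>\<^sup>2 * prob (A k))"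
    unfolding un using AP disj by (subst finite_measure_finite_Union) (auto simp: sum_distrib_left)
  also have "\<dots> \<le> (\<Sum>k\<in>{n..m}. expectation (\<lambda>\<omega>. indicator (A k) \<omega> * (Z m \<omega> - Z n \<omega>)\<^sup>2))"
    by (intro sum_mono part)
  also have "\<dots> = expectation (\<lambda>\<omega>. \<Sum>k\<in>{n..m}. indicator (A k) \<omega> * (Z m \<omega> - Z n \<omega>)\<^sup>2)"
    by (intro Bochner_Integration.integral_sum[symmetric] integrable_products[OF bA bD]) auto
  also have "\<dots> \<le> expectation (\<lambda>\<omega>. (Z m \<omega> - Z n \<omega>)\<^sup>2)"
  proof (rule integral_mono)
    show "integrable P (\<lambda>\<omega>. \<Sum>k\<in>{n..m}. indicat_real (A k) \<omega> * (Z m \<omega> - Z n \<omega>)\<^sup>2)"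
      by (intro Bochner_Integration.integrable_sum integrable_products[OF bA bD]) auto
    show "integrable P (\<lambda>\<omega>. (Z m \<omega> - Z n \<omega>)\<^sup>2)" by (rule bounded_rv_integrable[OF bD])
    fix \<omega>
    have "(\<Sum>k\<in>{n..m}. indicat_real (A k) \<omega>) = indicator (\<Union>k\<in>{n..m}. A k) \<omega>"
      by (rule indicator_UN_disjoint[OF _ disj, symmetric]) simp
    also have "\<dots> \<le> 1" by (simp add: indicator_def)
    finally have "(\<Sum>k\<in>{n..m}. indicat_real (A k) \<omega>) * (Z m \<omega> - Z n \<omega>)\<^sup>2 \<le> 1 * (Z m \<omega> - Z n \<omega>)\<^sup>2"
      by (intro mult_right_mono) auto
    then show "(\<Sum>k\<in>{n..m}. indicat_real (A k) \<omega> * (Z m \<omega> - Z n \<omega>)\<^sup>2) \<le> (Z m \<omega> - Z n \<omega>)\<^sup>2"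
      by (simp add: sum_distrib_right)
  qed
  also have "\<dots> = energy_sum m - energy_sum n" by (rule expectation_Z_diff_square[OF assms(1)])
  finally show ?thesis .
qed

text \<open>Let m and then n tend to infinity in the maximal inequality; the remaining variance
  \<open>energy_lim - energy_sum n\<close> tends to 0.\<close>

lemma AE_tail_small:
  assumes e: "\<epsilon> > 0"
  shows "AE \<omega> in P. \<exists>n. \<forall>k\<ge>n. \<bar>Z k \<omega> - Z n \<omega>\<bar> < \<epsilon>"
proof -
  define U where "U n m = (\<Union>k\<in>{n..m}. {\<omega>\<in>space P. \<epsilon> \<le> \<bar>Z k \<omega> - Z n \<omega>\<bar>})" for n m
  have U [measurable]: "U n m \<in> sets P" for n m unfolding U_def by measurable
  define B where "B = (\<Inter>n. \<Union>m. U n m)"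
  have B [measurable]: "B \<in> sets P" unfolding B_def by measurable
  have le: "prob B \<le> (energy_lim - energy_sum n) / \<epsilon>\<^sup>2" for n
  proof -
    have L1: "(\<lambda>m. prob (U n m)) \<longlonglongrightarrow> prob (\<Union>m. U n m)"
    proof (rule finite_Lim_measure_incseq)
      show "incseq (U n)" unfolding incseq_def U_def by (intro allI impI UN_mono) auto
    qed auto
    have L2: "prob (U n m) \<le> (energy_lim - energy_sum n) / \<epsilon>\<^sup>2" for m
    proof (cases "n \<le> m")
      case True
      have "\<epsilon>\<^sup>2 * prob (U n m) \<le> energy_lim - energy_sum n"
        using maximal_inequality[OF True e] energy_sum_limit(2)[of m] by (simp add: U_def)
      then show ?thesis using e by (simp add: pos_le_divide_eq mult.commute)
    next
      case False
      then show ?thesis using energy_sum_limit(2)[of n] by (simp add: U_def)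
    qed
    have "prob (\<Union>m. U n m) \<le> (energy_lim - energy_sum n) / \<epsilon>\<^sup>2"
      by (rule LIMSEQ_le_const2[OF L1]) (use L2 in auto)
    moreover have "prob B \<le> prob (\<Union>m. U n m)" unfolding B_def by (intro finite_measure_mono) auto
    ultimately show ?thesis by simp
  qed
  have "(\<lambda>n. (energy_lim - energy_sum n) / \<epsilon>\<^sup>2) \<longlonglongrightarrow> (energy_lim - energy_lim) / \<epsilon>\<^sup>2"
    using e by (intro tendsto_intros energy_sum_limit) auto
  then have "prob B \<le> 0" using le by (intro LIMSEQ_le_const[where a = "prob B"]) auto
  then have "prob B = 0" using measure_nonneg[of P B] by linarith
  then have "AE \<omega> in P. \<omega> \<notin> B" by (intro AE_not_in) (simp add: null_sets_def emeasure_eq_measure)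
  moreover have "AE \<omega> in P. \<omega> \<in> space P" by simp
  ultimately show ?thesis
  proof eventually_elim
    case (elim \<omega>)
    then obtain n where n: "\<And>m. \<omega> \<notin> U n m" by (auto simp: B_def)
    have "\<bar>Z k \<omega> - Z n \<omega>\<bar> < \<epsilon>" if "k \<ge> n" for k
    proof (rule ccontr)
      assume "\<not> \<bar>Z k \<omega> - Z n \<omega>\<bar> < \<epsilon>"
      then have "\<omega> \<in> U n k" using that elim(2) by (auto simp: U_def intro!: bexI[of _ k])
      then show False using n by simp
    qed
    then show ?case by blast
  qed
qed

definition Z_inf :: "'a \<Rightarrow> real" where
  "Z_inf \<omega> = lim (\<lambda>n. Z n \<omega>)"

lemma Z_inf_measurable [measurable]: "Z_inf \<in> borel_measurable P"
  unfolding Z_inf_def[abs_def] by (intro borel_measurable_lim_metric Z_measurable_P)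

lemma AE_Z_limit: "AE \<omega> in P. (\<lambda>n. Z n \<omega>) \<longlonglongrightarrow> Z_inf \<omega>"
proof -
  have "AE \<omega> in P. \<forall>j::nat. \<exists>n. \<forall>k\<ge>n. \<bar>Z k \<omega> - Z n \<omega>\<bar> < 1 / real (Suc j)"
    unfolding AE_all_countable by (intro allI AE_tail_small) simp
  then show ?thesis
  proof eventually_elim
    case (elim \<omega>)
    have "Cauchy (\<lambda>n. Z n \<omega>)" unfolding Cauchy_altdef2
    proof (intro allI impI)
      fix e :: real assume "e > 0"
      then obtain j where "inverse (real (Suc j)) < e" using reals_Archimedean by blast
      moreover obtain n where "\<forall>k\<ge>n. \<bar>Z k \<omega> - Z n \<omega>\<bar> < 1 / real (Suc j)" using elim by blast
      ultimately show "\<exists>N. \<forall>n\<ge>N. dist (Z n \<omega>) (Z N \<omega>) < e"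
        by (auto simp: dist_real_def inverse_eq_divide intro!: exI[of _ n] intro: less_trans)
    qed
    then have "convergent (\<lambda>n. Z n \<omega>)" by (rule Cauchy_convergent)
    then show ?case by (simp add: Z_inf_def convergent_LIMSEQ_iff)
  qed
qed

text \<open>Fatou's lemma along m in
  \<open>E (Z m - Z n)^2 = energy_sum m - energy_sum n\<close>.\<close>

lemma Z_inf_L2:
  shows "integrable P (\<lambda>\<omega>. (Z_inf \<omega> - Z n \<omega>)\<^sup>2)"
    and "expectation (\<lambda>\<omega>. (Z_inf \<omega> - Z n \<omega>)\<^sup>2) \<le> energy_lim - energy_sum n"
proof -
  let ?f = "\<lambda>m \<omega>. ennreal ((Z m \<omega> - Z n \<omega>)\<^sup>2)"
  have "(\<integral>\<^sup>+\<omega>. ennreal ((Z_inf \<omega> - Z n \<omega>)\<^sup>2) \<partial>P) = (\<integral>\<^sup>+\<omega>. liminf (\<lambda>m. ?f m \<omega>) \<partial>P)"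
  proof (rule nn_integral_cong_AE)
    show "AE \<omega> in P. ennreal ((Z_inf \<omega> - Z n \<omega>)\<^sup>2) = liminf (\<lambda>m. ?f m \<omega>)"
      using AE_Z_limit
    proof eventually_elim
      case (elim \<omega>)
      then have t: "(\<lambda>m. ?f m \<omega>) \<longlonglongrightarrow> ennreal ((Z_inf \<omega> - Z n \<omega>)\<^sup>2)"
        by (intro tendsto_intros)
      show ?case by (rule lim_imp_Liminf[OF _ t, symmetric]) simp
    qed
  qed
  also have "\<dots> \<le> liminf (\<lambda>m. \<integral>\<^sup>+\<omega>. ?f m \<omega> \<partial>P)"
    by (rule nn_integral_liminf) measurable
  also have "\<dots> \<le> limsup (\<lambda>m. \<integral>\<^sup>+\<omega>. ?f m \<omega> \<partial>P)" by (rule Liminf_le_Limsup) simp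
  also have "\<dots> \<le> ennreal (energy_lim - energy_sum n)"
  proof (rule Limsup_bounded)
    show "\<forall>\<^sub>F m in sequentially. (\<integral>\<^sup>+\<omega>. ?f m \<omega> \<partial>P) \<le> ennreal (energy_lim - energy_sum n)"
      using eventually_ge_at_top[of n]
    proof eventually_elim
      case (elim m)
      have "bounded_rv m (\<lambda>\<omega>. (Z m \<omega> - Z n \<omega>)\<^sup>2)"
        using elim by (intro bounded_rv_square bounded_rv_diff bounded_rv_Z bounded_rv_le[OF bounded_rv_Z])
      then have "(\<integral>\<^sup>+\<omega>. ?f m \<omega> \<partial>P) = ennreal (expectation (\<lambda>\<omega>. (Z m \<omega> - Z n \<omega>)\<^sup>2))"
        by (intro nn_integral_eq_integral bounded_rv_integrable) auto
      then show ?case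
        using energy_sum_limit(2)[of m] by (simp add: expectation_Z_diff_square[OF elim] ennreal_leI)
    qed
  qed
  finally have le: "(\<integral>\<^sup>+\<omega>. ennreal ((Z_inf \<omega> - Z n \<omega>)\<^sup>2) \<partial>P) \<le> ennreal (energy_lim - energy_sum n)" .
  show int: "integrable P (\<lambda>\<omega>. (Z_inf \<omega> - Z n \<omega>)\<^sup>2)"
    using le by (intro integrableI_bounded) (auto simp: less_top[symmetric] top_unique)
  have "ennreal (expectation (\<lambda>\<omega>. (Z_inf \<omega> - Z n \<omega>)\<^sup>2)) \<le> ennreal (energy_lim - energy_sum n)"
    using le nn_integral_eq_integral[OF int] by simp
  then show "expectation (\<lambda>\<omega>. (Z_inf \<omega> - Z n \<omega>)\<^sup>2) \<le> energy_lim - energy_sum n"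
    using energy_sum_limit(2)[of n] by (simp add: ennreal_le_iff)
qed

lemma integrable_Z_inf_square: "integrable P (\<lambda>\<omega>. (Z_inf \<omega>)\<^sup>2)"
proof (rule Bochner_Integration.integrable_bound)
  show "integrable P (\<lambda>\<omega>. 2 * (Z_inf \<omega> - Z 0 \<omega>)\<^sup>2 + 2 * (Z 0 \<omega>)\<^sup>2)"
    using Z_inf_L2(1)[of 0] bounded_rv_integrable[OF bounded_rv_square[OF bounded_rv_Z]] by simp
  show "AE \<omega> in P. norm ((Z_inf \<omega>)\<^sup>2) \<le> norm (2 * (Z_inf \<omega> - Z 0 \<omega>)\<^sup>2 + 2 * (Z 0 \<omega>)\<^sup>2)"
  proof (rule AE_I2)
    fix \<omega>
    have "0 \<le> (Z_inf \<omega> - 2 * Z 0 \<omega>)\<^sup>2" by simp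
    then have "(Z_inf \<omega>)\<^sup>2 \<le> 2 * (Z_inf \<omega> - Z 0 \<omega>)\<^sup>2 + 2 * (Z 0 \<omega>)\<^sup>2"
      by (simp add: power2_eq_square algebra_simps)
    then show "norm ((Z_inf \<omega>)\<^sup>2) \<le> norm (2 * (Z_inf \<omega> - Z 0 \<omega>)\<^sup>2 + 2 * (Z 0 \<omega>)\<^sup>2)" by simp
  qed
qed measurable

text \<open>Three errors: the count against Z at the same step, the 1 subtracted in
  \<open>N\<close>, and Z against its limit. The square of a sum of three terms is at most three
  times the sum of their squares.\<close>

theorem leaves_L2_limit:
  "(\<lambda>n. expectation (\<lambda>\<omega>. (real n powr (- \<beta>) * (leaves n \<omega> - 1) - leaf_const * Z_inf \<omega>)\<^sup>2)) \<longlonglongrightarrow> 0"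
proof -
  let ?R = "\<lambda>n \<omega>. leaves n \<omega> - leaf_const * real n powr \<beta> * Z n \<omega>"
  define y where "y n = 3 * (expectation (\<lambda>\<omega>. (?R n \<omega>)\<^sup>2) / real n powr (2 * \<beta>) + 1 / real n powr (2 * \<beta>) +
     leaf_const\<^sup>2 * (energy_lim - energy_sum n))" for n
  have "y \<longlonglongrightarrow> 3 * (0 + 0 + leaf_const\<^sup>2 * (energy_lim - energy_lim))"
    unfolding y_def
  proof (intro tendsto_intros leaves_L2_asymp energy_sum_limit)
    show "(\<lambda>n. 1 / real n powr (2 * \<beta>)) \<longlonglongrightarrow> 0" using \<beta>_bounds by real_asymp
  qed
  then have y: "y \<longlonglongrightarrow> 0" by simp
  have bl: "bounded_rv n (leaves n)" for n
    unfolding leaves_eq by (intro bounded_rv_S mean_split_bounded_weight[OF mean_split_leaf_poly])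
  have le: "expectation (\<lambda>\<omega>. (real n powr (- \<beta>) * (leaves n \<omega> - 1) - leaf_const * Z_inf \<omega>)\<^sup>2) \<le> y n" if n: "n > 0" for n
  proof -
    define w where "w = real n powr \<beta>"
    have w: "w > 0" "real n powr (- \<beta>) = 1 / w" "real n powr (2 * \<beta>) = w\<^sup>2"
      using n by (auto simp: w_def powr_minus_divide power2_eq_square powr_add[symmetric])
    have "bounded_rv n (\<lambda>\<omega>. leaves n \<omega> - (leaf_const * w) * Z n \<omega>)"
    proof -
      have "bounded_rv n (\<lambda>\<omega>. leaf_const * w)"
        by (auto simp: bounded_rv_def intro!: exI[of _ "\<bar>leaf_const * w\<bar>"])
      from bounded_rv_diff[OF bl bounded_rv_mult[OF this bounded_rv_Z]] show ?thesis .
    qed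
    then have iR: "integrable P (\<lambda>\<omega>. (?R n \<omega>)\<^sup>2)"
      using bounded_rv_integrable[OF bounded_rv_square] by (simp add: w_def mult_ac)
    have int: "integrable P (\<lambda>\<omega>. 3 * ((?R n \<omega>)\<^sup>2 / w\<^sup>2 + 1 / w\<^sup>2 + leaf_const\<^sup>2 * (Z_inf \<omega> - Z n \<omega>)\<^sup>2))"
      using iR Z_inf_L2(1)[of n] by (intro integrable_mult_right Bochner_Integration.integrable_add) auto
    have "expectation (\<lambda>\<omega>. (real n powr (- \<beta>) * (leaves n \<omega> - 1) - leaf_const * Z_inf \<omega>)\<^sup>2) \<le>
      expectation (\<lambda>\<omega>. 3 * ((?R n \<omega>)\<^sup>2 / w\<^sup>2 + 1 / w\<^sup>2 + leaf_const\<^sup>2 * (Z_inf \<omega> - Z n \<omega>)\<^sup>2))"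
    proof (rule integral_mono'[OF int])
      fix \<omega>
      have sq: "(a + b + c)\<^sup>2 \<le> 3 * (a\<^sup>2 + b\<^sup>2 + c\<^sup>2)" for a b c :: real
      proof -
        have "0 \<le> (a - b)\<^sup>2 + (b - c)\<^sup>2 + (a - c)\<^sup>2" by simp
        then show ?thesis by (simp add: power2_eq_square algebra_simps)
      qed
      have "real n powr (- \<beta>) * (leaves n \<omega> - 1) - leaf_const * Z_inf \<omega> =
        ?R n \<omega> / w + (- 1 / w) + leaf_const * (Z n \<omega> - Z_inf \<omega>)"
        unfolding w(2) w_def[symmetric] using w(1) by (simp add: field_simps)
      then show "(real n powr (- \<beta>) * (leaves n \<omega> - 1) - leaf_const * Z_inf \<omega>)\<^sup>2 \<le>
          3 * ((?R n \<omega>)\<^sup>2 / w\<^sup>2 + 1 / w\<^sup>2 + leaf_const\<^sup>2 * (Z_inf \<omega> - Z n \<omega>)\<^sup>2)"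
        using sq[of "?R n \<omega> / w" "- 1 / w" "leaf_const * (Z n \<omega> - Z_inf \<omega>)"]
        by (simp only: power_divide power_mult_distrib power2_minus power_one power2_commute[of "Z n \<omega>"])
    qed auto
    also have "\<dots> = 3 * (expectation (\<lambda>\<omega>. (?R n \<omega>)\<^sup>2) / w\<^sup>2 + 1 / w\<^sup>2 + leaf_const\<^sup>2 * expectation (\<lambda>\<omega>. (Z_inf \<omega> - Z n \<omega>)\<^sup>2))"
      using iR Z_inf_L2(1)[of n] by (simp add: prob_space)
    also have "\<dots> \<le> y n"
      unfolding y_def w(3) using Z_inf_L2(2)[of n] by (intro mult_left_mono add_left_mono) auto
    finally show ?thesis .
  qed
  show ?thesis
  proof (rule tendsto_sandwich[OF _ _ tendsto_const y])
    show "\<forall>\<^sub>F n in sequentially. 0 \<le> expectation (\<lambda>\<omega>. (real n powr (- \<beta>) * (leaves n \<omega> - 1) - leaf_const * Z_inf \<omega>)\<^sup>2)"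
      by (intro always_eventually allI Bochner_Integration.integral_nonneg) auto
    show "\<forall>\<^sub>F n in sequentially. expectation (\<lambda>\<omega>. (real n powr (- \<beta>) * (leaves n \<omega> - 1) - leaf_const * Z_inf \<omega>)\<^sup>2) \<le> y n"
      using eventually_gt_at_top[of 0] by eventually_elim (rule le)
  qed
qed

end

section \<open>Poisson points in a time grid\<close>

lemma down_closed_initial_segment:
  fixes A :: "nat set"
  assumes "finite A" "\<And>i. i \<in> A \<Longrightarrow> 1 \<le> i" "\<And>i j. i \<in> A \<Longrightarrow> 1 \<le> j \<Longrightarrow> j \<le> i \<Longrightarrow> j \<in> A"
  shows "A = {1..card A}"
proof (cases "A = {}")
  case False
  have "A = {1..Max A}"
  proof
    show "A \<subseteq> {1..Max A}"
      using Max_ge[OF assms(1)] assms(2) by (auto simp only: subset_eq atLeastAtMost_iff)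
    show "{1..Max A} \<subseteq> A"
      using assms(3)[OF Max_in[OF assms(1) False]] by (auto simp only: subset_eq atLeastAtMost_iff)
  qed
  then obtain k where "A = {1..k}" by blast
  then show ?thesis by simp
qed simp

text \<open>If every slab of T holds exactly one point and the other slabs up to the last one of T
  hold none, the rank of a slab is the index of its point.\<close>

definition cell_rank :: "nat set \<Rightarrow> nat \<Rightarrow> nat" where
  "cell_rank T l = card {l' \<in> T. l' \<le> l}"

lemma bij_betw_rank:
  assumes "finite T" shows "bij_betw (cell_rank T) T {1..card T}"
proof -
  have "inj_on (cell_rank T) T"
  proof (rule linorder_inj_onI')
    fix i j assume "i \<in> T" "j \<in> T" "i < j"
    then have "{l' \<in> T. l' \<le> i} \<subseteq> {l' \<in> T. l' \<le> j}" "j \<in> {l' \<in> T. l' \<le> j}" "j \<notin> {l' \<in> T. l' \<le> i}"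
      by auto
    then have "{l' \<in> T. l' \<le> i} \<subset> {l' \<in> T. l' \<le> j}" by blast
    then have "cell_rank T i < cell_rank T j" unfolding cell_rank_def using assms by (intro psubset_card_mono) auto
    then show "cell_rank T i \<noteq> cell_rank T j" by simp
  qed
  moreover have "cell_rank T ` T \<subseteq> {1..card T}"
  proof
    fix x assume "x \<in> cell_rank T ` T"
    then obtain l where l: "l \<in> T" "x = cell_rank T l" by auto
    have "{l} \<subseteq> {l' \<in> T. l' \<le> l}" using l by auto
    then have "1 \<le> cell_rank T l" unfolding cell_rank_def using card_mono[of "{l' \<in> T. l' \<le> l}" "{l}"] assms by simp
    moreover have "cell_rank T l \<le> card T" unfolding cell_rank_def using assms by (intro card_mono) auto
    ultimately show "x \<in> {1..card T}" using l by simp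
  qed
  moreover from calculation have "cell_rank T ` T = {1..card T}"
    by (intro card_subset_eq) (auto simp: card_image)
  ultimately show ?thesis by (simp add: bij_betw_def)
qed

lemma prod_pairs: "(\<Prod>j<2 * n. f j) = (\<Prod>l<n. f (2 * l) * f (2 * l + 1))" for f :: "nat \<Rightarrow> real"
  by (induction n) (auto simp: mult_ac)

definition slab :: "nat \<Rightarrow> nat \<Rightarrow> real set" where
  "slab k l = {real l / real (Suc k) ..< real (Suc l) / real (Suc k)}"

definition cell :: "nat \<Rightarrow> real \<Rightarrow> nat" where
  "cell k t = nat \<lfloor>t * real (Suc k)\<rfloor>"

lemma slab_iff_cell:
  assumes "t \<ge> 0" shows "t \<in> slab k l \<longleftrightarrow> cell k t = l"
proof -
  have "t \<in> slab k l \<longleftrightarrow> real l \<le> t * real (Suc k) \<and> t * real (Suc k) < real l + 1"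
    by (simp add: slab_def divide_le_eq less_divide_eq add_ac del: of_nat_Suc) simp
  also have "\<dots> \<longleftrightarrow> \<lfloor>t * real (Suc k)\<rfloor> = int l" by (simp add: floor_eq_iff)
  also have "\<dots> \<longleftrightarrow> cell k t = l" using assms by (auto simp: cell_def)
  finally show ?thesis .
qed

lemma slab_nonneg: "slab k l \<subseteq> {0..}"
proof
  fix t assume "t \<in> slab k l"
  then have "real l / real (Suc k) \<le> t" by (simp add: slab_def)
  with divide_nonneg_nonneg[of "real l" "real (Suc k)"] have "0 \<le> t"
    by (meson of_nat_0_le_iff order_trans)
  then show "t \<in> {0..}" by simp
qed

lemma slab_disjoint:
  assumes "l \<noteq> l'" shows "slab k l \<inter> slab k l' = {}"
proof (rule equals0I)
  fix t assume t: "t \<in> slab k l \<inter> slab k l'"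
  then have "0 \<le> t" using slab_nonneg[of k l] by auto
  then show False using t assms slab_iff_cell[of t k l] slab_iff_cell[of t k l'] by simp
qed

lemma cell_mono: "t \<le> t' \<Longrightarrow> cell k t \<le> cell k t'"
  unfolding cell_def by (intro nat_mono floor_mono mult_right_mono) auto

lemma intensity_sets_Times:
  assumes "I \<in> sets borel" "C \<in> sets borel" "I \<subseteq> {0..}" "C \<subseteq> unit_square"
  shows "I \<times> C \<in> sets intensity"
    "emeasure intensity (I \<times> C) = emeasure lborel I * emeasure lborel C"
proof -
  have "({0..} :: real set) \<times> unit_square \<in> sets (borel \<Otimes>\<^sub>M borel)" "I \<times> C \<in> sets (borel \<Otimes>\<^sub>M borel)"
    using assms by (intro pair_measureI; simp)+
  then have 1: "({0..} :: real set) \<times> unit_square \<in> sets lborel" and 2: "I \<times> C \<in> sets lborel"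
    by (simp_all only: borel_prod sets_lborel)
  show 3: "I \<times> C \<in> sets intensity"
    unfolding intensity_def using 1 2 assms by (subst sets_restrict_space_iff) auto
  have "emeasure intensity (I \<times> C) = emeasure lborel (I \<times> C)"
    unfolding intensity_def using 1 assms by (intro emeasure_restrict_space) auto
  also have "\<dots> = emeasure (lborel \<Otimes>\<^sub>M lborel) (I \<times> C)" by (simp add: lborel_prod)
  also have "\<dots> = emeasure lborel I * emeasure lborel C"
    using assms by (intro lborel.emeasure_pair_measure_Times) auto
  finally show "emeasure intensity (I \<times> C) = emeasure lborel I * emeasure lborel C" .
qed

lemma space_intensity: "space intensity = {0..} \<times> unit_square"
  by (simp add: intensity_def space_restrict_space)

lemma emeasure_lborel_subset_square:
  assumes "C \<in> sets borel" "C \<subseteq> unit_square"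
  shows "emeasure lborel C = measure unif C" "measure unif C \<le> 1"
proof -
  have "emeasure unif C = emeasure lborel C" using assms by (simp add: emeasure_unif Int_absorb2)
  then show "emeasure lborel C = measure unif C" by (simp add: unif.emeasure_eq_measure)
qed simp

lemma measure_slab_Times:
  assumes "C \<in> sets borel" "C \<subseteq> unit_square"
  shows "emeasure intensity (slab k l \<times> C) = ennreal (measure unif C / real (Suc k))"
proof -
  have "emeasure lborel (slab k l) = ennreal (1 / real (Suc k))"
    unfolding slab_def by (subst emeasure_lborel_Ico) (auto simp: divide_right_mono diff_divide_distrib[symmetric])
  then show ?thesis
    using assms slab_nonneg[of k l]
    by (subst intensity_sets_Times(2)) (auto simp: slab_def emeasure_lborel_subset_square ennreal_mult'[symmetric] simp del: of_nat_Suc)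
qed

locale poisson_atoms = prob_space P for P :: "'a measure" +
  fixes \<Phi> :: "'a \<Rightarrow> (real \<times> real \<times> real) set"
    and \<tau> :: "nat \<Rightarrow> 'a \<Rightarrow> real" and p :: "nat \<Rightarrow> 'a \<Rightarrow> real \<times> real"
  assumes ppp: "poisson_point_process P intensity \<Phi>"
    and ranked: "ranked_atoms P \<Phi> \<tau> p"
begin

lemma \<tau>_measurable [measurable]: "\<tau> i \<in> borel_measurable P"
  using ranked by (simp add: ranked_atoms_def)

lemma p_measurable_P [measurable]: "p i \<in> borel_measurable P"
  using ranked by (simp add: ranked_atoms_def)

definition good :: "'a \<Rightarrow> bool" where
  "good \<omega> \<longleftrightarrow> \<tau> 0 \<omega> = 0 \<and> strict_mono (\<lambda>i. \<tau> i \<omega>) \<and>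
     \<Phi> \<omega> = (\<lambda>i. (\<tau> i \<omega>, p i \<omega>)) ` {1..} \<and> (\<forall>i\<ge>1. p i \<omega> \<in> unit_square)"

lemma AE_good: "AE \<omega> in P. good \<omega>"
proof -
  have "AE \<omega> in P. \<tau> 0 \<omega> = 0 \<and> strict_mono (\<lambda>i. \<tau> i \<omega>) \<and> \<Phi> \<omega> = (\<lambda>i. (\<tau> i \<omega>, p i \<omega>)) ` {1..}"
    using ranked by (simp add: ranked_atoms_def)
  moreover have "AE \<omega> in P. \<Phi> \<omega> \<subseteq> {0..} \<times> unit_square"
    using ppp by (intro AE_I2) (auto simp: poisson_point_process_def space_intensity)
  ultimately show ?thesis
    by eventually_elim (auto simp: good_def)
qed

lemma good_\<tau>_mono: "good \<omega> \<Longrightarrow> i \<le> j \<Longrightarrow> \<tau> i \<omega> \<le> \<tau> j \<omega>"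
  using strict_mono_less_eq[of "\<lambda>i. \<tau> i \<omega>" i j] by (simp add: good_def)

lemma good_\<tau>_nonneg: "good \<omega> \<Longrightarrow> 0 \<le> \<tau> i \<omega>"
  using good_\<tau>_mono[of \<omega> 0 i] by (simp add: good_def)

lemma good_\<tau>_strict: "good \<omega> \<Longrightarrow> i < j \<Longrightarrow> \<tau> i \<omega> < \<tau> j \<omega>"
  using strict_mono_less[of "\<lambda>i. \<tau> i \<omega>" i j] by (simp add: good_def)

text \<open>Strictly increasing times make the atoms distinct, so points can be counted by their
  indices.\<close>

lemma point_count_good:
  assumes "good \<omega>"
  shows "point_count \<Phi> B \<omega> = emeasure (count_space UNIV) {i. 1 \<le> i \<and> (\<tau> i \<omega>, p i \<omega>) \<in> B}"
proof -
  let ?f = "\<lambda>i. (\<tau> i \<omega>, p i \<omega>)"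
  have inj: "inj_on ?f A" for A
  proof (rule linorder_inj_onI')
    fix i j :: nat assume "i < j"
    then show "?f i \<noteq> ?f j" using good_\<tau>_strict[OF assms, of i j] by simp
  qed
  have im: "\<Phi> \<omega> \<inter> B = ?f ` {i. 1 \<le> i \<and> ?f i \<in> B}" using assms by (auto simp: good_def)
  show ?thesis unfolding point_count_def im
    using finite_image_iff[OF inj] card_image[OF inj] by (simp add: emeasure_count_space)
qed

lemma point_count_eq_0:
  assumes "good \<omega>"
  shows "point_count \<Phi> B \<omega> = of_nat 0 \<longleftrightarrow> (\<forall>i\<ge>1. (\<tau> i \<omega>, p i \<omega>) \<notin> B)"
  unfolding point_count_good[OF assms] by (auto simp: emeasure_count_space_eq_0)

lemma point_count_eq_card:
  assumes "good \<omega>"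
  shows "point_count \<Phi> B \<omega> = of_nat n \<longleftrightarrow>
     finite {i. 1 \<le> i \<and> (\<tau> i \<omega>, p i \<omega>) \<in> B} \<and> card {i. 1 \<le> i \<and> (\<tau> i \<omega>, p i \<omega>) \<in> B} = n"
proof -
  have "(of_nat n :: ennreal) \<noteq> top" by (simp add: ennreal_of_nat_eq_real_of_nat)
  then show ?thesis
    unfolding point_count_good[OF assms] by (auto simp: emeasure_count_space)
qed

lemma point_count_measurable: "B \<in> sets intensity \<Longrightarrow> point_count \<Phi> B \<in> borel_measurable P"
  using ppp by (simp add: poisson_point_process_def)

lemma count_event [measurable]: "B \<in> sets intensity \<Longrightarrow> {\<omega>\<in>space P. point_count \<Phi> B \<omega> = of_nat k} \<in> sets P"
proof -
  assume "B \<in> sets intensity"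
  from measurable_sets[OF point_count_measurable[OF this], of "{of_nat k}"]
  have "point_count \<Phi> B -` {of_nat k} \<inter> space P \<in> sets P" by simp
  moreover have "point_count \<Phi> B -` {of_nat k} \<inter> space P = {\<omega>\<in>space P. point_count \<Phi> B \<omega> = of_nat k}" by auto
  ultimately show ?thesis by simp
qed

lemma prob_point_count:
  assumes "B \<in> sets intensity" "emeasure intensity B = ennreal m" "m \<ge> 0"
  shows "prob {\<omega>\<in>space P. point_count \<Phi> B \<omega> = of_nat k} = m ^ k / fact k * exp (- m)"
proof -
  have "measure intensity B = m" using assms by (simp add: measure_def)
  moreover have "emeasure intensity B < \<infinity>" using assms by simp
  ultimately show ?thesis
    using ppp[unfolded poisson_point_process_def, THEN conjunct2, THEN conjunct2, THEN conjunct1, rule_format, OF assms(1)]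
    by simp
qed

text \<open>One point in each slab of T, lying in the prescribed region, and none in the other slabs
  below n. It is phrased through counts in disjoint sets because these are what the definition of a
  Poisson process controls.\<close>

definition slab_event :: "nat \<Rightarrow> nat set \<Rightarrow> nat \<Rightarrow> (nat \<Rightarrow> (real \<times> real) set) \<Rightarrow> 'a set" where
  "slab_event k T n C = {\<omega>\<in>space P. \<forall>l<n. point_count \<Phi> (slab k l \<times> C l) \<omega> = of_nat (of_bool (l \<in> T)) \<and>
      point_count \<Phi> (slab k l \<times> (unit_square - C l)) \<omega> = of_nat 0}"

text \<open>Each slab is cut into its region and the complement. The two exponential factors always
  combine to that of the whole slab, so the regions enter only through the slabs of T.\<close>

lemma slab_event_prob:
  assumes C: "\<And>l. C l \<in> sets borel" "\<And>l. C l \<subseteq> unit_square" and n: "n > 0"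
  shows "prob (slab_event k T n C) = (\<Prod>l<n. (if l \<in> T then measure unif (C l) / real (Suc k) else 1) * exp (- 1 / real (Suc k)))"
    "slab_event k T n C \<in> sets P"
proof -
  \<comment> \<open>Even indices carry the regions, odd ones the complements, so that a single
    sequence of disjoint sets covers both.\<close>
  define B where "B j = slab k (j div 2) \<times> (if even j then C (j div 2) else unit_square - C (j div 2))" for j
  define c where "c j = (if even j then of_bool (j div 2 \<in> T) else 0 :: nat)" for j
  have Bs: "B j \<in> sets intensity" for j
    unfolding B_def using C slab_nonneg by (intro intensity_sets_Times) (auto simp: slab_def)
  have sub: "measure unif (unit_square - C l) = 1 - measure unif (C l)" for l
  proof -
    have "measure unif (unit_square - C l) = measure unif unit_square - measure unif (C l)"
      using C by (intro unif.finite_measure_Diff) auto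
    moreover have "measure unif unit_square = 1"
      by (simp add: measure_def emeasure_unif emeasure_unit_square)
    ultimately show ?thesis by simp
  qed
  define m where "m j = measure unif (if even j then C (j div 2) else unit_square - C (j div 2)) / real (Suc k)" for j
  have Bm: "emeasure intensity (B j) = ennreal (m j)" "m j \<ge> 0" for j
    unfolding B_def m_def using C by (auto intro!: measure_slab_Times simp del: of_nat_Suc)
  have disj: "disjoint_family B"
    unfolding disjoint_family_on_def
  proof safe
    fix i j :: nat and a b c assume ij: "i \<noteq> j" "(a, b, c) \<in> B i" "(a, b, c) \<in> B j"
    then have "i div 2 = j div 2" using slab_disjoint[of "i div 2" "j div 2" k] by (auto simp: B_def)
    moreover from this have "even i = even j" using ij by (auto simp: B_def split: if_splits)
    ultimately have "i = j" by (metis div_mult_mod_eq odd_iff_mod_2_eq_one even_iff_mod_2_eq_zero)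
    then show "(a, b, c) \<in> {}" using ij by simp
  qed
  have ind: "indep_vars (\<lambda>_. borel) (\<lambda>j. point_count \<Phi> (B j)) UNIV"
    using ppp[unfolded poisson_point_process_def, THEN conjunct2, THEN conjunct2, THEN conjunct2, THEN conjunct2,
        rule_format, of B] disj Bs by auto
  have ev: "slab_event k T n C = (\<Inter>j\<in>{..<2 * n}. point_count \<Phi> (B j) -` {of_nat (c j)} \<inter> space P)"
  proof (intro set_eqI iffI)
    fix \<omega> assume w: "\<omega> \<in> slab_event k T n C"
    have "point_count \<Phi> (B j) \<omega> = of_nat (c j)" if "j < 2 * n" for j
    proof -
      have "j div 2 < n" using that by simp
      then show ?thesis using w by (auto simp: slab_event_def B_def c_def)
    qed
    then show "\<omega> \<in> (\<Inter>j\<in>{..<2 * n}. point_count \<Phi> (B j) -` {of_nat (c j)} \<inter> space P)"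
      using w by (auto simp: slab_event_def)
  next
    fix \<omega> assume w: "\<omega> \<in> (\<Inter>j\<in>{..<2 * n}. point_count \<Phi> (B j) -` {of_nat (c j)} \<inter> space P)"
    have j: "point_count \<Phi> (B j) \<omega> = of_nat (c j)" if "j < 2 * n" for j
      using INT_D[OF w, of j] that by simp
    have "\<omega> \<in> space P" using INT_D[OF w, of 0] n by simp
    moreover have "point_count \<Phi> (slab k l \<times> C l) \<omega> = of_nat (of_bool (l \<in> T)) \<and>
      point_count \<Phi> (slab k l \<times> (unit_square - C l)) \<omega> = of_nat 0" if "l < n" for l
      using j[of "2 * l"] j[of "2 * l + 1"] that by (simp add: B_def c_def)
    ultimately show "\<omega> \<in> slab_event k T n C" by (auto simp: slab_event_def)
  qed
  have "prob (slab_event k T n C) = (\<Prod>j<2 * n. prob (point_count \<Phi> (B j) -` {of_nat (c j)} \<inter> space P))"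
    unfolding ev using n by (intro indep_varsD[OF ind]) (auto simp: lessThan_empty_iff)
  also have "\<dots> = (\<Prod>j<2 * n. m j ^ c j / fact (c j) * exp (- m j))"
  proof (rule prod.cong[OF refl])
    fix j
    have "point_count \<Phi> (B j) -` {of_nat (c j)} \<inter> space P = {\<omega>\<in>space P. point_count \<Phi> (B j) \<omega> = of_nat (c j)}" by auto
    then show "prob (point_count \<Phi> (B j) -` {of_nat (c j)} \<inter> space P) = m j ^ c j / fact (c j) * exp (- m j)"
      using prob_point_count[OF Bs Bm, of j "c j"] by simp
  qed
  also have "\<dots> = (\<Prod>l<n. (if l \<in> T then measure unif (C l) / real (Suc k) else 1) * exp (- 1 / real (Suc k)))"
    unfolding prod_pairs
  proof (rule prod.cong[OF refl])
    fix l
    have e: "exp (- m (2 * l)) * exp (- m (2 * l + 1)) = exp (- 1 / real (Suc k))"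
      by (simp add: exp_add[symmetric] m_def sub diff_divide_distrib)
    have m0: "m (2 * l) = measure unif (C l) / real (Suc k)" by (simp add: m_def)
    have "m (2 * l) ^ c (2 * l) / fact (c (2 * l)) * exp (- m (2 * l)) *
       (m (2 * l + 1) ^ c (2 * l + 1) / fact (c (2 * l + 1)) * exp (- m (2 * l + 1))) =
       (if l \<in> T then m (2 * l) else 1) * (exp (- m (2 * l)) * exp (- m (2 * l + 1)))"
      by (simp add: c_def)
    also have "\<dots> = (if l \<in> T then measure unif (C l) / real (Suc k) else 1) * exp (- 1 / real (Suc k))"
      unfolding e by (simp only: m0)
    finally show "m (2 * l) ^ c (2 * l) / fact (c (2 * l)) * exp (- m (2 * l)) *
       (m (2 * l + 1) ^ c (2 * l + 1) / fact (c (2 * l + 1)) * exp (- m (2 * l + 1))) =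
       (if l \<in> T then measure unif (C l) / real (Suc k) else 1) * exp (- 1 / real (Suc k))" .
  qed
  finally show "prob (slab_event k T n C) = \<dots>" .
  show "slab_event k T n C \<in> sets P"
    unfolding ev using n Bs
    by (intro sets.finite_INT measurable_sets[OF point_count_measurable]) (auto simp: lessThan_empty_iff)
qed

end

section \<open>Order of arrival read off from the occupied slabs\<close>

lemma strict_chain:
  fixes c :: "nat \<Rightarrow> nat"
  assumes "\<forall>i\<in>{1..m}. c i < c (Suc i)" "1 \<le> i" "i < j" "j \<le> Suc m"
  shows "c i < c j"
  using assms(3,4)
proof (induction j)
  case (Suc j)
  show ?case
  proof (cases "i = j")
    case True
    then show ?thesis using assms(1,2) Suc.prems by simp
  next
    case False
    then have "c i < c j" using Suc by simp
    also have "c j < c (Suc j)" using assms(1,2) Suc.prems by simp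
    finally show ?thesis .
  qed
qed simp

lemma inj_on_strict_chain:
  fixes c :: "nat \<Rightarrow> nat"
  assumes "\<forall>i\<in>{1..m}. c i < c (Suc i)"
  shows "inj_on c {1..m}"
proof (rule linorder_inj_onI')
  fix i j assume "i \<in> {1..m}" "j \<in> {1..m}" "i < j"
  then show "c i \<noteq> c j" using strict_chain[OF assms, of i j] by simp
qed

lemma rank_strict_chain:
  fixes c :: "nat \<Rightarrow> nat"
  assumes c: "\<forall>i\<in>{1..m}. c i < c (Suc i)" and i: "i \<in> {1..m}"
  shows "cell_rank (c ` {1..m}) (c i) = i"
proof -
  have "{l' \<in> c ` {1..m}. l' \<le> c i} = c ` {1..i}"
  proof (intro equalityI subsetI)
    fix l assume "l \<in> {l' \<in> c ` {1..m}. l' \<le> c i}"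
    then obtain j where j: "j \<in> {1..m}" "l = c j" "c j \<le> c i" by auto
    have "\<not> i < j" using strict_chain[OF c, of i j] i j by auto
    then show "l \<in> c ` {1..i}" using j by auto
  next
    fix l assume "l \<in> c ` {1..i}"
    then obtain j where j: "j \<in> {1..i}" "l = c j" by auto
    have "c j \<le> c i" using strict_chain[OF c, of j i] i j by (cases "j = i") auto
    then show "l \<in> {l' \<in> c ` {1..m}. l' \<le> c i}" using i j by auto
  qed
  moreover have "inj_on c {1..i}" using inj_on_strict_chain[OF c] i by (auto intro: inj_on_subset)
  ultimately show ?thesis by (simp add: cell_rank_def card_image)
qed

context poisson_atoms begin

text \<open>The comparison extends to arrival m + 1: otherwise the slab of point m could hold
  further points.\<close>

definition ordered :: "nat \<Rightarrow> nat \<Rightarrow> 'a \<Rightarrow> bool" where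
  "ordered k m \<omega> \<longleftrightarrow> (\<forall>i\<in>{1..m}. cell k (\<tau> i \<omega>) < cell k (\<tau> (Suc i) \<omega>))"

definition cells :: "nat \<Rightarrow> nat \<Rightarrow> 'a \<Rightarrow> nat set" where
  "cells k m \<omega> = (\<lambda>i. cell k (\<tau> i \<omega>)) ` {1..m}"

definition marked :: "nat \<Rightarrow> nat \<Rightarrow> nat set \<Rightarrow> (nat \<Rightarrow> (real \<times> real) set) \<Rightarrow> 'a set" where
  "marked k m T C = {\<omega>\<in>space P. ordered k m \<omega> \<and> cells k m \<omega> = T \<and> (\<forall>i\<in>{1..m}. p i \<omega> \<in> C i)}"

lemma slab_mem: "good \<omega> \<Longrightarrow> (\<tau> i \<omega>, p i \<omega>) \<in> slab k l \<times> D \<longleftrightarrow> cell k (\<tau> i \<omega>) = l \<and> p i \<omega> \<in> D"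
  using slab_iff_cell[OF good_\<tau>_nonneg] by simp

text \<open>If the grid separates the first \<open>m + 1\<close> arrival times, then prescribing the slabs and the
  regions of the first \<open>m\<close> points means prescribing the numbers of points in disjoint sets.\<close>

lemma marked_imp_slab_event:
  assumes g: "good \<omega>" and m: "m \<ge> 1" and w: "\<omega> \<in> marked k m T C"
  shows "\<omega> \<in> slab_event k T (Suc (Max T)) (\<lambda>l. C (cell_rank T l))"
proof -
  define c where "c i = cell k (\<tau> i \<omega>)" for i
  have ord: "\<forall>i\<in>{1..m}. c i < c (Suc i)" and T: "T = c ` {1..m}" and C: "\<And>i. i \<in> {1..m} \<Longrightarrow> p i \<omega> \<in> C i"
    using w by (auto simp: marked_def ordered_def cells_def c_def)
  have mono: "c i \<le> c j" if "i \<le> j" for i j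
    unfolding c_def by (intro cell_mono good_\<tau>_mono[OF g that])
  have Max: "Max T = c m" unfolding T using m by (intro Max_eqI) (auto intro: mono)
  have le: "i \<le> m" if "c i \<le> Max T" for i
  proof (rule ccontr)
    assume "\<not> i \<le> m"
    then have "c (Suc m) \<le> c i" by (intro mono) simp
    moreover have "c m < c (Suc m)" using ord m by simp
    ultimately show False using that by (simp add: Max)
  qed
  have rk: "cell_rank T (c i) = i" if "i \<in> {1..m}" for i
    unfolding T by (rule rank_strict_chain[OF ord that])
  have "point_count \<Phi> (slab k l \<times> C (cell_rank T l)) \<omega> = of_nat (of_bool (l \<in> T)) \<and>
      point_count \<Phi> (slab k l \<times> (unit_square - C (cell_rank T l))) \<omega> = of_nat 0" if l: "l < Suc (Max T)" for l
  proof
    show "point_count \<Phi> (slab k l \<times> (unit_square - C (cell_rank T l))) \<omega> = of_nat 0"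
      unfolding point_count_eq_0[OF g] slab_mem[OF g]
    proof (intro allI impI notI)
      fix i assume i: "1 \<le> i" "cell k (\<tau> i \<omega>) = l \<and> p i \<omega> \<in> unit_square - C (cell_rank T l)"
      then have "i \<in> {1..m}" using le[of i] l by (simp add: c_def)
      then show False using C[of i] rk[of i] i by (auto simp: c_def)
    qed
    show "point_count \<Phi> (slab k l \<times> C (cell_rank T l)) \<omega> = of_nat (of_bool (l \<in> T))"
    proof (cases "l \<in> T")
      case True
      then obtain i0 where i0: "i0 \<in> {1..m}" "l = c i0" by (auto simp: T)
      have "{i. 1 \<le> i \<and> cell k (\<tau> i \<omega>) = l \<and> p i \<omega> \<in> C (cell_rank T l)} = {i0}"
      proof (intro equalityI subsetI)
        fix i assume "i \<in> {i. 1 \<le> i \<and> cell k (\<tau> i \<omega>) = l \<and> p i \<omega> \<in> C (cell_rank T l)}"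
        then have i: "1 \<le> i" "c i = c i0" by (auto simp: c_def i0)
        then have "i \<in> {1..m}" using le[of i] l i0 by simp
        then show "i \<in> {i0}" using inj_on_strict_chain[OF ord] i i0 by (auto dest: inj_onD)
      qed (use i0 C[OF i0(1)] rk[OF i0(1)] in \<open>auto simp: c_def\<close>)
      then have "{i. 1 \<le> i \<and> (\<tau> i \<omega>, p i \<omega>) \<in> slab k l \<times> C (cell_rank T l)} = {i0}"
        unfolding slab_mem[OF g] .
      then show ?thesis using True unfolding point_count_eq_card[OF g] by simp
    next
      case False
      have "\<not> (cell k (\<tau> i \<omega>) = l)" if "1 \<le> i" for i
        using le[of i] l that False by (auto simp: c_def T)
      then have "point_count \<Phi> (slab k l \<times> C (cell_rank T l)) \<omega> = of_nat 0"
        unfolding point_count_eq_0[OF g] slab_mem[OF g] by blast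
      then show ?thesis using False by simp
    qed
  qed
  then show ?thesis using w by (auto simp: slab_event_def marked_def)
qed

text \<open>Let A be the set of indices of the points up to the last slab of T. Each slab of T holds
  exactly one of them and the others none, so A has m elements; being closed downwards it is
  \<open>{1..m}\<close>, and the ranks return the indices.\<close>

lemma slab_event_imp_marked:
  assumes g: "good \<omega>" and T: "finite T" "card T = m" and m: "m \<ge> 1"
    and w: "\<omega> \<in> slab_event k T (Suc (Max T)) (\<lambda>l. C (cell_rank T l))"
  shows "\<omega> \<in> marked k m T C"
proof -
  define c where "c i = cell k (\<tau> i \<omega>)" for i
  define J where "J = Max T"
  define A where "A = {i. 1 \<le> i \<and> c i \<le> J}"
  have mono: "c i \<le> c j" if "i \<le> j" for i j
    unfolding c_def by (intro cell_mono good_\<tau>_mono[OF g that])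
  have TJ: "l \<le> J" if "l \<in> T" for l unfolding J_def using T that by (intro Max_ge)
  have 1: "point_count \<Phi> (slab k l \<times> C (cell_rank T l)) \<omega> = of_nat (of_bool (l \<in> T))"
    and 2: "\<And>i. 1 \<le> i \<Longrightarrow> c i = l \<Longrightarrow> p i \<omega> \<in> C (cell_rank T l)" if "l \<le> J" for l
  proof -
    show "point_count \<Phi> (slab k l \<times> C (cell_rank T l)) \<omega> = of_nat (of_bool (l \<in> T))"
      using w that by (auto simp: slab_event_def J_def)
    have "point_count \<Phi> (slab k l \<times> (unit_square - C (cell_rank T l))) \<omega> = of_nat 0"
      using w that by (auto simp: slab_event_def J_def)
    then have "\<forall>i\<ge>1. \<not> (c i = l \<and> p i \<omega> \<in> unit_square - C (cell_rank T l))"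
      unfolding point_count_eq_0[OF g] slab_mem[OF g] c_def .
    then show "p i \<omega> \<in> C (cell_rank T l)" if "1 \<le> i" "c i = l" for i
      using that g by (auto simp: good_def)
  qed
  have one: "\<exists>i0. {i. 1 \<le> i \<and> c i = l} = {i0}" if "l \<in> T" for l
  proof -
    have "{i. 1 \<le> i \<and> c i = l} = {i. 1 \<le> i \<and> (\<tau> i \<omega>, p i \<omega>) \<in> slab k l \<times> C (cell_rank T l)}"
      using 2[OF TJ[OF that]] slab_mem[OF g] by (auto simp: c_def)
    moreover have "point_count \<Phi> (slab k l \<times> C (cell_rank T l)) \<omega> = of_nat 1"
      using 1[OF TJ[OF that]] that by simp
    then have "card {i. 1 \<le> i \<and> (\<tau> i \<omega>, p i \<omega>) \<in> slab k l \<times> C (cell_rank T l)} = 1"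
      unfolding point_count_eq_card[OF g] by blast
    ultimately show ?thesis by (simp add: card_1_singleton_iff)
  qed
  \<comment> \<open>In a slab outside T both the region and its complement are free of
    points.\<close>
  have AT: "c i \<in> T" if "i \<in> A" for i
  proof (rule ccontr)
    assume n: "c i \<notin> T"
    have i: "1 \<le> i" "c i \<le> J" using that by (auto simp: A_def)
    then have "point_count \<Phi> (slab k (c i) \<times> C (cell_rank T (c i))) \<omega> = of_nat 0" using 1[of "c i"] n by simp
    then have "\<not> (c i = c i \<and> p i \<omega> \<in> C (cell_rank T (c i)))"
      unfolding point_count_eq_0[OF g] slab_mem[OF g] using i by (simp add: c_def)
    then show False using 2[OF i(2) i(1)] by simp
  qed
  have inj: "inj_on c A"
  proof (rule inj_onI)
    fix i j assume ij: "i \<in> A" "j \<in> A" "c i = c j"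
    obtain i0 where i0: "{i'. 1 \<le> i' \<and> c i' = c i} = {i0}" using one[OF AT[OF ij(1)]] by blast
    have "i \<in> {i'. 1 \<le> i' \<and> c i' = c i}" "j \<in> {i'. 1 \<le> i' \<and> c i' = c i}"
      using ij by (auto simp: A_def)
    then show "i = j" unfolding i0 by simp
  qed
  have "c ` A = T"
  proof
    show "c ` A \<subseteq> T" using AT by blast
    show "T \<subseteq> c ` A"
    proof
      fix l assume l: "l \<in> T"
      then obtain i0 where "{i. 1 \<le> i \<and> c i = l} = {i0}" using one by blast
      then have "1 \<le> i0 \<and> c i0 = l" by blast
      then show "l \<in> c ` A" using TJ[OF l] by (auto simp: A_def)
    qed
  qed
  then have fA: "finite A" and cA: "card A = m"
    using T inj by (auto dest: finite_imageD card_image)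
  have "A = {1..card A}"
  proof (rule down_closed_initial_segment[OF fA])
    show "1 \<le> i" if "i \<in> A" for i using that by (simp add: A_def)
    show "j \<in> A" if "i \<in> A" "1 \<le> j" "j \<le> i" for i j
      using mono[of j i] that by (auto simp: A_def)
  qed
  then have Am: "A = {1..m}" unfolding cA .
  have ord: "\<forall>i\<in>{1..m}. c i < c (Suc i)"
  proof
    fix i assume i: "i \<in> {1..m}"
    show "c i < c (Suc i)"
    proof (cases "Suc i \<in> A")
      case True
      then have "c i \<noteq> c (Suc i)" using inj i Am by (auto dest: inj_onD)
      then show ?thesis using mono[of i "Suc i"] by simp
    next
      case False
      then have "J < c (Suc i)" by (simp add: A_def)
      moreover have "i \<in> A" using i unfolding Am .
      then have "c i \<le> J" by (simp add: A_def)
      ultimately show ?thesis by simp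
    qed
  qed
  have Teq: "T = c ` {1..m}" using \<open>c ` A = T\<close> Am by simp
  have "p i \<omega> \<in> C i" if "i \<in> {1..m}" for i
  proof -
    have "i \<in> A" using that Am by simp
    then have "p i \<omega> \<in> C (cell_rank T (c i))" using 2[of "c i" i] by (auto simp: A_def)
    then show ?thesis unfolding Teq rank_strict_chain[OF ord that] .
  qed
  then show ?thesis
    using ord Teq w by (auto simp: marked_def ordered_def cells_def c_def slab_event_def)
qed

lemma cell_measurable [measurable]: "(\<lambda>\<omega>. cell k (\<tau> i \<omega>)) \<in> P \<rightarrow>\<^sub>M count_space UNIV"
  unfolding cell_def by measurable

lemma cell_borel_measurable [measurable]: "(\<lambda>\<omega>. cell k (\<tau> i \<omega>)) \<in> borel_measurable P"
proof -
  have m: "borel_measurable P = P \<rightarrow>\<^sub>M (count_space UNIV :: nat measure)"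
    by (rule measurable_cong_sets) (simp_all add: sets_borel_eq_count_space)
  show ?thesis unfolding m by (rule cell_measurable)
qed

lemma ordered_measurable [measurable]: "Measurable.pred P (ordered k m)"
  unfolding ordered_def[abs_def] by measurable

lemma marked_sets:
  assumes [measurable]: "\<And>i. C i \<in> sets borel"
  shows "marked k m T C \<in> sets P"
proof -
  have c: "cells k m \<omega> = T \<longleftrightarrow> (\<forall>i\<in>{1..m}. \<exists>l\<in>T. cell k (\<tau> i \<omega>) = l) \<and> (\<forall>l\<in>T. \<exists>i\<in>{1..m}. cell k (\<tau> i \<omega>) = l)" for \<omega>
    by (auto simp: cells_def)
  have eq: "marked k m T C = {\<omega>\<in>space P. ordered k m \<omega> \<and> (\<forall>i\<in>{1..m}. \<exists>l\<in>T. cell k (\<tau> i \<omega>) = l) \<and>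
      (\<forall>l\<in>T. \<exists>i\<in>{1..m}. cell k (\<tau> i \<omega>) = l) \<and> (\<forall>i\<in>{1..m}. p i \<omega> \<in> C i)}"
    unfolding marked_def c by (simp only: conj_assoc)
  show ?thesis unfolding eq by measurable
qed

text \<open>The slab factors are the same for all choices of regions, and the ranks match the slabs
  of T with the indices 1 to m.\<close>

lemma prob_marked:
  assumes C: "\<And>i. C i \<in> sets borel" "\<And>i. C i \<subseteq> unit_square" and T: "finite T" "card T = m" and m: "m \<ge> 1"
  shows "emeasure P (marked k m T C) = ennreal (\<Prod>i\<in>{1..m}. measure unif (C i)) * emeasure P (marked k m T (\<lambda>_. unit_square))"
proof -
  define J where "J = Max T"
  have TJ: "T \<subseteq> {..<Suc J}" using T by (auto simp: J_def less_Suc_eq_le)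
  have eq: "emeasure P (marked k m T D) = prob (slab_event k T (Suc J) (\<lambda>l. D (cell_rank T l)))"
    if "\<And>i. D i \<in> sets borel" "\<And>i. D i \<subseteq> unit_square" for D
  proof -
    have "AE \<omega> in P. \<omega> \<in> marked k m T D \<longleftrightarrow> \<omega> \<in> slab_event k T (Suc J) (\<lambda>l. D (cell_rank T l))"
      using AE_good unfolding J_def
      by eventually_elim (use marked_imp_slab_event slab_event_imp_marked T m in blast)
    then have "emeasure P (marked k m T D) = emeasure P (slab_event k T (Suc J) (\<lambda>l. D (cell_rank T l)))"
      using that T by (intro emeasure_eq_AE marked_sets slab_event_prob(2)) auto
    then show ?thesis by (simp add: emeasure_eq_measure)
  qed
  define e where "e l = (if l \<in> T then 1 / real (Suc k) else 1) * exp (- 1 / real (Suc k))" for l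
  have pr: "prob (slab_event k T (Suc J) (\<lambda>l. D (cell_rank T l))) = (\<Prod>i\<in>{1..m}. measure unif (D i)) * (\<Prod>l<Suc J. e l)"
    if D: "\<And>i. D i \<in> sets borel" "\<And>i. D i \<subseteq> unit_square" for D
  proof -
    have "prob (slab_event k T (Suc J) (\<lambda>l. D (cell_rank T l))) =
      (\<Prod>l<Suc J. (if l \<in> T then measure unif (D (cell_rank T l)) / real (Suc k) else 1) * exp (- 1 / real (Suc k)))"
      using D by (intro slab_event_prob(1)) auto
    also have "\<dots> = (\<Prod>l<Suc J. (if l \<in> T then measure unif (D (cell_rank T l)) else 1) * e l)"
      by (intro prod.cong refl) (simp add: e_def)
    also have "\<dots> = (\<Prod>l<Suc J. if l \<in> T then measure unif (D (cell_rank T l)) else 1) * (\<Prod>l<Suc J. e l)"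
      by (rule prod.distrib)
    also have "(\<Prod>l<Suc J. if l \<in> T then measure unif (D (cell_rank T l)) else 1) = (\<Prod>l\<in>T. measure unif (D (cell_rank T l)))"
      using TJ by (intro prod.mono_neutral_cong_right) auto
    also have "\<dots> = (\<Prod>i\<in>{1..m}. measure unif (D i))"
      using prod.reindex_bij_betw[OF bij_betw_rank[OF T(1)], of "\<lambda>i. measure unif (D i)"] T(2) by simp
    finally show ?thesis .
  qed
  have u: "measure unif unit_square = 1" by (simp add: measure_def emeasure_unif emeasure_unit_square)
  define E where "E = (\<Prod>l<Suc J. e l)"
  have 1: "emeasure P (marked k m T C) = ennreal ((\<Prod>i\<in>{1..m}. measure unif (C i)) * E)"
    using eq[of C] pr[of C] C by (simp only: E_def)
  have 2: "emeasure P (marked k m T (\<lambda>_. unit_square)) = ennreal E"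
    using eq[of "\<lambda>_. unit_square"] pr[of "\<lambda>_. unit_square"] by (simp add: E_def u)
  show ?thesis unfolding 1 2 by (rule ennreal_mult') (simp add: prod_nonneg)
qed

text \<open>Decomposes by the set of occupied slabs: there are countably many finite sets of size m,
  and on each of them the regions factor out with the same product.\<close>

lemma prob_ordered_marked:
  fixes k :: nat and D :: "nat set set"
  assumes C: "\<And>i. C i \<in> sets borel" "\<And>i. C i \<subseteq> unit_square" and m: "m \<ge> 1"
  defines "E \<equiv> \<lambda>C. {\<omega>\<in>space P. ordered k m \<omega> \<and> cells k m \<omega> \<in> D \<and> (\<forall>i\<in>{1..m}. p i \<omega> \<in> C i)}"
  shows "prob (E C) = (\<Prod>i\<in>{1..m}. measure unif (C i)) * prob (E (\<lambda>_. unit_square))"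
    "E C \<in> sets P"
proof -
  define I where "I = {T \<in> D. finite T \<and> card T = m}"
  have I: "countable I" by (rule countable_subset[OF _ countable_Collect_finite]) (auto simp: I_def)
  have un: "E C = (\<Union>T\<in>I. marked k m T C)" for C
  proof -
    have "card (cells k m \<omega>) = m" if "ordered k m \<omega>" for \<omega>
      unfolding cells_def using inj_on_strict_chain[of m "\<lambda>i. cell k (\<tau> i \<omega>)"] that
      by (simp add: ordered_def card_image)
    then show ?thesis unfolding E_def marked_def I_def by (auto simp: cells_def)
  qed
  have em: "emeasure P (E C) = (\<integral>\<^sup>+T. emeasure P (marked k m T C) \<partial>count_space I)" if "\<And>i. C i \<in> sets borel" for C
    unfolding un using that I
    by (intro emeasure_UN_countable marked_sets) (auto simp: I_def disjoint_family_on_def marked_def)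
  have "emeasure P (E C) = (\<integral>\<^sup>+T. ennreal (\<Prod>i\<in>{1..m}. measure unif (C i)) * emeasure P (marked k m T (\<lambda>_. unit_square)) \<partial>count_space I)"
    unfolding em[OF C(1)]
  proof (rule nn_integral_cong)
    fix T assume "T \<in> space (count_space I)"
    then have "finite T" "card T = m" by (simp_all add: I_def)
    then show "emeasure P (marked k m T C) = ennreal (\<Prod>i\<in>{1..m}. measure unif (C i)) * emeasure P (marked k m T (\<lambda>_. unit_square))"
      by (intro prob_marked C m)
  qed
  also have "\<dots> = ennreal (\<Prod>i\<in>{1..m}. measure unif (C i)) * emeasure P (E (\<lambda>_. unit_square))"
    unfolding em[OF unit_square_borel] by (rule nn_integral_cmult) simp
  finally show "prob (E C) = (\<Prod>i\<in>{1..m}. measure unif (C i)) * prob (E (\<lambda>_. unit_square))"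
    by (simp add: emeasure_eq_measure ennreal_mult'[symmetric] prod_nonneg)
  show "E C \<in> sets P"
    unfolding un by (rule sets.countable_UN'[OF I]) (intro image_subsetI marked_sets C(1))
qed

end

section \<open>Independence of times and positions\<close>

lemma eventually_cell_strict:
  assumes "0 \<le> s" "s < t"
  shows "\<forall>\<^sub>F k in sequentially. cell k s < cell k t"
proof -
  obtain K where K: "inverse (real (Suc K)) < t - s" using reals_Archimedean[of "t - s"] assms by auto
  have "cell k s < cell k t" if "k \<ge> K" for k
  proof -
    have "1 < (t - s) * real (Suc K)" using K by (simp add: field_simps)
    also have "\<dots> \<le> (t - s) * real (Suc k)" using that assms by (intro mult_left_mono) auto
    finally have "s * real (Suc k) + 1 \<le> t * real (Suc k)" by (simp add: algebra_simps)
    then have "\<lfloor>s * real (Suc k) + 1\<rfloor> \<le> \<lfloor>t * real (Suc k)\<rfloor>" by (rule floor_mono)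
    then have "\<lfloor>s * real (Suc k)\<rfloor> + 1 \<le> \<lfloor>t * real (Suc k)\<rfloor>" by simp
    moreover have "0 \<le> \<lfloor>s * real (Suc k)\<rfloor>" using assms by simp
    ultimately show ?thesis unfolding cell_def by linarith
  qed
  then show ?thesis by (auto simp: eventually_sequentially)
qed

text \<open>The right end of the slab of s lies strictly above s, by at most one mesh width; this is
  why the limit condition is a strict inequality.\<close>

lemma eventually_cell_le_iff:
  assumes "0 \<le> s"
  shows "\<forall>\<^sub>F k in sequentially. real (Suc (cell k s)) / real (Suc k) \<le> t \<longleftrightarrow> s < t"
proof -
  have c: "real (cell k s) \<le> s * real (Suc k)" "s * real (Suc k) < real (Suc (cell k s))" for k
  proof -
    have "0 \<le> \<lfloor>s * real (Suc k)\<rfloor>" using assms by simp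
    then have "real (cell k s) = real_of_int \<lfloor>s * real (Suc k)\<rfloor>" by (simp add: cell_def)
    then show "real (cell k s) \<le> s * real (Suc k)" "s * real (Suc k) < real (Suc (cell k s))"
      by linarith+
  qed
  show ?thesis
  proof (cases "s < t")
    case True
    obtain K where K: "inverse (real (Suc K)) < t - s" using reals_Archimedean[of "t - s"] True by auto
    have "real (Suc (cell k s)) / real (Suc k) \<le> t" if "k \<ge> K" for k
    proof -
      have "1 < (t - s) * real (Suc K)" using K by (simp add: field_simps)
      also have "\<dots> \<le> (t - s) * real (Suc k)" using that True by (intro mult_left_mono) auto
      finally have "real (Suc (cell k s)) \<le> t * real (Suc k)" using c(1)[of k] by (simp add: algebra_simps)
      then show ?thesis by (simp add: pos_divide_le_eq del: of_nat_Suc)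
    qed
    then show ?thesis using True by (auto simp: eventually_sequentially)
  next
    case False
    have "\<not> real (Suc (cell k s)) / real (Suc k) \<le> t" for k
    proof
      assume "real (Suc (cell k s)) / real (Suc k) \<le> t"
      then have "real (Suc (cell k s)) \<le> t * real (Suc k)" by (simp add: pos_divide_le_eq del: of_nat_Suc)
      also have "\<dots> \<le> s * real (Suc k)" using False by (intro mult_right_mono) auto
      finally show False using c(2)[of k] by simp
    qed
    then show ?thesis using False by simp
  qed
qed

context poisson_atoms begin

text \<open>Limit of the grid statement: almost surely the grid eventually separates the first m + 1
  arrivals and decides each \<open>\<tau> i \<omega> < t i\<close>, so the indicators converge and
  dominated convergence applies.\<close>

lemma joint_law_square:
  fixes t :: "nat \<Rightarrow> real" and m1 :: nat
  assumes C: "\<And>i. C i \<in> sets borel" "\<And>i. C i \<subseteq> unit_square" and m: "m \<ge> 1"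
  defines "E \<equiv> \<lambda>C. {\<omega>\<in>space P. (\<forall>i\<in>{1..m}. i \<le> m1 \<longrightarrow> \<tau> i \<omega> < t i) \<and> (\<forall>i\<in>{1..m}. p i \<omega> \<in> C i)}"
  shows "prob (E C) = (\<Prod>i\<in>{1..m}. measure unif (C i)) * prob (E (\<lambda>_. unit_square))"
proof -
  \<comment> \<open>The time constraints in terms of the set of occupied slabs alone: the point in
    slab l has index \<open>cell_rank T l\<close>, and the slab must end no later than the time
    prescribed for that index.\<close>
  define D where "D k = {T. \<forall>l\<in>T. cell_rank T l \<le> m1 \<longrightarrow> real (Suc l) / real (Suc k) \<le> t (cell_rank T l)}" for k
  define F where "F k C = {\<omega>\<in>space P. ordered k m \<omega> \<and> cells k m \<omega> \<in> D k \<and> (\<forall>i\<in>{1..m}. p i \<omega> \<in> C i)}" for k C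
  have D: "cells k m \<omega> \<in> D k \<longleftrightarrow> (\<forall>i\<in>{1..m}. i \<le> m1 \<longrightarrow> real (Suc (cell k (\<tau> i \<omega>))) / real (Suc k) \<le> t i)"
    if "ordered k m \<omega>" for k \<omega>
    using rank_strict_chain[of m "\<lambda>i. cell k (\<tau> i \<omega>)"] that
    by (auto simp: D_def cells_def ordered_def)
  have lim: "(\<lambda>k. prob (F k C)) \<longlonglongrightarrow> prob (E C)" if C: "\<And>i. C i \<in> sets borel" "\<And>i. C i \<subseteq> unit_square" for C
  proof -
    have [measurable]: "F k C \<in> sets P" for k
      unfolding F_def using C m by (intro prob_ordered_marked(2))
    note [measurable] = C(1)
    have [measurable]: "E C \<in> sets P" unfolding E_def by measurable
    have "(\<lambda>k. expectation (indicat_real (F k C))) \<longlonglongrightarrow> expectation (indicat_real (E C))"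
    proof (rule integral_dominated_convergence[where w = "\<lambda>_. 1"])
      show "AE \<omega> in P. (\<lambda>k. indicat_real (F k C) \<omega>) \<longlonglongrightarrow> indicator (E C) \<omega>"
        using AE_good
      proof eventually_elim
        case (elim \<omega>)
        have "\<forall>\<^sub>F k in sequentially. ordered k m \<omega>"
          unfolding ordered_def
          by (intro eventually_ball_finite ballI eventually_cell_strict good_\<tau>_nonneg good_\<tau>_strict elim) auto
        moreover have "\<forall>\<^sub>F k in sequentially. \<forall>i\<in>{1..m}. real (Suc (cell k (\<tau> i \<omega>))) / real (Suc k) \<le> t i \<longleftrightarrow> \<tau> i \<omega> < t i"
          by (intro eventually_ball_finite ballI eventually_cell_le_iff good_\<tau>_nonneg elim) auto
        ultimately have "\<forall>\<^sub>F k in sequentially. indicat_real (F k C) \<omega> = indicator (E C) \<omega>"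
        proof eventually_elim
          case (elim k)
          have "\<omega> \<in> F k C \<longleftrightarrow> \<omega> \<in> E C"
            using elim D[OF elim(1)] by (auto simp: F_def E_def)
          then show ?case by (simp add: indicator_def)
        qed
        then show ?case by (rule tendsto_eventually)
      qed
    qed (auto simp: indicator_def)
    then show ?thesis by simp
  qed
  have "prob (F k C) = (\<Prod>i\<in>{1..m}. measure unif (C i)) * prob (F k (\<lambda>_. unit_square))" for k
    unfolding F_def using C m by (intro prob_ordered_marked(1))
  moreover have "(\<lambda>k. (\<Prod>i\<in>{1..m}. measure unif (C i)) * prob (F k (\<lambda>_. unit_square))) \<longlonglongrightarrow>
      (\<Prod>i\<in>{1..m}. measure unif (C i)) * prob (E (\<lambda>_. unit_square))"
    by (intro tendsto_mult tendsto_const lim) auto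
  ultimately have "(\<lambda>k. prob (F k C)) \<longlonglongrightarrow> (\<Prod>i\<in>{1..m}. measure unif (C i)) * prob (E (\<lambda>_. unit_square))"
    by simp
  then show ?thesis using LIMSEQ_unique[OF lim[OF C]] by simp
qed

lemma measure_unif_Int: "C \<in> sets borel \<Longrightarrow> measure unif (C \<inter> unit_square) = measure unif C"
  by (simp add: measure_def emeasure_unif Int_assoc)

lemma joint_law:
  assumes C: "\<And>i. C i \<in> sets borel" and m: "m \<ge> 1" "m1 \<le> m"
  shows "prob {\<omega>\<in>space P. (\<forall>i\<in>{1..m1}. \<tau> i \<omega> < t i) \<and> (\<forall>i\<in>{1..m}. p i \<omega> \<in> C i)} =
    (\<Prod>i\<in>{1..m}. measure unif (C i)) * prob {\<omega>\<in>space P. \<forall>i\<in>{1..m1}. \<tau> i \<omega> < t i}"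
proof -
  note [measurable] = C
  let ?E = "\<lambda>C. {\<omega>\<in>space P. (\<forall>i\<in>{1..m}. i \<le> m1 \<longrightarrow> \<tau> i \<omega> < t i) \<and> (\<forall>i\<in>{1..m}. p i \<omega> \<in> C i)}"
  have "prob {\<omega>\<in>space P. (\<forall>i\<in>{1..m1}. \<tau> i \<omega> < t i) \<and> (\<forall>i\<in>{1..m}. p i \<omega> \<in> C i)} = prob (?E (\<lambda>i. C i \<inter> unit_square))"
  proof (rule measure_eq_AE)
    show "AE \<omega> in P. \<omega> \<in> {\<omega>\<in>space P. (\<forall>i\<in>{1..m1}. \<tau> i \<omega> < t i) \<and> (\<forall>i\<in>{1..m}. p i \<omega> \<in> C i)} \<longleftrightarrow>
       \<omega> \<in> ?E (\<lambda>i. C i \<inter> unit_square)"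
      using AE_good by eventually_elim (use m in \<open>auto simp: good_def\<close>)
  qed measurable
  also have "\<dots> = (\<Prod>i\<in>{1..m}. measure unif (C i \<inter> unit_square)) * prob (?E (\<lambda>_. unit_square))"
    by (rule joint_law_square) (use m in auto)
  also have "prob (?E (\<lambda>_. unit_square)) = prob {\<omega>\<in>space P. \<forall>i\<in>{1..m1}. \<tau> i \<omega> < t i}"
  proof (rule measure_eq_AE)
    show "AE \<omega> in P. \<omega> \<in> ?E (\<lambda>_. unit_square) \<longleftrightarrow> \<omega> \<in> {\<omega>\<in>space P. \<forall>i\<in>{1..m1}. \<tau> i \<omega> < t i}"
      using AE_good by eventually_elim (use m in \<open>auto simp: good_def\<close>)
  qed measurable
  finally show ?thesis using C by (simp add: measure_unif_Int)
qed

section \<open>A filtration with all times and the first n positions\<close>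

definition past_gen :: "nat \<Rightarrow> 'a set set" where
  "past_gen n = {{\<omega>\<in>space P. (\<forall>i\<in>{1..m}. \<tau> i \<omega> < t i) \<and> (\<forall>i\<in>{1..n}. p i \<omega> \<in> C i)} | m t C. \<forall>i. C i \<in> sets borel}"

text \<open>All arrival times are included, also the future ones: only the positions are revealed
  step by step.\<close>

definition past :: "nat \<Rightarrow> 'a measure" where
  "past n = sigma (space P) (past_gen n)"

lemma past_genI:
  "(\<And>i. C i \<in> sets borel) \<Longrightarrow> A = {\<omega>\<in>space P. (\<forall>i\<in>{1..m}. \<tau> i \<omega> < t i) \<and> (\<forall>i\<in>{1..n}. p i \<omega> \<in> C i)} \<Longrightarrow> A \<in> past_gen n"
  unfolding past_gen_def by blast

lemma past_gen_sets: "past_gen n \<subseteq> sets P"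
proof
  fix A assume "A \<in> past_gen n"
  then obtain m t C where [measurable]: "\<And>i. C i \<in> sets borel"
    and A: "A = {\<omega>\<in>space P. (\<forall>i\<in>{1..m}. \<tau> i \<omega> < t i) \<and> (\<forall>i\<in>{1..n}. p i \<omega> \<in> C i)}"
    unfolding past_gen_def by blast
  show "A \<in> sets P" unfolding A by measurable
qed

lemma past_gen_Pow: "past_gen n \<subseteq> Pow (space P)"
  using past_gen_sets sets.sets_into_space by blast

lemma space_past: "space (past n) = space P"
  unfolding past_def using past_gen_Pow by (rule space_measure_of)

lemma sets_past: "sets (past n) = sigma_sets (space P) (past_gen n)"
  unfolding past_def using past_gen_Pow by (rule sets_measure_of)

lemma past_gen_in_past: "A \<in> past_gen n \<Longrightarrow> A \<in> sets (past n)"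
  unfolding sets_past by (rule sigma_sets.Basic)

lemma past_subalgebra: "subalgebra P (past n)"
  unfolding subalgebra_def space_past sets_past
  using sets.sigma_sets_subset[OF past_gen_sets] by simp

lemma past_mono: "sets (past n) \<subseteq> sets (past (Suc n))"
  unfolding sets_past
proof (rule sigma_sets_mono')
  show "past_gen n \<subseteq> past_gen (Suc n)"
  proof
    fix A assume "A \<in> past_gen n"
    then obtain m t C where C: "\<And>i. C i \<in> sets borel"
      and A: "A = {\<omega>\<in>space P. (\<forall>i\<in>{1..m}. \<tau> i \<omega> < t i) \<and> (\<forall>i\<in>{1..n}. p i \<omega> \<in> C i)}"
      unfolding past_gen_def by blast
    show "A \<in> past_gen (Suc n)"
      by (rule past_genI[of "\<lambda>i. if i \<le> n then C i else UNIV" _ m t]) (use C in \<open>auto simp: A\<close>)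
  qed
qed

lemma past_gen_Int_stable: "Int_stable (past_gen n)"
proof (rule Int_stableI)
  fix A B assume "A \<in> past_gen n" "B \<in> past_gen n"
  then obtain m t C m' t' C' where C: "\<And>i. C i \<in> sets borel" "\<And>i. C' i \<in> sets borel"
    and A: "A = {\<omega>\<in>space P. (\<forall>i\<in>{1..m}. \<tau> i \<omega> < t i) \<and> (\<forall>i\<in>{1..n}. p i \<omega> \<in> C i)}"
    and B: "B = {\<omega>\<in>space P. (\<forall>i\<in>{1..m'}. \<tau> i \<omega> < t' i) \<and> (\<forall>i\<in>{1..n}. p i \<omega> \<in> C' i)}"
    unfolding past_gen_def by blast
  have "(\<forall>i\<in>{1..max m m'}. \<tau> i \<omega> < (if i \<le> m then if i \<le> m' then min (t i) (t' i) else t i else t' i)) \<longleftrightarrow>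
     (\<forall>i\<in>{1..m}. \<tau> i \<omega> < t i) \<and> (\<forall>i\<in>{1..m'}. \<tau> i \<omega> < t' i)" for \<omega>
  proof -
    have "(\<forall>i\<in>{1..max m m'}. \<tau> i \<omega> < (if i \<le> m then if i \<le> m' then min (t i) (t' i) else t i else t' i)) \<longleftrightarrow>
     (\<forall>i\<in>{1..max m m'}. (i \<le> m \<longrightarrow> \<tau> i \<omega> < t i) \<and> (i \<le> m' \<longrightarrow> \<tau> i \<omega> < t' i))"
      by (intro ball_cong refl) auto
    also have "\<dots> \<longleftrightarrow> (\<forall>i\<in>{1..m}. \<tau> i \<omega> < t i) \<and> (\<forall>i\<in>{1..m'}. \<tau> i \<omega> < t' i)" by auto
    finally show ?thesis .
  qed
  then have "A \<inter> B = {\<omega>\<in>space P. (\<forall>i\<in>{1..max m m'}. \<tau> i \<omega> < (if i \<le> m then if i \<le> m' then min (t i) (t' i) else t i else t' i)) \<and>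
     (\<forall>i\<in>{1..n}. p i \<omega> \<in> C i \<inter> C' i)}"
    unfolding A B by blast
  then show "A \<inter> B \<in> past_gen n"
    by (rule past_genI[rotated]) (use C in auto)
qed

lemma past_indep_gen:
  assumes A: "A \<in> past_gen n" and D: "D \<in> sets borel"
  shows "prob (A \<inter> p (Suc n) -` D) = prob A * measure unif D"
proof -
  obtain m t C where C: "\<And>i. C i \<in> sets borel"
    and A: "A = {\<omega>\<in>space P. (\<forall>i\<in>{1..m}. \<tau> i \<omega> < t i) \<and> (\<forall>i\<in>{1..n}. p i \<omega> \<in> C i)}"
    using A unfolding past_gen_def by blast
  \<comment> \<open>\<open>joint_law\<close> asks for at least as many positions as times; surplus
    positions get the region \<open>UNIV\<close>, of measure 1.\<close>
  define M where "M = max m (Suc n)"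
  define C' where "C' E i = (if i \<le> n then C i else if i = Suc n then E else UNIV)" for E i
  have C': "C' E i \<in> sets borel" if "E \<in> sets borel" for E i using that C by (simp add: C'_def)
  have ball: "(\<forall>i\<in>{1..M}. p i \<omega> \<in> C' E i) \<longleftrightarrow> (\<forall>i\<in>{1..n}. p i \<omega> \<in> C i) \<and> p (Suc n) \<omega> \<in> E" for \<omega> E
    by (auto simp: C'_def M_def)
  have jl: "prob {\<omega>\<in>space P. (\<forall>i\<in>{1..m}. \<tau> i \<omega> < t i) \<and> (\<forall>i\<in>{1..n}. p i \<omega> \<in> C i) \<and> p (Suc n) \<omega> \<in> E} =
     (\<Prod>i\<in>{1..M}. measure unif (C' E i)) * prob {\<omega>\<in>space P. \<forall>i\<in>{1..m}. \<tau> i \<omega> < t i}" if "E \<in> sets borel" for E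
    unfolding ball[symmetric] by (rule joint_law[OF C'[OF that]]) (auto simp: M_def)
  have unif1: "measure unif UNIV = 1" using unif.prob_space by simp
  have pr: "(\<Prod>i\<in>{1..M}. measure unif (C' E i)) = (\<Prod>i\<in>{1..n}. measure unif (C i)) * measure unif E" for E
  proof -
    have "(\<Prod>i\<in>{1..M}. measure unif (C' E i)) = (\<Prod>i\<in>{1..Suc n}. measure unif (C' E i))"
      by (rule prod.mono_neutral_right) (auto simp: M_def C'_def unif1)
    also have "\<dots> = (\<Prod>i\<in>{1..n}. measure unif (C' E i)) * measure unif (C' E (Suc n))"
      by (simp add: atLeastAtMostSuc_conv mult.commute)
    also have "(\<Prod>i\<in>{1..n}. measure unif (C' E i)) = (\<Prod>i\<in>{1..n}. measure unif (C i))"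
      by (intro prod.cong) (auto simp: C'_def)
    finally show ?thesis by (simp add: C'_def)
  qed
  have "A \<inter> p (Suc n) -` D = {\<omega>\<in>space P. (\<forall>i\<in>{1..m}. \<tau> i \<omega> < t i) \<and> (\<forall>i\<in>{1..n}. p i \<omega> \<in> C i) \<and> p (Suc n) \<omega> \<in> D}"
    unfolding A by auto
  moreover have "A = {\<omega>\<in>space P. (\<forall>i\<in>{1..m}. \<tau> i \<omega> < t i) \<and> (\<forall>i\<in>{1..n}. p i \<omega> \<in> C i) \<and> p (Suc n) \<omega> \<in> UNIV}"
    unfolding A by auto
  ultimately show ?thesis using jl[OF D] jl[of UNIV] unfolding pr by (simp add: unif1)
qed

text \<open>Dynkin's argument: the generator is stable under intersections, and the identity passes
  to complements and disjoint unions.\<close>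

lemma past_indep:
  assumes A: "A \<in> sets (past n)" and D: "D \<in> sets borel"
  shows "prob (A \<inter> p (Suc n) -` D) = prob A * measure unif D"
proof -
  have A': "A \<in> sigma_sets (space P) (past_gen n)" using A by (simp add: sets_past)
  have pD: "p (Suc n) -` D \<inter> space P \<in> sets P" using D by (intro measurable_sets[OF p_measurable_P]) auto
  have in_P: "B \<in> sets P" if "B \<in> sigma_sets (space P) (past_gen n)" for B
    using that past_subalgebra[of n] by (auto simp: subalgebra_def sets_past)
  have in_P2: "B \<inter> p (Suc n) -` D \<in> sets P" if "B \<in> sigma_sets (space P) (past_gen n)" for B
  proof -
    have "B \<inter> p (Suc n) -` D = B \<inter> (p (Suc n) -` D \<inter> space P)"
      using sets.sets_into_space[OF in_P[OF that]] by auto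
    then show ?thesis using in_P[OF that] pD by simp
  qed
  have sp: "space P \<in> past_gen n"
    by (rule past_genI[of "\<lambda>_. UNIV" _ 0]) auto
  show ?thesis
  proof (induction rule: sigma_sets_induct_disjoint[OF past_gen_Int_stable past_gen_Pow A', case_names basic empty compl union])
    case (basic A)
    then show ?case by (rule past_indep_gen[OF _ D])
  next
    case empty
    then show ?case by simp
  next
    case (compl A)
    have "(space P - A) \<inter> p (Suc n) -` D = (space P \<inter> p (Suc n) -` D) - (A \<inter> p (Suc n) -` D)" by auto
    also have "prob \<dots> = prob (space P \<inter> p (Suc n) -` D) - prob (A \<inter> p (Suc n) -` D)"
      using sets.sets_into_space[OF in_P[OF compl(1)]]
      by (intro finite_measure_Diff in_P2 sigma_sets_top compl(1)) auto
    also have "\<dots> = prob (space P) * measure unif D - prob A * measure unif D"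
      using past_indep_gen[OF sp D] compl by simp
    also have "\<dots> = prob (space P - A) * measure unif D"
      using in_P[OF compl(1)] by (simp add: prob_compl prob_space algebra_simps)
    finally show ?case .
  next
    case (union F)
    have F: "range F \<subseteq> sets P" "range (\<lambda>i. F i \<inter> p (Suc n) -` D) \<subseteq> sets P"
      using union(2) in_P in_P2 by auto
    have d: "disjoint_family (\<lambda>i. F i \<inter> p (Suc n) -` D)"
      using union(1) by (auto simp: disjoint_family_on_def)
    have "(\<lambda>i. prob (F i) * measure unif D) sums (prob (\<Union>(range F)) * measure unif D)"
      by (intro sums_mult2 finite_measure_UNION F union)
    moreover have "(\<lambda>i. prob (F i \<inter> p (Suc n) -` D)) sums prob (\<Union>i. F i \<inter> p (Suc n) -` D)"
      by (intro finite_measure_UNION F d)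
    moreover have "(\<Union>i. F i \<inter> p (Suc n) -` D) = \<Union>(range F) \<inter> p (Suc n) -` D" by auto
    ultimately show ?case using union(3) by (simp add: sums_unique2)
  qed
qed

lemma p_past_measurable: "1 \<le> i \<Longrightarrow> i \<le> n \<Longrightarrow> p i \<in> past n \<rightarrow>\<^sub>M borel"
proof (rule measurableI)
  fix D :: "(real \<times> real) set" assume i: "1 \<le> i" "i \<le> n" and D: "D \<in> sets borel"
  show "p i -` D \<inter> space (past n) \<in> sets (past n)"
    by (intro past_gen_in_past past_genI[of "\<lambda>j. if j = i then D else UNIV" _ 0])
       (use i D in \<open>auto simp: space_past\<close>)
qed simp

lemma \<tau>_past_measurable:
  assumes "1 \<le> i" shows "\<tau> i \<in> borel_measurable (past n)"
proof (rule borel_measurableI_less)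
  fix s
  \<comment> \<open>A generator bounds all of the first i times at once; the times other than the
    i-th are released by letting the integer bound K run.\<close>
  have "{\<omega> \<in> space (past n). \<tau> i \<omega> < s} =
     (\<Union>K::nat. {\<omega> \<in> space P. (\<forall>j\<in>{1..i}. \<tau> j \<omega> < (if j = i then s else real K)) \<and> (\<forall>j\<in>{1..n}. p j \<omega> \<in> UNIV)})"
  proof (intro equalityI subsetI)
    fix \<omega> assume w: "\<omega> \<in> {\<omega> \<in> space (past n). \<tau> i \<omega> < s}"
    obtain K :: nat where K: "Max ((\<lambda>j. \<tau> j \<omega>) ` {1..i}) < real K" using reals_Archimedean2 by blast
    have "\<tau> j \<omega> < real K" if "j \<in> {1..i}" for j
      using K Max_ge[of "(\<lambda>j. \<tau> j \<omega>) ` {1..i}" "\<tau> j \<omega>"] that by (auto intro: le_less_trans)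
    then show "\<omega> \<in> (\<Union>K::nat. {\<omega> \<in> space P. (\<forall>j\<in>{1..i}. \<tau> j \<omega> < (if j = i then s else real K)) \<and> (\<forall>j\<in>{1..n}. p j \<omega> \<in> UNIV)})"
      using w by (auto simp: space_past intro!: exI[of _ K])
  next
    fix \<omega> assume "\<omega> \<in> (\<Union>K::nat. {\<omega> \<in> space P. (\<forall>j\<in>{1..i}. \<tau> j \<omega> < (if j = i then s else real K)) \<and> (\<forall>j\<in>{1..n}. p j \<omega> \<in> UNIV)})"
    then obtain K :: nat where "\<omega> \<in> space P" "\<forall>j\<in>{1..i}. \<tau> j \<omega> < (if j = i then s else real K)" by blast
    then show "\<omega> \<in> {\<omega> \<in> space (past n). \<tau> i \<omega> < s}" using assms by (auto simp: space_past dest!: bspec[of _ _ i])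
  qed
  also have "\<dots> \<in> sets (past n)"
    by (intro sets.countable_UN image_subsetI past_gen_in_past past_genI[of "\<lambda>_. UNIV", OF _ refl]) simp
  finally show "{\<omega> \<in> space (past n). \<tau> i \<omega> < s} \<in> sets (past n)" .
qed

text \<open>From here on the results on the chain hold for the Poisson positions, with test events
  that may involve any arrival times.\<close>

sublocale uniform_chain P past p
  by unfold_locales (auto intro: past_subalgebra past_indep p_past_measurable subsetD[OF past_mono])

end

section \<open>Continuous time\<close>

context poisson_atoms begin

definition K :: "real \<Rightarrow> 'a \<Rightarrow> nat" where
  "K t \<omega> = card {i. 1 \<le> i \<and> \<tau> i \<omega> \<le> t}"

definition nice :: "'a \<Rightarrow> bool" where
  "nice \<omega> \<longleftrightarrow> good \<omega> \<and> (\<forall>t. finite {i. 1 \<le> i \<and> \<tau> i \<omega> \<le> t})"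

text \<open>The Poisson weights add up to 1, so an infinite count has probability 0.\<close>

lemma AE_point_count_finite:
  assumes "B \<in> sets intensity" "emeasure intensity B = ennreal m" "m \<ge> 0"
  shows "AE \<omega> in P. \<exists>k. point_count \<Phi> B \<omega> = of_nat k"
proof -
  define A where "A k = {\<omega>\<in>space P. point_count \<Phi> B \<omega> = of_nat k}" for k :: nat
  have A: "range A \<subseteq> sets P" using count_event[OF assms(1)] by (auto simp: A_def)
  have "disjoint_family A"
    unfolding disjoint_family_on_def A_def
    by (auto simp: ennreal_of_nat_eq_real_of_nat)
  then have "(\<lambda>k. prob (A k)) sums prob (\<Union>k. A k)"
    by (rule finite_measure_UNION[OF A])
  moreover have "(\<lambda>k. prob (A k)) sums (exp m * exp (- m))"
  proof -
    have "(\<lambda>k. m ^ k / fact k) sums exp m"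
      using exp_converges[of m] by (simp add: divide_inverse mult.commute)
    from sums_mult2[OF this, of "exp (- m)"] show ?thesis
      by (simp add: A_def prob_point_count[OF assms])
  qed
  ultimately have "prob (\<Union>k. A k) = exp m * exp (- m)" by (rule sums_unique2)
  then have "prob (\<Union>k. A k) = 1" by (simp add: exp_minus)
  then have "AE \<omega> in P. \<omega> \<in> (\<Union>k. A k)"
    using A by (intro prob_Collect_eq_1[THEN iffD1, of "\<lambda>\<omega>. \<omega> \<in> (\<Union>k. A k)"] AE_prob_1) auto
  then show ?thesis by eventually_elim (auto simp: A_def)
qed

lemma sets_Icc_Times:
  assumes "C \<in> sets borel" "C \<subseteq> unit_square" "I \<in> sets borel" "I \<subseteq> {0..t}"
  shows "I \<times> C \<in> sets intensity" "I \<times> C \<subseteq> {0..t} \<times> unit_square"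
  using assms by (auto intro!: intensity_sets_Times(1))

lemma AE_nice: "AE \<omega> in P. nice \<omega>"
proof -
  have "AE \<omega> in P. \<exists>k. point_count \<Phi> ({0..real j} \<times> unit_square) \<omega> = of_nat k" for j
  proof (rule AE_point_count_finite)
    show "{0..real j} \<times> unit_square \<in> sets intensity" by (rule sets_Icc_Times(1)[of _ _ "real j"]) auto
    show "emeasure intensity ({0..real j} \<times> unit_square) = ennreal (real j)"
      by (subst intensity_sets_Times(2)) (auto simp: emeasure_unit_square)
  qed simp
  then have "AE \<omega> in P. \<forall>j::nat. \<exists>k. point_count \<Phi> ({0..real j} \<times> unit_square) \<omega> = of_nat k"
    unfolding AE_all_countable by blast
  then show ?thesis using AE_good
  proof eventually_elim
    case (elim \<omega>)
    have "finite {i. 1 \<le> i \<and> \<tau> i \<omega> \<le> t}" for t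
    proof -
      obtain j :: nat where j: "t \<le> real j" using real_arch_simple by blast
      obtain k where "point_count \<Phi> ({0..real j} \<times> unit_square) \<omega> = of_nat k" using elim by blast
      then have "finite {i. 1 \<le> i \<and> (\<tau> i \<omega>, p i \<omega>) \<in> {0..real j} \<times> unit_square}"
        unfolding point_count_eq_card[OF elim(2)] by blast
      then show ?thesis
        by (rule finite_subset[rotated]) (use j elim(2) good_\<tau>_nonneg in \<open>auto simp: good_def\<close>)
    qed
    then show ?case using elim by (simp add: nice_def)
  qed
qed

lemma nice_K_set:
  assumes "nice \<omega>" shows "{i. 1 \<le> i \<and> \<tau> i \<omega> \<le> t} = {1..K t \<omega>}"
  unfolding K_def
proof (rule down_closed_initial_segment)
  show "finite {i. 1 \<le> i \<and> \<tau> i \<omega> \<le> t}" using assms by (simp add: nice_def)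
  show "j \<in> {i. 1 \<le> i \<and> \<tau> i \<omega> \<le> t}" if "i \<in> {i. 1 \<le> i \<and> \<tau> i \<omega> \<le> t}" "1 \<le> j" "j \<le> i" for i j
    using that good_\<tau>_mono[of \<omega> j i] assms by (auto simp: nice_def)
qed auto

lemma nice_le_K: "nice \<omega> \<Longrightarrow> 1 \<le> i \<Longrightarrow> i \<le> K t \<omega> \<longleftrightarrow> \<tau> i \<omega> \<le> t"
  using nice_K_set[of \<omega> t] by (auto simp: set_eq_iff)

text \<open>The case n = 0 is separate because t may be negative, while
  \<open>\<tau> 0 \<omega> = 0\<close>.\<close>

lemma nice_K_eq:
  assumes "nice \<omega>"
  shows "K t \<omega> = n \<longleftrightarrow> (n = 0 \<or> \<tau> n \<omega> \<le> t) \<and> t < \<tau> (Suc n) \<omega>"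
proof -
  have "K t \<omega> = n \<longleftrightarrow> (n = 0 \<or> n \<le> K t \<omega>) \<and> \<not> Suc n \<le> K t \<omega>" by auto
  then show ?thesis using nice_le_K[OF assms, of n t] nice_le_K[OF assms, of "Suc n" t] by (cases n) auto
qed

lemma K_mono: "nice \<omega> \<Longrightarrow> s \<le> t \<Longrightarrow> K s \<omega> \<le> K t \<omega>"
  unfolding K_def nice_def by (intro card_mono) auto

lemma nice_K_at_\<tau>: "nice \<omega> \<Longrightarrow> K (\<tau> n \<omega>) \<omega> = n"
  unfolding nice_K_eq using good_\<tau>_strict[of \<omega> n "Suc n"] by (simp add: nice_def)

lemma nice_K_at_top:
  assumes "nice \<omega>" shows "filterlim (\<lambda>t. K t \<omega>) at_top at_top"
  unfolding filterlim_at_top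
proof
  fix n
  have "n \<le> K t \<omega>" if "t \<ge> \<tau> n \<omega>" for t
    using K_mono[OF assms that] nice_K_at_\<tau>[OF assms, of n] by simp
  then show "\<forall>\<^sub>F t in at_top. n \<le> K t \<omega>" by (auto simp: eventually_at_top_linorder)
qed

lemma K_measurable [measurable]: "K t \<in> P \<rightarrow>\<^sub>M count_space UNIV"
  unfolding K_def[abs_def] by measurable

lemma K_\<tau>_measurable [measurable]: "(\<lambda>\<omega>. K (\<tau> n \<omega>) \<omega>) \<in> P \<rightarrow>\<^sub>M count_space UNIV"
  unfolding K_def by measurable

section \<open>The process in continuous time and the count at arrival times\<close>

definition M :: "real \<Rightarrow> 'a \<Rightarrow> real" where
  "M t \<omega> = \<MM> (\<lambda>i. \<tau> i \<omega>) (\<lambda>i. p i \<omega>) t"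

lemma M_eq: "M t \<omega> = Z (K t \<omega>) \<omega>"
  by (simp add: M_def \<MM>_eq Z_def S_def strip_sum_def K_def \<beta>_def)

lemma M_nonneg: "M t \<omega> \<ge> 0"
  unfolding M_eq Z_def S_def strip_sum_def by (intro sum_list_nonneg) auto

lemma M_measurable_P [measurable]: "M t \<in> borel_measurable P"
  unfolding M_eq[abs_def] by (rule measurable_compose_countable[OF Z_measurable_P K_measurable])

definition leaf_count :: "nat \<Rightarrow> 'a \<Rightarrow> real" where
  "leaf_count n \<omega> = N (\<lambda>i. \<tau> i \<omega>) (\<lambda>i. p i \<omega>) (\<tau> n \<omega>) 0"

lemma leaf_count_eq: "leaf_count n \<omega> = leaves (K (\<tau> n \<omega>) \<omega>) \<omega> - 1"
  by (simp add: leaf_count_def N_eq leaves_def K_def)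

lemma leaves_measurable_P [measurable]: "leaves n \<in> borel_measurable P"
  unfolding leaves_eq
  using mean_split_bounded_weight[OF mean_split_leaf_poly] by (intro S_measurable_P) (simp add: bounded_weight_def)

lemma leaf_count_measurable [measurable]: "leaf_count n \<in> borel_measurable P"
proof -
  have "(\<lambda>\<omega>. leaves (K (\<tau> n \<omega>) \<omega>) \<omega>) \<in> borel_measurable P"
    by (rule measurable_compose_countable[OF leaves_measurable_P K_\<tau>_measurable])
  then show ?thesis unfolding leaf_count_eq[abs_def] by measurable
qed

lemma AE_leaf_count: "AE \<omega> in P. leaf_count n \<omega> = leaves n \<omega> - 1"
  using AE_nice by eventually_elim (simp add: leaf_count_eq nice_K_at_\<tau>)

lemma converges_L2_leaf_count:
  "converges_L2 P (\<lambda>n \<omega>. real n powr (1 - sqrt 2) * leaf_count n \<omega>) (\<lambda>\<omega>. leaf_const * Z_inf \<omega>)"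
  unfolding converges_L2_def
proof (intro conjI allI)
  have b: "1 - sqrt 2 = - \<beta>" by (simp add: \<beta>_def)
  show "(\<lambda>\<omega>. real n powr (1 - sqrt 2) * leaf_count n \<omega>) \<in> borel_measurable P" for n by measurable
  show "integrable P (\<lambda>\<omega>. (real n powr (1 - sqrt 2) * leaf_count n \<omega>)\<^sup>2)" for n
  proof (rule integrable_const_bound)
    show "AE \<omega> in P. norm ((real n powr (1 - sqrt 2) * leaf_count n \<omega>)\<^sup>2) \<le> (real n powr (1 - sqrt 2) * 2 ^ n)\<^sup>2"
      using AE_leaf_count[of n]
    proof eventually_elim
      case (elim \<omega>)
      have "leaves n \<omega> \<le> 2 ^ n" using length_left_strips[of "\<lambda>i. p i \<omega>" n]
        by (simp add: leaves_def flip: of_nat_le_iff)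
      moreover have "0 \<le> leaves n \<omega>" by (simp add: leaves_def)
      moreover have "(1::real) \<le> 2 ^ n" by simp
      ultimately have "\<bar>leaf_count n \<omega>\<bar> \<le> 2 ^ n" unfolding elim by linarith
      then have "\<bar>real n powr (1 - sqrt 2) * leaf_count n \<omega>\<bar> \<le> real n powr (1 - sqrt 2) * 2 ^ n"
        by (simp add: abs_mult mult_left_mono)
      then have "(real n powr (1 - sqrt 2) * leaf_count n \<omega>)\<^sup>2 \<le> (real n powr (1 - sqrt 2) * 2 ^ n)\<^sup>2"
        by (subst power2_le_iff_abs_le) auto
      then show ?case by simp
    qed
  qed measurable
  show "(\<lambda>\<omega>. leaf_const * Z_inf \<omega>) \<in> borel_measurable P" by measurable
  show "integrable P (\<lambda>\<omega>. (leaf_const * Z_inf \<omega>)\<^sup>2)"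
    using integrable_Z_inf_square by (simp add: power_mult_distrib)
  have "(LINT \<omega>|P. (real n powr (1 - sqrt 2) * leaf_count n \<omega> - leaf_const * Z_inf \<omega>)\<^sup>2) =
     (LINT \<omega>|P. (real n powr (- \<beta>) * (leaves n \<omega> - 1) - leaf_const * Z_inf \<omega>)\<^sup>2)" for n
  proof (rule integral_cong_AE)
    show "AE \<omega> in P. (real n powr (1 - sqrt 2) * leaf_count n \<omega> - leaf_const * Z_inf \<omega>)\<^sup>2 =
       (real n powr (- \<beta>) * (leaves n \<omega> - 1) - leaf_const * Z_inf \<omega>)\<^sup>2"
      using AE_leaf_count[of n] by eventually_elim (simp add: b)
  qed measurable
  then show "(\<lambda>n. LINT \<omega>|P. (real n powr (1 - sqrt 2) * leaf_count n \<omega> - leaf_const * Z_inf \<omega>)\<^sup>2) \<longlonglongrightarrow> 0"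
    using leaves_L2_limit by simp
qed

lemma AE_M_limit: "AE \<omega> in P. ((\<lambda>t. M t \<omega>) \<longlongrightarrow> Z_inf \<omega>) at_top"
  using AE_nice AE_Z_limit
proof eventually_elim
  case (elim \<omega>)
  show ?case unfolding M_eq by (rule filterlim_compose[OF elim(2) nice_K_at_top[OF elim(1)]])
qed

text \<open>Agrees almost surely with \<open>K t \<omega> = n\<close>, but is written with arrival
  times only, so that it belongs to the uncompleted sigma-algebras \<open>past k\<close>.\<close>

definition K_event :: "real \<Rightarrow> nat \<Rightarrow> 'a set" where
  "K_event t n = {\<omega>\<in>space P. (n = 0 \<or> \<tau> n \<omega> \<le> t) \<and> t < \<tau> (Suc n) \<omega>}"

text \<open>Holds even for k = 0, since every \<open>past k\<close> contains all arrival times: the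
  number of points at a fixed time counts as known before any position is revealed.\<close>

lemma K_event_past: "K_event t n \<in> sets (past k)"
proof -
  have [measurable]: "\<tau> (Suc n) \<in> borel_measurable (past k)" by (rule \<tau>_past_measurable) simp
  show ?thesis
  proof (cases "n = 0")
    case True
    have "{\<omega>\<in>space (past k). t < \<tau> (Suc n) \<omega>} \<in> sets (past k)" by measurable
    then show ?thesis using True by (simp add: K_event_def)
  next
    case False
    then have [measurable]: "\<tau> n \<in> borel_measurable (past k)" by (intro \<tau>_past_measurable) simp
    have "{\<omega>\<in>space (past k). \<tau> n \<omega> \<le> t \<and> t < \<tau> (Suc n) \<omega>} \<in> sets (past k)" by measurable
    then show ?thesis using False by (simp add: K_event_def)
  qed
qed

lemma AE_K_event: "AE \<omega> in P. K t \<omega> = n \<longleftrightarrow> \<omega> \<in> K_event t n"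
  using AE_nice AE_space by eventually_elim (simp add: K_event_def nice_K_eq)

section \<open>Second moments at a fixed time\<close>

lemma nn_integral_partition:
  assumes [measurable]: "f \<in> borel_measurable P" "k \<in> P \<rightarrow>\<^sub>M count_space UNIV"
  shows "(\<integral>\<^sup>+\<omega>. f \<omega> \<partial>P) = (\<Sum>n::nat. \<integral>\<^sup>+\<omega>. f \<omega> * indicator {n} (k \<omega>) \<partial>P)"
proof -
  have [measurable]: "(\<lambda>\<omega>. indicator {n} (k \<omega>) :: ennreal) \<in> borel_measurable P" for n
    by (rule measurable_compose[OF assms(2)]) simp
  have "(\<Sum>n. \<integral>\<^sup>+\<omega>. f \<omega> * indicator {n} (k \<omega>) \<partial>P) = (\<integral>\<^sup>+\<omega>. (\<Sum>n. f \<omega> * indicator {n} (k \<omega>)) \<partial>P)"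
    by (rule nn_integral_suminf[symmetric]) measurable
  also have "\<dots> = (\<integral>\<^sup>+\<omega>. f \<omega> \<partial>P)"
  proof (rule nn_integral_cong)
    fix \<omega>
    have "(\<Sum>n. f \<omega> * indicator {n} (k \<omega>)) = (\<Sum>n\<in>{k \<omega>}. f \<omega> * indicator {n} (k \<omega>))"
      by (rule suminf_finite) auto
    then show "(\<Sum>n. f \<omega> * indicator {n} (k \<omega>)) = f \<omega>" by simp
  qed
  finally show ?thesis by simp
qed

lemma Z_nonneg: "Z n \<omega> \<ge> 0"
  unfolding Z_def S_def strip_sum_def by (intro sum_list_nonneg) auto

text \<open>Split by the value n of \<open>K t\<close>. The event lies in \<open>past 0\<close>, so
  the discrete second moment bound holds on it with a constant independent of n, and the
  probabilities add up to 1.\<close>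

lemma nn_integral_M_square: "(\<integral>\<^sup>+\<omega>. ennreal ((M t \<omega>)\<^sup>2) \<partial>P) \<le> ennreal var_bound"
proof -
  have vb: "var_bound \<ge> 0" using decay_pos by (simp add: var_bound_def)
  have HP: "K_event t n \<in> sets P" for n
    using K_event_past[of t n 0] past_subalgebra[of 0] by (auto simp: subalgebra_def)
  have "(\<integral>\<^sup>+\<omega>. ennreal ((M t \<omega>)\<^sup>2) \<partial>P) = (\<Sum>n. \<integral>\<^sup>+\<omega>. ennreal ((M t \<omega>)\<^sup>2) * indicator {n} (K t \<omega>) \<partial>P)"
    by (rule nn_integral_partition) measurable
  also have "\<dots> \<le> (\<Sum>n. ennreal var_bound * emeasure P (K_event t n))"
  proof (intro suminf_le)
    fix n
    have "(\<integral>\<^sup>+\<omega>. ennreal ((M t \<omega>)\<^sup>2) * indicator {n} (K t \<omega>) \<partial>P) = (\<integral>\<^sup>+\<omega>. ennreal (indicator (K_event t n) \<omega> * (Z n \<omega>)\<^sup>2) \<partial>P)"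
    proof (rule nn_integral_cong_AE)
      show "AE \<omega> in P. ennreal ((M t \<omega>)\<^sup>2) * indicator {n} (K t \<omega>) = ennreal (indicator (K_event t n) \<omega> * (Z n \<omega>)\<^sup>2)"
        using AE_K_event[of t n] by eventually_elim (auto simp: M_eq indicator_def)
    qed
    also have "\<dots> = ennreal (expectation (\<lambda>\<omega>. indicator (K_event t n) \<omega> * (Z n \<omega>)\<^sup>2))"
      by (intro nn_integral_eq_integral integrable_products[of n] bounded_rv_indicator K_event_past
          bounded_rv_square bounded_rv_Z) auto
    also have "\<dots> \<le> ennreal (var_bound * prob (K_event t n))"
      by (intro ennreal_leI expectation_Z_square_le K_event_past)
    finally show "(\<integral>\<^sup>+\<omega>. ennreal ((M t \<omega>)\<^sup>2) * indicator {n} (K t \<omega>) \<partial>P) \<le> ennreal var_bound * emeasure P (K_event t n)"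
      using vb by (simp add: emeasure_eq_measure ennreal_mult')
  qed auto
  also have "\<dots> = ennreal var_bound * (\<Sum>n. emeasure P (K_event t n))" by (rule ennreal_suminf_cmult)
  also have "(\<Sum>n. emeasure P (K_event t n)) = (\<Sum>n. \<integral>\<^sup>+\<omega>. 1 * indicator {n} (K t \<omega>) \<partial>P)"
  proof (rule suminf_cong)
    fix n
    have "(\<integral>\<^sup>+\<omega>. 1 * indicator {n} (K t \<omega>) \<partial>P) = (\<integral>\<^sup>+\<omega>. indicator (K_event t n) \<omega> \<partial>P)"
    proof (rule nn_integral_cong_AE)
      show "AE \<omega> in P. 1 * indicator {n} (K t \<omega>) = (indicator (K_event t n) \<omega> :: ennreal)"
        using AE_K_event[of t n] by eventually_elim (auto simp: indicator_def)
    qed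
    then show "emeasure P (K_event t n) = (\<integral>\<^sup>+\<omega>. 1 * indicator {n} (K t \<omega>) \<partial>P)" using HP by simp
  qed
  also have "\<dots> = (\<integral>\<^sup>+\<omega>. 1 \<partial>P)" by (rule nn_integral_partition[symmetric]) measurable
  finally show ?thesis by (simp add: emeasure_space_1)
qed

lemma integrable_M_square: "integrable P (\<lambda>\<omega>. (M t \<omega>)\<^sup>2)"
  using nn_integral_M_square[of t] by (intro integrableI_bounded) (auto intro: le_less_trans)

lemma expectation_M_square: "expectation (\<lambda>\<omega>. (M t \<omega>)\<^sup>2) \<le> var_bound"
proof -
  have "var_bound \<ge> 0" using decay_pos by (simp add: var_bound_def)
  then show ?thesis
    using nn_integral_M_square[of t] nn_integral_eq_integral[OF integrable_M_square, of t] by simp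
qed

lemma integrable_M: "integrable P (M t)"
proof (rule Bochner_Integration.integrable_bound)
  show "integrable P (\<lambda>\<omega>. 1 + (M t \<omega>)\<^sup>2)" using integrable_M_square[of t] by simp
  show "AE \<omega> in P. norm (M t \<omega>) \<le> norm (1 + (M t \<omega>)\<^sup>2)"
  proof (rule AE_I2)
    fix \<omega>
    have "0 \<le> (\<bar>M t \<omega>\<bar> - 1)\<^sup>2" by simp
    then have "2 * \<bar>M t \<omega>\<bar> \<le> 1 + (M t \<omega>)\<^sup>2" by (simp add: power2_eq_square algebra_simps)
    then show "norm (M t \<omega>) \<le> norm (1 + (M t \<omega>)\<^sup>2)" by simp
  qed
qed measurable

text \<open>Follows from boundedness in mean square: above the level c, the modulus of M is at most
  \<open>M^2 / c\<close>, and \<open>c = var_bound / \<epsilon>\<close> makes the mean of this at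
  most \<epsilon>.\<close>

lemma uniformly_integrable_M: "uniformly_integrable P M {0..}"
  unfolding uniformly_integrable_def
proof (intro conjI ballI allI impI)
  show "integrable P (M t)" for t by (rule integrable_M)
  fix \<epsilon> :: real assume e: "\<epsilon> > 0"
  have vb: "var_bound > 0" using decay_pos by (simp add: var_bound_def add_pos_pos)
  define c where "c = var_bound / \<epsilon>"
  have c: "c > 0" using vb e by (simp add: c_def)
  have "(LINT \<omega>|P. \<bar>M t \<omega>\<bar> * indicator {\<omega>. \<bar>M t \<omega>\<bar> \<ge> c} \<omega>) \<le> \<epsilon>" for t
  proof -
    have "(LINT \<omega>|P. \<bar>M t \<omega>\<bar> * indicator {\<omega>. \<bar>M t \<omega>\<bar> \<ge> c} \<omega>) \<le> (LINT \<omega>|P. (M t \<omega>)\<^sup>2 / c)"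
    proof (rule integral_mono')
      show "integrable P (\<lambda>\<omega>. (M t \<omega>)\<^sup>2 / c)" using integrable_M_square by simp
      fix \<omega>
      show "\<bar>M t \<omega>\<bar> * indicator {\<omega>. \<bar>M t \<omega>\<bar> \<ge> c} \<omega> \<le> (M t \<omega>)\<^sup>2 / c"
      proof (cases "\<bar>M t \<omega>\<bar> \<ge> c")
        case True
        then have "c * \<bar>M t \<omega>\<bar> \<le> \<bar>M t \<omega>\<bar> * \<bar>M t \<omega>\<bar>" by (intro mult_right_mono) auto
        then show ?thesis using True c by (simp add: pos_le_divide_eq power2_eq_square mult.commute)
      qed (use c in simp)
      show "0 \<le> (M t \<omega>)\<^sup>2 / c" using c by simp
    qed
    also have "\<dots> \<le> var_bound / c" using expectation_M_square[of t] c by (simp add: divide_right_mono)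
    also have "\<dots> = \<epsilon>" using vb e by (simp add: c_def)
    finally show ?thesis .
  qed
  then show "\<exists>c. \<forall>t\<in>{0..}. (LINT \<omega>|P. \<bar>M t \<omega>\<bar> * indicator {\<omega>. \<bar>M t \<omega>\<bar> \<ge> c} \<omega>) \<le> \<epsilon>" by blast
qed

end

section \<open>Martingale property for the filtration of the point process\<close>

context poisson_atoms begin

abbreviation F :: "real \<Rightarrow> 'a measure" where
  "F t \<equiv> point_filtration P \<Phi> t"

definition F_gen :: "real \<Rightarrow> 'a set set" where
  "F_gen t = {{\<omega>\<in>space P. point_count \<Phi> B \<omega> = of_nat k} | B (k::nat).
         B \<in> sets intensity \<and> B \<subseteq> {0..t} \<times> unit_square} \<union> null_sets P"

lemma F_gen_sets: "F_gen t \<subseteq> sets P"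
  unfolding F_gen_def using count_event by (auto dest: null_setsD2)

lemma F_gen_Pow: "F_gen t \<subseteq> Pow (space P)"
  using F_gen_sets sets.sets_into_space by blast

lemma F_eq: "F t = sigma (space P) (F_gen t)"
  by (simp add: point_filtration_def F_gen_def)

lemma space_F [simp]: "space (F t) = space P"
  unfolding F_eq using F_gen_Pow by (rule space_measure_of)

lemma sets_F: "sets (F t) = sigma_sets (space P) (F_gen t)"
  unfolding F_eq using F_gen_Pow by (rule sets_measure_of)

lemma F_subalgebra: "subalgebra P (F t)"
  unfolding subalgebra_def space_F sets_F using sets.sigma_sets_subset[OF F_gen_sets] by simp

lemma F_sets_P: "A \<in> sets (F t) \<Longrightarrow> A \<in> sets P"
  using F_subalgebra[of t] by (auto simp: subalgebra_def)

lemma filtration_F: "filtration (space P) F"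
proof
  show "sets (F s) \<subseteq> sets (F t)" if "s \<le> t" for s t
    unfolding sets_F
  proof (rule sigma_sets_mono')
    have "{0..s} \<times> unit_square \<subseteq> {0..t} \<times> unit_square" using that by auto
    then show "F_gen s \<subseteq> F_gen t" unfolding F_gen_def by blast
  qed
qed simp

lemma F_count:
  assumes "B \<in> sets intensity" "B \<subseteq> {0..t} \<times> unit_square"
  shows "{\<omega>\<in>space P. point_count \<Phi> B \<omega> = of_nat k} \<in> sets (F t)"
  unfolding sets_F F_gen_def using assms by (intro sigma_sets.Basic) blast

lemma F_null: "A \<in> null_sets P \<Longrightarrow> A \<in> sets (F t)"
  unfolding sets_F F_gen_def by (intro sigma_sets.Basic) blast

text \<open>The filtration contains all null sets, so almost sure equality transfers measurability
  and it is enough to argue on \<open>nice\<close> outcomes.\<close>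

lemma F_complete:
  assumes A: "A \<in> sets P" and A': "A' \<in> sets (F t)" and ae: "AE \<omega> in P. \<omega> \<in> A \<longleftrightarrow> \<omega> \<in> A'"
  shows "A \<in> sets (F t)"
proof -
  have A'P: "A' \<in> sets P" by (rule F_sets_P[OF A'])
  have "AE \<omega> in P. \<omega> \<notin> A - A'" "AE \<omega> in P. \<omega> \<notin> A' - A" using ae by auto
  then have "A - A' \<in> null_sets P" "A' - A \<in> null_sets P"
    using A A'P by (simp_all add: AE_iff_null_sets)
  then have "A' - (A' - A) \<union> (A - A') \<in> sets (F t)"
    by (intro sets.Un sets.Diff A' F_null)
  moreover have "A' - (A' - A) \<union> (A - A') = A" by blast
  ultimately show ?thesis by simp
qed

lemma K_F_measurable: "K t \<in> F t \<rightarrow>\<^sub>M count_space UNIV"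
proof (subst measurable_count_space_eq2_countable; (intro conjI ballI)?)
  fix n
  let ?B = "{0..t} \<times> unit_square"
  have B: "?B \<in> sets intensity" by (rule sets_Icc_Times(1)[of _ _ t]) auto
  have "K t -` {n} \<inter> space P \<in> sets P" by measurable
  moreover have "{\<omega>\<in>space P. point_count \<Phi> ?B \<omega> = of_nat n} \<in> sets (F t)" by (rule F_count[OF B]) simp
  moreover have "AE \<omega> in P. \<omega> \<in> K t -` {n} \<inter> space P \<longleftrightarrow> \<omega> \<in> {\<omega>\<in>space P. point_count \<Phi> ?B \<omega> = of_nat n}"
    using AE_nice
  proof eventually_elim
    case (elim \<omega>)
    have g: "good \<omega>" using elim by (simp add: nice_def)
    have "{i. 1 \<le> i \<and> (\<tau> i \<omega>, p i \<omega>) \<in> ?B} = {i. 1 \<le> i \<and> \<tau> i \<omega> \<le> t}"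
      using g good_\<tau>_nonneg[OF g] by (auto simp: good_def)
    then show ?case
      using elim unfolding nice_def by (auto simp: point_count_eq_card[OF g] K_def)
  qed
  ultimately show "K t -` {n} \<inter> space (F t) \<in> sets (F t)" unfolding space_F by (rule F_complete)
qed auto

text \<open>Reads the i-th position off counts: a time window isolates arrival i, with i - 1 points
  before it and exactly one inside, and a second count restricted to C locates that point. Countably
  many windows suffice.\<close>

lemma mark_event_iff:
  assumes w: "nice \<omega>" and i: "1 \<le> i"
  shows "i \<le> K t \<omega> \<and> p i \<omega> \<in> C \<longleftrightarrow>
    (\<exists>a\<in>\<rat> \<inter> {0..<t}. \<exists>b\<in>\<rat> \<inter> {0..t} \<union> {t}. point_count \<Phi> ({0..a} \<times> unit_square) \<omega> = of_nat (i - 1) \<and>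
       point_count \<Phi> ({a<..b} \<times> unit_square) \<omega> = of_nat 1 \<and>
       point_count \<Phi> ({a<..b} \<times> (C \<inter> unit_square)) \<omega> = of_nat 1)"
    (is "?L \<longleftrightarrow> ?R")
proof -
  have g: "good \<omega>" using w by (simp add: nice_def)
  have sq: "p j \<omega> \<in> unit_square" if "1 \<le> j" for j using g that by (simp add: good_def)
  have pc0: "point_count \<Phi> ({0..a} \<times> unit_square) \<omega> = of_nat n \<longleftrightarrow> K a \<omega> = n" for a n
  proof -
    have "{i. 1 \<le> i \<and> (\<tau> i \<omega>, p i \<omega>) \<in> {0..a} \<times> unit_square} = {i. 1 \<le> i \<and> \<tau> i \<omega> \<le> a}"
      using sq good_\<tau>_nonneg[OF g] by auto
    then show ?thesis using w unfolding nice_def by (simp add: point_count_eq_card[OF g] K_def)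
  qed
  have pc: "point_count \<Phi> ({a<..b} \<times> D) \<omega> = of_nat n \<longleftrightarrow>
      finite {j. 1 \<le> j \<and> a < \<tau> j \<omega> \<and> \<tau> j \<omega> \<le> b \<and> p j \<omega> \<in> D} \<and>
      card {j. 1 \<le> j \<and> a < \<tau> j \<omega> \<and> \<tau> j \<omega> \<le> b \<and> p j \<omega> \<in> D} = n" for a b D n
  proof -
    have "{j. 1 \<le> j \<and> (\<tau> j \<omega>, p j \<omega>) \<in> {a<..b} \<times> D} = {j. 1 \<le> j \<and> a < \<tau> j \<omega> \<and> \<tau> j \<omega> \<le> b \<and> p j \<omega> \<in> D}" by auto
    then show ?thesis unfolding point_count_eq_card[OF g] by simp
  qed
  show ?thesis
  proof
    assume L: ?L
    then have it: "\<tau> i \<omega> \<le> t" using nice_le_K[OF w i] by simp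
    have lt: "\<tau> (i - 1) \<omega> < \<tau> i \<omega>" "\<tau> i \<omega> < \<tau> (Suc i) \<omega>" using i good_\<tau>_strict[OF g] by auto
    obtain a where a: "a \<in> \<rat>" "\<tau> (i - 1) \<omega> < a" "a < \<tau> i \<omega>" using Rats_dense_in_real[OF lt(1)] by blast
    have a0: "0 \<le> a" using good_\<tau>_nonneg[OF g, of "i - 1"] a by simp
    \<comment> \<open>Besides rationals, b may be t itself: if arrival i falls on an irrational t,
      no rational in [0, t] can end the window.\<close>
    obtain b where b: "b \<in> \<rat> \<inter> {0..t} \<union> {t}" "\<tau> i \<omega> \<le> b" "b < \<tau> (Suc i) \<omega>"
    proof (cases "t < \<tau> (Suc i) \<omega>")
      case True
      then show ?thesis using that[of t] it by simp
    next
      case False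
      obtain b where "b \<in> \<rat>" "\<tau> i \<omega> < b" "b < \<tau> (Suc i) \<omega>" using Rats_dense_in_real[OF lt(2)] by blast
      then show ?thesis using that[of b] False good_\<tau>_nonneg[OF g, of i] by simp
    qed
    have Ka: "K a \<omega> = i - 1" unfolding nice_K_eq[OF w] using a i by simp
    have sing: "{j. 1 \<le> j \<and> a < \<tau> j \<omega> \<and> \<tau> j \<omega> \<le> b \<and> p j \<omega> \<in> D} = {i}" if "p i \<omega> \<in> D" for D
    proof (intro equalityI subsetI)
      fix j assume "j \<in> {j. 1 \<le> j \<and> a < \<tau> j \<omega> \<and> \<tau> j \<omega> \<le> b \<and> p j \<omega> \<in> D}"
      then have j: "a < \<tau> j \<omega>" "\<tau> j \<omega> \<le> b" by auto
      have "\<not> j \<le> i - 1" using good_\<tau>_mono[OF g, of j "i - 1"] j a by auto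
      moreover have "\<not> Suc i \<le> j" using good_\<tau>_mono[OF g, of "Suc i" j] j b by auto
      ultimately show "j \<in> {i}" by simp
    qed (use a b i that in auto)
    have "p i \<omega> \<in> C \<inter> unit_square" using sq[OF i] L by simp
    note sing' = sing[OF sq[OF i]] sing[OF this]
    have "point_count \<Phi> ({0..a} \<times> unit_square) \<omega> = of_nat (i - 1) \<and>
       point_count \<Phi> ({a<..b} \<times> unit_square) \<omega> = of_nat 1 \<and>
       point_count \<Phi> ({a<..b} \<times> (C \<inter> unit_square)) \<omega> = of_nat 1"
      unfolding pc0 pc sing' Ka by simp
    moreover have "a \<in> \<rat> \<inter> {0..<t}" using a a0 it by simp
    ultimately show ?R using b(1) by blast
  next
    assume ?R
    then obtain a b where ab: "a \<in> \<rat> \<inter> {0..<t}" "b \<in> \<rat> \<inter> {0..t} \<union> {t}"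
      and 1: "K a \<omega> = i - 1"
      and 2: "card {j. 1 \<le> j \<and> a < \<tau> j \<omega> \<and> \<tau> j \<omega> \<le> b \<and> p j \<omega> \<in> unit_square} = 1"
      and 3: "card {j. 1 \<le> j \<and> a < \<tau> j \<omega> \<and> \<tau> j \<omega> \<le> b \<and> p j \<omega> \<in> C \<inter> unit_square} = 1"
      unfolding pc0 pc by blast
    obtain j where j: "{j. 1 \<le> j \<and> a < \<tau> j \<omega> \<and> \<tau> j \<omega> \<le> b \<and> p j \<omega> \<in> unit_square} = {j}"
      using 2 by (auto simp: card_1_singleton_iff)
    obtain j' where j': "{j. 1 \<le> j \<and> a < \<tau> j \<omega> \<and> \<tau> j \<omega> \<le> b \<and> p j \<omega> \<in> C \<inter> unit_square} = {j'}"
      using 3 by (auto simp: card_1_singleton_iff)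
    have jj: "1 \<le> j' \<and> a < \<tau> j' \<omega> \<and> \<tau> j' \<omega> \<le> b \<and> p j' \<omega> \<in> C \<inter> unit_square" using j' by blast
    have ia: "a < \<tau> i \<omega>" using 1 i unfolding nice_K_eq[OF w] by simp
    \<comment> \<open>The window has a single point, j'. Arrival i is the first one after a, so it
      comes no later than j' and lies in the window too; hence the two agree.\<close>
    have "i \<le> j'"
    proof (rule ccontr)
      assume "\<not> i \<le> j'"
      then have "j' \<le> K a \<omega>" using 1 by simp
      then show False using nice_le_K[OF w, of j' a] jj by simp
    qed
    then have "\<tau> i \<omega> \<le> b" using good_\<tau>_mono[OF g, of i j'] jj by simp
    then have "i \<in> {j. 1 \<le> j \<and> a < \<tau> j \<omega> \<and> \<tau> j \<omega> \<le> b \<and> p j \<omega> \<in> unit_square}" using ia i sq by simp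
    moreover have "j' \<in> {j. 1 \<le> j \<and> a < \<tau> j \<omega> \<and> \<tau> j \<omega> \<le> b \<and> p j \<omega> \<in> unit_square}" using jj by simp
    ultimately have "i = j'" unfolding j by simp
    moreover have "b \<le> t" using ab by auto
    ultimately show ?L using jj nice_le_K[OF w i, of t] by auto
  qed
qed

lemma mark_event_F:
  assumes i: "1 \<le> i" and C: "C \<in> sets borel"
  shows "{\<omega>\<in>space P. i \<le> K t \<omega> \<and> p i \<omega> \<in> C} \<in> sets (F t)"
proof (rule F_complete)
  define E where "E a b = {\<omega>\<in>space P. point_count \<Phi> ({0..a} \<times> unit_square) \<omega> = of_nat (i - 1)} \<inter>
      {\<omega>\<in>space P. point_count \<Phi> ({a<..b} \<times> unit_square) \<omega> = of_nat 1} \<inter>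
      {\<omega>\<in>space P. point_count \<Phi> ({a<..b} \<times> (C \<inter> unit_square)) \<omega> = of_nat 1}" for a b :: real
  let ?U = "\<Union>a\<in>\<rat> \<inter> {0..<t}. \<Union>b\<in>\<rat> \<inter> {0..t} \<union> {t}. E a b"
  note [measurable] = C
  show "{\<omega>\<in>space P. i \<le> K t \<omega> \<and> p i \<omega> \<in> C} \<in> sets P" by measurable
  have cnt: "countable (\<rat> \<inter> X :: real set)" for X using countable_rat by (rule countable_subset[rotated]) auto
  have "E a b \<in> sets (F t)" if "a \<in> \<rat> \<inter> {0..<t}" "b \<in> \<rat> \<inter> {0..t} \<union> {t}" for a b
  proof -
    have ab: "0 \<le> a" "a < t" "b \<le> t" using that by auto
    show ?thesis unfolding E_def
      using ab C by (intro sets.Int F_count sets_Icc_Times[of _ _ t]) auto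
  qed
  then show "?U \<in> sets (F t)"
    by (intro sets.countable_UN'' countable_Un cnt) auto
  show "AE \<omega> in P. \<omega> \<in> {\<omega>\<in>space P. i \<le> K t \<omega> \<and> p i \<omega> \<in> C} \<longleftrightarrow> \<omega> \<in> ?U"
    using AE_nice AE_space
  proof eventually_elim
    case (elim \<omega>)
    then show ?case unfolding E_def using mark_event_iff[OF elim(1) i, of t C] by blast
  qed
qed

text \<open>Positions after time t are replaced by a constant. The strips at time t use only the
  first \<open>K t\<close> points and do not change, while each \<open>seen t i\<close> with i \<ge>
  1 is known at time t.\<close>

definition seen :: "real \<Rightarrow> nat \<Rightarrow> 'a \<Rightarrow> real \<times> real" where
  "seen t i \<omega> = (if i \<le> K t \<omega> then p i \<omega> else (0, 0))"

lemma seen_F: "1 \<le> i \<Longrightarrow> seen t i \<in> F t \<rightarrow>\<^sub>M borel"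
proof (rule measurableI)
  fix C :: "(real \<times> real) set" assume i: "1 \<le> i" and C: "C \<in> sets borel"
  have "seen t i -` C \<inter> space (F t) = {\<omega>\<in>space P. i \<le> K t \<omega> \<and> p i \<omega> \<in> C} \<union>
      (if (0, 0) \<in> C then {\<omega>\<in>space (F t). \<not> i \<le> K t \<omega>} else {})"
    by (auto simp: seen_def split: if_splits)
  moreover have "{\<omega>\<in>space (F t). \<not> i \<le> K t \<omega>} \<in> sets (F t)"
  proof -
    have "K t -` {..<i} \<inter> space (F t) \<in> sets (F t)" by (rule measurable_sets[OF K_F_measurable]) simp
    moreover have "K t -` {..<i} \<inter> space (F t) = {\<omega>\<in>space (F t). \<not> i \<le> K t \<omega>}" by auto
    ultimately show ?thesis by simp
  qed
  ultimately show "seen t i -` C \<inter> space (F t) \<in> sets (F t)"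
    using mark_event_F[OF i C, of t] by simp
qed simp

lemma M_F_measurable: "M t \<in> borel_measurable (F t)"
proof -
  define f where "f n \<omega> = (\<Sum>r\<leftarrow>left_strips (\<lambda>i. seen t i \<omega>) n. strip_area r powr \<beta>)" for n \<omega>
  have f: "f n \<in> borel_measurable (F t)" for n
    unfolding f_def by (intro measurable_left_strips_sum seen_F) simp_all
  have "M t \<omega> = f (K t \<omega>) \<omega>" for \<omega>
  proof -
    have "left_strips (\<lambda>i. p i \<omega>) (K t \<omega>) = left_strips (\<lambda>i. seen t i \<omega>) (K t \<omega>)"
      by (rule left_strips_cong) (simp add: seen_def)
    then show ?thesis by (simp add: M_eq f_def Z_def S_def strip_sum_def)
  qed
  then have "M t = (\<lambda>\<omega>. f (K t \<omega>) \<omega>)" by (rule ext)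
  then show ?thesis using measurable_compose_countable[OF f K_F_measurable] by simp
qed

text \<open>Where \<open>K s\<close> equals k, only the first k points lie in [0, s], so an event of
  the time filtration coincides there with one about those points and the arrival times. This links
  the two filtrations.\<close>

lemma F_trace_past:
  assumes "A \<in> sets (F s)"
  shows "\<exists>A'\<in>sets (past k). AE \<omega> in P. (\<omega> \<in> A \<and> K s \<omega> = k) \<longleftrightarrow> \<omega> \<in> A'"
proof -
  have "A \<in> sigma_sets (space P) (F_gen s)" using assms by (simp add: sets_F)
  then show ?thesis
  proof induction
    case (Basic A)
    then consider B n where "A = {\<omega>\<in>space P. point_count \<Phi> B \<omega> = of_nat n}" "B \<in> sets intensity" "B \<subseteq> {0..s} \<times> unit_square"
      | "A \<in> null_sets P"
      by (auto simp: F_gen_def)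
    then show ?case
    proof cases
      case (1 B n)
      have "B \<in> sets borel"
      proof -
        have "({0..} :: real set) \<times> unit_square \<in> sets (borel \<Otimes>\<^sub>M borel)" by (intro pair_measureI) auto
        then have "({0..} :: real set) \<times> unit_square \<in> sets lborel" by (simp only: borel_prod sets_lborel)
        then have "B \<in> sets lborel" using 1(2) unfolding intensity_def by (subst (asm) sets_restrict_space_iff) auto
        then show ?thesis by simp
      qed
      define D where "D \<omega> = {i. i \<in> {1..k} \<and> (\<tau> i \<omega>, p i \<omega>) \<in> B}" for \<omega>
      have [measurable]: "(\<lambda>\<omega>. card (D \<omega>)) \<in> past k \<rightarrow>\<^sub>M count_space UNIV"
      proof (rule measurable_card)
        fix i
        show "{\<omega>\<in>space (past k). i \<in> D \<omega>} \<in> sets (past k)"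
        proof (cases "i \<in> {1..k}")
          case True
          then have [measurable]: "\<tau> i \<in> borel_measurable (past k)" "p i \<in> past k \<rightarrow>\<^sub>M borel"
            by (auto intro!: \<tau>_past_measurable p_past_measurable)
          have "(\<lambda>\<omega>. (\<tau> i \<omega>, p i \<omega>)) \<in> past k \<rightarrow>\<^sub>M borel"
            by (intro borel_measurable_Pair) simp_all
          from measurable_sets[OF this \<open>B \<in> sets borel\<close>] show ?thesis
            using True by (simp add: D_def vimage_def Int_def conj_commute)
        next
          case False
          then have "{\<omega>\<in>space (past k). i \<in> D \<omega>} = {}" unfolding D_def by blast
          then show ?thesis by (simp only: sets.empty_sets)
        qed
      qed
      have "(\<lambda>\<omega>. card (D \<omega>)) -` {n} \<inter> space (past k) \<in> sets (past k)" by measurable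
      then have A': "(\<lambda>\<omega>. card (D \<omega>)) -` {n} \<inter> space P \<inter> K_event s k \<in> sets (past k)"
        using K_event_past[of s k k] by (simp add: sets.Int)
      have "AE \<omega> in P. (\<omega> \<in> A \<and> K s \<omega> = k) \<longleftrightarrow> \<omega> \<in> (\<lambda>\<omega>. card (D \<omega>)) -` {n} \<inter> space P \<inter> K_event s k"
        using AE_nice AE_K_event[of s k] AE_space
      proof eventually_elim
        case (elim \<omega>)
        have g: "good \<omega>" using elim by (simp add: nice_def)
        have "D \<omega> = {i. 1 \<le> i \<and> (\<tau> i \<omega>, p i \<omega>) \<in> B}" if "K s \<omega> = k"
        proof -
          have "i \<le> k" if "1 \<le> i" "(\<tau> i \<omega>, p i \<omega>) \<in> B" for i
            using nice_le_K[OF elim(1) that(1), of s] that(2) 1(3) \<open>K s \<omega> = k\<close> by auto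
          then show ?thesis by (auto simp: D_def)
        qed
        moreover have "finite (D \<omega>)" by (simp add: D_def)
        ultimately have "K s \<omega> = k \<Longrightarrow> point_count \<Phi> B \<omega> = of_nat n \<longleftrightarrow> card (D \<omega>) = n"
          unfolding point_count_eq_card[OF g] by simp
        then show ?case using elim by (auto simp: 1(1))
      qed
      with A' show ?thesis by blast
    next
      case 2
      then have "AE \<omega> in P. \<omega> \<notin> A" by (rule AE_not_in)
      then have "AE \<omega> in P. (\<omega> \<in> A \<and> K s \<omega> = k) \<longleftrightarrow> \<omega> \<in> {}" by eventually_elim simp
      then show ?thesis by (intro bexI[of _ "{}"]) auto
    qed
  next
    case Empty
    show ?case by (intro bexI[of _ "{}"]) auto
  next
    case (Compl A)
    then obtain A' where A': "A' \<in> sets (past k)" "AE \<omega> in P. (\<omega> \<in> A \<and> K s \<omega> = k) \<longleftrightarrow> \<omega> \<in> A'" by blast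
    \<comment> \<open>The complement is taken inside the event that \<open>K s\<close> equals k,
      which itself belongs to \<open>past k\<close>.\<close>
    have "AE \<omega> in P. (\<omega> \<in> space P - A \<and> K s \<omega> = k) \<longleftrightarrow> \<omega> \<in> K_event s k - A'"
      using A'(2) AE_K_event[of s k] AE_space by eventually_elim auto
    moreover have "K_event s k - A' \<in> sets (past k)" using K_event_past A'(1) by (rule sets.Diff)
    ultimately show ?case by blast
  next
    case (Union A)
    then have "\<forall>i. \<exists>A'. A' \<in> sets (past k) \<and> (AE \<omega> in P. (\<omega> \<in> A i \<and> K s \<omega> = k) \<longleftrightarrow> \<omega> \<in> A')" by blast
    then obtain A' where A': "\<And>i. A' i \<in> sets (past k)" "\<And>i. AE \<omega> in P. (\<omega> \<in> A i \<and> K s \<omega> = k) \<longleftrightarrow> \<omega> \<in> A' i"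
      by metis
    have "AE \<omega> in P. \<forall>i. (\<omega> \<in> A i \<and> K s \<omega> = k) \<longleftrightarrow> \<omega> \<in> A' i" unfolding AE_all_countable using A'(2) by blast
    then have "AE \<omega> in P. (\<omega> \<in> (\<Union>i. A i) \<and> K s \<omega> = k) \<longleftrightarrow> \<omega> \<in> (\<Union>i. A' i)" by eventually_elim auto
    moreover have "(\<Union>i. A' i) \<in> sets (past k)" using A'(1) by auto
    ultimately show ?case by blast
  qed
qed

text \<open>Split by the values k of \<open>K s\<close> and n of \<open>K t\<close>. On each piece M
  is Z at a fixed step, and the piece is almost surely an event of \<open>past k\<close> although it
  also fixes n, because \<open>past k\<close> knows the later arrival times; the discrete martingale
  property then applies.\<close>

lemma nn_integral_M_conditional:
  assumes A: "A \<in> sets (F s)" and st: "s \<le> t"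
  shows "(\<integral>\<^sup>+\<omega>. ennreal (M t \<omega>) * indicator A \<omega> \<partial>P) = (\<integral>\<^sup>+\<omega>. ennreal (M s \<omega>) * indicator A \<omega> \<partial>P)"
proof -
  have [measurable]: "A \<in> sets P" by (rule F_sets_P[OF A])
  have ind [measurable]: "(\<lambda>\<omega>. indicator {n} (K u \<omega>) :: ennreal) \<in> borel_measurable P" for n u
    by (rule measurable_compose[OF K_measurable]) simp
  have part: "(\<integral>\<^sup>+\<omega>. ennreal (M u \<omega>) * indicator A \<omega> \<partial>P) =
    (\<Sum>k. \<Sum>n. \<integral>\<^sup>+\<omega>. ennreal (M u \<omega>) * indicator A \<omega> * indicator {k} (K s \<omega>) * indicator {n} (K t \<omega>) \<partial>P)" for u
  proof -
    have "(\<integral>\<^sup>+\<omega>. ennreal (M u \<omega>) * indicator A \<omega> \<partial>P) = (\<Sum>k. \<integral>\<^sup>+\<omega>. ennreal (M u \<omega>) * indicator A \<omega> * indicator {k} (K s \<omega>) \<partial>P)"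
      by (rule nn_integral_partition) measurable
    also have "\<dots> = (\<Sum>k. \<Sum>n. \<integral>\<^sup>+\<omega>. ennreal (M u \<omega>) * indicator A \<omega> * indicator {k} (K s \<omega>) * indicator {n} (K t \<omega>) \<partial>P)"
      by (intro suminf_cong nn_integral_partition) measurable
    finally show ?thesis .
  qed
  have "(\<integral>\<^sup>+\<omega>. ennreal (M t \<omega>) * indicator A \<omega> * indicator {k} (K s \<omega>) * indicator {n} (K t \<omega>) \<partial>P) =
     (\<integral>\<^sup>+\<omega>. ennreal (M s \<omega>) * indicator A \<omega> * indicator {k} (K s \<omega>) * indicator {n} (K t \<omega>) \<partial>P)" for k n
  proof -
    obtain A' where A': "A' \<in> sets (past k)" "AE \<omega> in P. (\<omega> \<in> A \<and> K s \<omega> = k) \<longleftrightarrow> \<omega> \<in> A'"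
      using F_trace_past[OF A] by blast
    define H where "H = A' \<inter> K_event t n"
    have H: "H \<in> sets (past k)" unfolding H_def by (intro sets.Int A'(1) K_event_past)
    have ae: "AE \<omega> in P. (\<omega> \<in> A \<and> K s \<omega> = k \<and> K t \<omega> = n) \<longleftrightarrow> \<omega> \<in> H"
      using A'(2) AE_K_event[of t n] by eventually_elim (auto simp: H_def)
    have eq: "(\<integral>\<^sup>+\<omega>. ennreal (M u \<omega>) * indicator A \<omega> * indicator {k} (K s \<omega>) * indicator {n} (K t \<omega>) \<partial>P) =
       (\<integral>\<^sup>+\<omega>. ennreal (indicator H \<omega> * Z j \<omega>) \<partial>P)"
      if "\<And>\<omega>. K s \<omega> = k \<Longrightarrow> K t \<omega> = n \<Longrightarrow> M u \<omega> = Z j \<omega>" for u j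
    proof (rule nn_integral_cong_AE)
      show "AE \<omega> in P. ennreal (M u \<omega>) * indicator A \<omega> * indicator {k} (K s \<omega>) * indicator {n} (K t \<omega>) = ennreal (indicator H \<omega> * Z j \<omega>)"
        using ae by eventually_elim (auto simp: indicator_def that)
    qed
    show ?thesis
    proof (cases "k \<le> n")
      case True
      have b: "bounded_rv k (indicator H)" by (rule bounded_rv_indicator[OF H])
      have i: "integrable P (\<lambda>\<omega>. indicator H \<omega> * Z n \<omega>)"
        by (rule integrable_products[OF bounded_rv_le[OF b True] bounded_rv_Z])
      have i': "integrable P (\<lambda>\<omega>. indicator H \<omega> * Z k \<omega>)"
        by (rule integrable_products[OF b bounded_rv_Z])
      have "(\<integral>\<^sup>+\<omega>. ennreal (indicator H \<omega> * Z n \<omega>) \<partial>P) = (\<integral>\<^sup>+\<omega>. ennreal (indicator H \<omega> * Z k \<omega>) \<partial>P)"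
        using expectation_mult_Z[OF b True] Z_nonneg
        by (simp add: nn_integral_eq_integral[OF i] nn_integral_eq_integral[OF i'])
      then show ?thesis using eq[of t n] eq[of s k] by (simp add: M_eq)
    next
      \<comment> \<open>Pieces with k > n are null, as \<open>K\<close> is nondecreasing in
        time.\<close>
      case False
      have "AE \<omega> in P. ennreal (M u \<omega>) * indicator A \<omega> * indicator {k} (K s \<omega>) * indicator {n} (K t \<omega>) = 0" for u
        using AE_nice
      proof eventually_elim
        case (elim \<omega>)
        then show ?case using K_mono[OF elim st] False by (auto simp: indicator_def)
      qed
      then have "(\<integral>\<^sup>+\<omega>. ennreal (M u \<omega>) * indicator A \<omega> * indicator {k} (K s \<omega>) * indicator {n} (K t \<omega>) \<partial>P) = (\<integral>\<^sup>+\<omega>. 0 \<partial>P)" for u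
        by (intro nn_integral_cong_AE)
      then show ?thesis by simp
    qed
  qed
  then show ?thesis unfolding part by simp
qed

text \<open>The conditional expectation is identified by integrals over the sets of
  \<open>F s\<close>; since M is nonnegative, these can be compared as nonnegative
  integrals.\<close>

lemma martingale_M: "martingale P F M"
  unfolding martingale_def
proof (intro conjI allI impI)
  show "filtration (space P) F" by (rule filtration_F)
  show "subalgebra P (F t)" for t by (rule F_subalgebra)
  show "M t \<in> borel_measurable (F t)" for t by (rule M_F_measurable)
  show "integrable P (M t)" for t by (rule integrable_M)
  fix s t :: real assume "0 \<le> s \<and> s \<le> t"
  then have st: "s \<le> t" by simp
  interpret fs: finite_measure_subalgebra P "F s"
    by unfold_locales (rule F_subalgebra)
  show "AE \<omega> in P. real_cond_exp P (F s) (M t) \<omega> = M s \<omega>"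
  proof (rule fs.real_cond_exp_charact)
    fix A assume A: "A \<in> sets (F s)"
    have [measurable]: "A \<in> sets P" by (rule F_sets_P[OF A])
    have e: "ennreal (set_lebesgue_integral P A (M u)) = (\<integral>\<^sup>+\<omega>. ennreal (M u \<omega>) * indicator A \<omega> \<partial>P)" for u
    proof -
      have "integrable P (\<lambda>\<omega>. indicator A \<omega> * M u \<omega>)"
        using integrable_M by (intro integrable_real_mult_indicator[of A P "M u", unfolded mult.commute[of "M u _"]]) auto
      from nn_integral_eq_integral[OF this] M_nonneg
      have "ennreal (set_lebesgue_integral P A (M u)) = (\<integral>\<^sup>+\<omega>. ennreal (indicator A \<omega> * M u \<omega>) \<partial>P)"
        by (simp add: set_lebesgue_integral_def)
      also have "\<dots> = (\<integral>\<^sup>+\<omega>. ennreal (M u \<omega>) * indicator A \<omega> \<partial>P)"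
        by (intro nn_integral_cong) (auto simp: indicator_def)
      finally show ?thesis .
    qed
    have nn: "0 \<le> set_lebesgue_integral P A (M u)" for u
      unfolding set_lebesgue_integral_def using M_nonneg by (intro Bochner_Integration.integral_nonneg) auto
    show "set_lebesgue_integral P A (M t) = set_lebesgue_integral P A (M s)"
      using nn_integral_M_conditional[OF A st] nn by (simp add: e[symmetric])
  qed (auto intro: integrable_M M_F_measurable)
qed

end

theorem corollary3p2:
  fixes P :: "'a measure"
    and \<Phi> :: "'a \<Rightarrow> (real \<times> real \<times> real) set"
    and \<tau> :: "nat \<Rightarrow> 'a \<Rightarrow> real"
    and p :: "nat \<Rightarrow> 'a \<Rightarrow> real \<times> real"
  defines "M \<equiv> \<lambda>t \<omega>. \<MM> (\<lambda>i. \<tau> i \<omega>) (\<lambda>i. p i \<omega>) t"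
  assumes "prob_space P"
    and "poisson_point_process P intensity \<Phi>"
    and "ranked_atoms P \<Phi> \<tau> p"
  shows "martingale P (point_filtration P \<Phi>) M \<and>
    uniformly_integrable P M {0..} \<and>
    (\<exists>M_inf. M_inf \<in> borel_measurable P \<and>
       (AE \<omega> in P. ((\<lambda>t. M t \<omega>) \<longlongrightarrow> M_inf \<omega>) at_top) \<and>
       converges_L2 P
         (\<lambda>n \<omega>. real n powr (1 - sqrt 2) * N (\<lambda>i. \<tau> i \<omega>) (\<lambda>i. p i \<omega>) (\<tau> n \<omega>) 0)
         (\<lambda>\<omega>. Gamma (2 * sqrt 2) / (sqrt 2 * Gamma (sqrt 2) ^ 3) * M_inf \<omega>))"
proof -
  interpret A: poisson_atoms P \<Phi> \<tau> p
    using assms(2-4) by (simp add: poisson_atoms_def poisson_atoms_axioms_def)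
  have M: "M = A.M" by (simp add: M_def A.M_def fun_eq_iff)
  show ?thesis
    unfolding M using A.martingale_M A.uniformly_integrable_M A.Z_inf_measurable A.AE_M_limit
      A.converges_L2_leaf_count[unfolded A.leaf_count_def leaf_const_def] by blast
qed

end
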